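(* Suppose that there is a nonmeager subset of $\mathbb{R}$ of cardinality $\omega_1$ (this holds, e.g., under the continuum hypothesis). Then: (1) There is an equivalent norm on the Hilbert space $\ell_2(\omega_1)$ such that $\ell_2(\omega_1)$ with this norm does not admit an uncountable equilateral set. (2) There is a nonseparable Hilbert generated Banach space $\mathcal{X}$ such that every nonseparable (closed linear) subspace of $\mathcal{X}$ contains a subspace isomorphic to $\ell_2$, and the unit sphere of $\mathcal{X}$ admits neither an uncountable equilateral set nor, for any $\varepsilon>0$, an uncountable $(1+\varepsilon)$-separated set.
   Context: A Banach space $\mathcal{X}$ is Hilbert generated if there is a bounded linear operator from a Hilbert space into $\mathcal{X}$ with dense range. A set $\mathcal{Y}$ in a Banach space is $\delta$-equilateral if $\|y-y'\|=\delta$ for all distinct $y,y'\in\mathcal{Y}$, and equilateral if it is $\delta$-equilateral for some $\delta>0$; it is $\delta$-separated if $\|y-y'\|\geq\delta$ for all distinct $y,y'\in\mathcal{Y}$. $\ell_2(\omega_1)$ is the Hilbert space of square-summable real functions on the first uncountable ordinal $\omega_1$. *)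

theory Defs
  imports "HOL-Analysis.Analysis" "HOL-Library.Function_Algebras"
begin

instantiation "fun" :: (type, real_vector) real_vector
begin
definition scaleR_fun :: "real \<Rightarrow> ('a \<Rightarrow> 'b) \<Rightarrow> 'a \<Rightarrow> 'b" where
  "scaleR_fun c f = (\<lambda>i. c *\<^sub>R f i)"
instance
  by standard (auto simp: scaleR_fun_def fun_eq_iff scaleR_add_right scaleR_add_left)
end

definition card_omega1 :: "'a set \<Rightarrow> bool" where
  "card_omega1 A \<longleftrightarrow> ordIso2 (card_of A) (cardSuc natLeq)"

definition nowhere_dense :: "'a::topological_space set \<Rightarrow> bool" where
  "nowhere_dense S \<longleftrightarrow> interior (closure S) = {}"

definition meager :: "'a::topological_space set \<Rightarrow> bool" where
  "meager A \<longleftrightarrow> (\<exists>F :: nat \<Rightarrow> 'a set. (\<forall>n. nowhere_dense (F n)) \<and> A \<subseteq> (\<Union>n. F n))"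

definition is_norm_on :: "'v::real_vector set \<Rightarrow> ('v \<Rightarrow> real) \<Rightarrow> bool" where
  "is_norm_on V N \<longleftrightarrow> subspace V \<and>
     (\<forall>x\<in>V. N x \<ge> 0 \<and> (N x = 0 \<longleftrightarrow> x = 0)) \<and>
     (\<forall>x\<in>V. \<forall>c. N (c *\<^sub>R x) = \<bar>c\<bar> * N x) \<and>
     (\<forall>x\<in>V. \<forall>y\<in>V. N (x + y) \<le> N x + N y)"

definition complete_wrt :: "'v::real_vector set \<Rightarrow> ('v \<Rightarrow> real) \<Rightarrow> bool" where
  "complete_wrt V N \<longleftrightarrow> (\<forall>s :: nat \<Rightarrow> 'v. (\<forall>n. s n \<in> V) \<longrightarrow>
      (\<forall>e>0. \<exists>M. \<forall>m\<ge>M. \<forall>n\<ge>M. N (s m - s n) < e) \<longrightarrow>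
      (\<exists>x\<in>V. (\<lambda>n. N (s n - x)) \<longlonglongrightarrow> 0))"

definition banach_space :: "'v::real_vector set \<Rightarrow> ('v \<Rightarrow> real) \<Rightarrow> bool" where
  "banach_space V N \<longleftrightarrow> is_norm_on V N \<and> complete_wrt V N"

definition dense_in :: "'v::real_vector set \<Rightarrow> 'v set \<Rightarrow> ('v \<Rightarrow> real) \<Rightarrow> bool" where
  "dense_in D V N \<longleftrightarrow> (\<forall>x\<in>V. \<forall>e>0. \<exists>d\<in>D. N (x - d) < e)"

definition separable_wrt :: "'v::real_vector set \<Rightarrow> ('v \<Rightarrow> real) \<Rightarrow> bool" where
  "separable_wrt V N \<longleftrightarrow> (\<exists>D. countable D \<and> D \<subseteq> V \<and> dense_in D V N)"

definition closed_subspace_of :: "'v::real_vector set \<Rightarrow> 'v set \<Rightarrow> ('v \<Rightarrow> real) \<Rightarrow> bool" where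
  "closed_subspace_of W V N \<longleftrightarrow> subspace W \<and> W \<subseteq> V \<and>
     (\<forall>s :: nat \<Rightarrow> 'v. \<forall>x\<in>V. (\<forall>n. s n \<in> W) \<longrightarrow> (\<lambda>n. N (s n - x)) \<longlonglongrightarrow> 0 \<longrightarrow> x \<in> W)"

definition linear_on_set :: "'v::real_vector set \<Rightarrow> ('v \<Rightarrow> 'w::real_vector) \<Rightarrow> bool" where
  "linear_on_set S T \<longleftrightarrow> (\<forall>x\<in>S. \<forall>y\<in>S. T (x + y) = T x + T y) \<and>
     (\<forall>x\<in>S. \<forall>c. T (c *\<^sub>R x) = c *\<^sub>R T x)"

definition l2_space :: "'i set \<Rightarrow> ('i \<Rightarrow> real) set" where
  "l2_space \<Gamma> = {f. (\<forall>i. i \<notin> \<Gamma> \<longrightarrow> f i = 0) \<and> (\<lambda>i. (f i)\<^sup>2) summable_on UNIV}"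

definition l2_norm :: "('i \<Rightarrow> real) \<Rightarrow> real" where
  "l2_norm f = sqrt (\<Sum>\<^sub>\<infinity>i. (f i)\<^sup>2)"

definition equivalent_norm :: "'v::real_vector set \<Rightarrow> ('v \<Rightarrow> real) \<Rightarrow> ('v \<Rightarrow> real) \<Rightarrow> bool" where
  "equivalent_norm V N0 N \<longleftrightarrow> is_norm_on V N \<and>
     (\<exists>c C. 0 < c \<and> 0 < C \<and> (\<forall>x\<in>V. c * N0 x \<le> N x \<and> N x \<le> C * N0 x))"

definition hilbert_generated_by :: "'i set \<Rightarrow> 'v::real_vector set \<Rightarrow> ('v \<Rightarrow> real) \<Rightarrow> bool" where
  "hilbert_generated_by \<Gamma> V N \<longleftrightarrow> (\<exists>T. T ` l2_space \<Gamma> \<subseteq> V \<and> linear_on_set (l2_space \<Gamma>) T \<and>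
     (\<exists>C. \<forall>x\<in>l2_space \<Gamma>. N (T x) \<le> C * l2_norm x) \<and> dense_in (T ` l2_space \<Gamma>) V N)"

definition contains_l2 :: "'v::real_vector set \<Rightarrow> ('v \<Rightarrow> real) \<Rightarrow> bool" where
  "contains_l2 W N \<longleftrightarrow> (\<exists>T :: (nat \<Rightarrow> real) \<Rightarrow> 'v. T ` l2_space UNIV \<subseteq> W \<and>
     linear_on_set (l2_space UNIV) T \<and>
     (\<exists>c C. 0 < c \<and> (\<forall>x\<in>l2_space UNIV. c * l2_norm x \<le> N (T x) \<and> N (T x) \<le> C * l2_norm x)))"

definition equilateral :: "('v::real_vector \<Rightarrow> real) \<Rightarrow> 'v set \<Rightarrow> bool" where
  "equilateral N Y \<longleftrightarrow> (\<exists>\<delta>>0. \<forall>y\<in>Y. \<forall>y'\<in>Y. y \<noteq> y' \<longrightarrow> N (y - y') = \<delta>)"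

definition separated :: "('v::real_vector \<Rightarrow> real) \<Rightarrow> real \<Rightarrow> 'v set \<Rightarrow> bool" where
  "separated N \<delta> Y \<longleftrightarrow> (\<forall>y\<in>Y. \<forall>y'\<in>Y. y \<noteq> y' \<longrightarrow> N (y - y') \<ge> \<delta>)"

definition unit_sphere_of :: "'v::real_vector set \<Rightarrow> ('v \<Rightarrow> real) \<Rightarrow> 'v set" where
  "unit_sphere_of V N = {x\<in>V. N x = 1}"

end

(*
  A nonmeager set of reals of size omega_1 yields a scale f_i (i < omega_1) of increasing functions in
  nat => nat that is unbounded modulo finite sets. The number of times f_i overtakes f_j can be
  prescribed, up to a bounded error, simultaneously for all i in a and j in b, for suitable a, b in any
  uncountable family of disjoint finite sets (Todorcevic's oscillation argument). Colouring the pair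
  {i, j} according to a block structure on this number gives a graph c on omega_1 such that every
  uncountable family of disjoint finite sets has two members with all cross pairs joined and two
  members with no cross pair joined.

  Let hnorm c x be the supremum of the l2-norms of x over finite cliques of c. For finitely supported
  x, y with disjoint supports, hnorm c (x - y) is the maximum of the two norms if no cross pair is
  joined, and at least sqrt 2 times the minimum if all are. A Delta-system argument brings any
  uncountable separated set into this position up to a small error, so the distances in it cannot be
  constant, neither for hnorm c nor for l2_norm + hnorm c, and on the unit sphere of hnorm c some
  distance is at most 1 + epsilon. Inside a nonseparable subspace one finds almost disjointly
  supported vectors that are large at the points of an infinite clique; these span a copy of l2.
*)

theory Submission
  imports Defs "HOL-Library.Countable_Set_Type"
begin

subsection \<open>Oscillations of unbounded families\<close>

text \<open>Nonmeagerness enters only through unboundedness: no single function dominates the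
  omega_1 many functions built from the set, while every countable part of the scale is dominated by
  a later member. Oscillation numbers are prescribed only up to an error, since nothing is known of
  the tuples on an initial stretch that is fixed at the start; the length of this stretch bounds the
  error, whatever number is aimed at. The clique norm lies between the sup norm (no edges) and the
  l2 norm (all edges). It is not equivalent to the l2 norm, as infinite independent sets of the
  graph span copies of c_0, so on the Hilbert space it is added to the l2 norm. For disjointly
  supported vectors of nearly equal l2 norm the l2 summand of the distance is nearly constant, and
  comparing a joined with an unjoined pair is decided by the clique summand alone. Equilateral sets
  need both colours, the bound 1 + epsilon only unjoined pairs, the copies of l2 only joined
  ones.\<close>

lemma uncountable_mono: "uncountable A \<Longrightarrow> A \<subseteq> B \<Longrightarrow> uncountable B"
  using countable_subset by blast

lemma uncountable_UN_nat:
  assumes "uncountable A" "A \<subseteq> (\<Union>n::nat. B n)"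
  obtains n where "uncountable (A \<inter> B n)"
proof -
  have "A = (\<Union>n. A \<inter> B n)" using assms(2) by auto
  then have "\<not> (\<forall>n. countable (A \<inter> B n))"
    using assms(1) countable_UN[of UNIV "\<lambda>n. A \<inter> B n"] by auto
  then show ?thesis using that by blast
qed

lemma uncountable_common_value:
  assumes "uncountable A" "countable (f ` A)"
  obtains v where "uncountable {x \<in> A. f x = v}"
proof -
  have "A = (\<Union>v\<in>f ` A. {x \<in> A. f x = v})" by auto
  then have "\<not> (\<forall>v\<in>f ` A. countable {x \<in> A. f x = v})"
    using assms countable_UN[of "f ` A" "\<lambda>v. {x \<in> A. f x = v}"] by auto
  then show ?thesis using that by blast
qed

text \<open>Todorcevic's oscillation number is the number of these places. Only changes of the lead
  from \<open>v\<close> to \<open>u\<close> are recorded, so a full alternation counts once; the set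
  is finite as soon as \<open>u\<close> is eventually below \<open>v\<close>.\<close>

definition crossings :: "(nat \<Rightarrow> nat) \<Rightarrow> (nat \<Rightarrow> nat) \<Rightarrow> nat set" where
  "crossings u v = {x. u x \<le> v x \<and> v (Suc x) < u (Suc x)}"

text \<open>By \<open>anti\<close> the function \<open>u\<close> never newly gets ahead between
  \<open>M\<close> and \<open>N\<close>; \<open>v\<close> may overtake there, which is not
  counted.\<close>

lemma card_crossings_no_change:
  assumes "M \<le> N"
    and anti: "\<And>x. M \<le> x \<Longrightarrow> x < N \<Longrightarrow> v (Suc x) < u (Suc x) \<Longrightarrow> v x < u x"
  shows "card (crossings u v \<inter> {..<N}) = card (crossings u v \<inter> {..<M})"
proof -
  have "x < M" if "x \<in> crossings u v" "x < N" for x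
    using anti[of x] that by (force simp: crossings_def)
  then have "crossings u v \<inter> {..<N} = crossings u v \<inter> {..<M}"
    using assms(1) by auto
  then show ?thesis by simp
qed

text \<open>A lead of \<open>u\<close>, once gained, persists up to \<open>N\<close>, so the only
  new crossing is the predecessor \<open>z\<close> of the first place \<open>y\<close> from
  \<open>M\<close> on at which \<open>u\<close> leads.\<close>

lemma card_crossings_one_change:
  assumes "M \<le> N"
    and mono: "\<And>x. M \<le> x \<Longrightarrow> x < N \<Longrightarrow> v x < u x \<Longrightarrow> v (Suc x) < u (Suc x)"
    and M: "\<not> v M < u M" and N: "v N < u N"
  shows "card (crossings u v \<inter> {..<N}) = Suc (card (crossings u v \<inter> {..<M}))"
proof -
  define y where "y = (LEAST x. M \<le> x \<and> v x < u x)"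
  have y: "M \<le> y" "v y < u y" "y \<le> N"
    using LeastI[of "\<lambda>x. M \<le> x \<and> v x < u x" N] Least_le[of "\<lambda>x. M \<le> x \<and> v x < u x" N] N assms(1)
    unfolding y_def by auto
  have least: "\<not> v x < u x" if "M \<le> x" "x < y" for x
    using not_less_Least[of x "\<lambda>x. M \<le> x \<and> v x < u x"] that unfolding y_def by auto
  have "y \<noteq> M" using y M by auto
  then obtain z where z: "y = Suc z" "M \<le> z" using y(1) by (cases y) auto
  have up: "v x < u x" if "y \<le> x" "x \<le> N" for x
    using that
  proof (induction x rule: dec_induct)
    case base then show ?case using y by simp
  next
    case (step x) then show ?case using mono[of x] y by auto
  qed
  have "crossings u v \<inter> {..<N} = insert z (crossings u v \<inter> {..<M})"
  proof (intro set_eqI iffI)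
    fix x assume x: "x \<in> crossings u v \<inter> {..<N}"
    show "x \<in> insert z (crossings u v \<inter> {..<M})"
    proof (cases "x < M")
      case False
      have "\<not> y \<le> x" using up[of x] x by (auto simp: crossings_def)
      moreover have "\<not> Suc x < y" using least[of "Suc x"] x False by (auto simp: crossings_def)
      ultimately show ?thesis using z by auto
    qed (use x in auto)
  next
    fix x assume "x \<in> insert z (crossings u v \<inter> {..<M})"
    then show "x \<in> crossings u v \<inter> {..<N}"
      using z y least[of z] \<open>M \<le> N\<close> by (auto simp: crossings_def not_less)
  qed
  moreover have "z \<notin> crossings u v \<inter> {..<M}" using z by auto
  ultimately show ?thesis by simp
qed

text \<open>Applied to the finitely many values of the members of a tuple before a place where all of
  them are unbounded: up to that place each value is either below a fixed bound or above the
  given level.\<close>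
lemma uncountable_gap:
  fixes h :: "'v \<Rightarrow> 'k \<Rightarrow> nat"
  assumes "finite V" and unc: "\<And>l. uncountable {k \<in> K. Q l k}"
    and anti: "\<And>l l' k. l \<le> l' \<Longrightarrow> Q l' k \<Longrightarrow> Q l k"
  shows "\<exists>C. \<forall>l. uncountable {k \<in> K. Q l k \<and> (\<forall>v\<in>V. h v k \<le> C \<or> l \<le> h v k)}"
  using assms(1)
proof (induction V)
  case empty then show ?case using unc by simp
next
  case (insert w V)
  then obtain C where C: "\<And>l. uncountable {k \<in> K. Q l k \<and> (\<forall>v\<in>V. h v k \<le> C \<or> l \<le> h v k)}" by blast
  define G where "G l = {k \<in> K. Q l k \<and> (\<forall>v\<in>V. h v k \<le> C \<or> l \<le> h v k)}" for l
  have G: "uncountable (G l)" for l using C unfolding G_def .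
  have Ganti: "G l' \<subseteq> G l" if "l \<le> l'" for l l' 
    using that anti[OF that] unfolding G_def by (auto dest: order_trans)
  \<comment> \<open>Either a fixed bound \<open>c\<close> on the value \<open>w\<close> leaves
    uncountably many members at every level and is absorbed into \<open>C\<close>, or no bound does.
    Then the bound \<open>l\<close> itself fails at some level \<open>l'\<close>, and at the larger
    of the two levels all but countably many members have a value above \<open>l\<close>.\<close>
  show ?case
  proof (cases "\<exists>c. \<forall>l. uncountable {k \<in> G l. h w k \<le> c}")
    case True
    then obtain c where c: "\<And>l. uncountable {k \<in> G l. h w k \<le> c}" by blast
    have "{k \<in> G l. h w k \<le> c} \<subseteq> {k \<in> K. Q l k \<and> (\<forall>v\<in>insert w V. h v k \<le> max c C \<or> l \<le> h v k)}" for l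
      unfolding G_def by (auto simp: le_max_iff_disj)
    then have "uncountable {k \<in> K. Q l k \<and> (\<forall>v\<in>insert w V. h v k \<le> max c C \<or> l \<le> h v k)}" for l
      by (rule uncountable_mono[OF c])
    then show ?thesis by blast
  next
    case False
    have "uncountable {k \<in> K. Q l k \<and> (\<forall>v\<in>insert w V. h v k \<le> C \<or> l \<le> h v k)}" for l
    proof -
      obtain l' where l': "countable {k \<in> G l'. h w k \<le> l}" using False by blast
      have "countable {k \<in> G (max l l'). h w k \<le> l}"
        by (rule countable_subset[OF _ l']) (use Ganti[of l' "max l l'"] in auto)
      then have "uncountable (G (max l l') - {k \<in> G (max l l'). h w k \<le> l})"
        using G uncountable_minus_countable by blast
      moreover have "G (max l l') - {k \<in> G (max l l'). h w k \<le> l} \<subseteq>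
         {k \<in> K. Q l k \<and> (\<forall>v\<in>insert w V. h v k \<le> C \<or> l \<le> h v k)}"
        using Ganti[of l "max l l'"] unfolding G_def by auto
      ultimately show ?thesis by (rule uncountable_mono)
    qed
    then show ?thesis by blast
  qed
qed

section \<open>Tuples that overtake each other a prescribed number of times\<close>

text \<open>What disjoint n-tuples inherit from a scale of length omega_1; \<open>\<phi> k j\<close>
  is the j-th function of the tuple \<open>k\<close>. By \<open>unbounded\<close>, for all but
  countably many tuples there are infinitely many places at which all n functions exceed a given
  \<open>g\<close> simultaneously.\<close>

locale unbounded_tuples =
  fixes \<phi> :: "'k \<Rightarrow> nat \<Rightarrow> nat \<Rightarrow> nat" and K :: "'k set" and n :: nat
  assumes uncountable_K: "uncountable K"
    and mono_\<phi>: "k \<in> K \<Longrightarrow> j < n \<Longrightarrow> mono (\<phi> k j)"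
    and unbounded: "countable {k \<in> K. \<forall>\<^sub>F x in sequentially. \<exists>j<n. \<phi> k j x \<le> g x}"
    and directed: "countable D \<Longrightarrow> D \<subseteq> K \<Longrightarrow>
       \<exists>g. (\<forall>k\<in>D. \<forall>j<n. \<forall>\<^sub>F x in sequentially. \<phi> k j x < g x) \<and>
           countable {k \<in> K. \<not> (\<forall>j<n. \<forall>\<^sub>F x in sequentially. g x \<le> \<phi> k j x)}"
begin

lemma \<phi>_le: "k \<in> K \<Longrightarrow> j < n \<Longrightarrow> x \<le> y \<Longrightarrow> \<phi> k j x \<le> \<phi> k j y"
  using mono_\<phi> by (auto simp: mono_def)

text \<open>By monotonicity each function of the tuple skips the values strictly between
  \<open>C\<close> and \<open>l\<close> in a single step, different functions possibly at different
  places. Where exactly is irrelevant against a function whose values stay in that gap.\<close>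

definition jumps :: "nat \<Rightarrow> nat \<Rightarrow> nat \<Rightarrow> 'k \<Rightarrow> bool" where
  "jumps N C l k \<longleftrightarrow> (\<forall>j<n. l \<le> \<phi> k j N \<and> (\<forall>x<N. \<phi> k j x \<le> C \<or> l \<le> \<phi> k j x))"

lemma uncountable_bounded_at:
  assumes "uncountable A"
  obtains c where "uncountable {k \<in> A. \<forall>j<n. \<phi> k j N \<le> c}"
proof -
  have "A \<subseteq> (\<Union>c. {k. \<forall>j<n. \<phi> k j N \<le> c})"
  proof
    fix k
    have "\<forall>j<n. \<phi> k j N \<le> (\<Sum>j<n. \<phi> k j N)" 
      by (auto intro!: member_le_sum)
    then show "k \<in> (\<Union>c. {k. \<forall>j<n. \<phi> k j N \<le> c})" by blast
  qed
  then obtain c where "uncountable (A \<inter> {k. \<forall>j<n. \<phi> k j N \<le> c})" using uncountable_UN_nat[OF assms] by blast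
  then show ?thesis using that[of c] by (simp add: Int_def)
qed

text \<open>If at every place from \<open>N\<close> on some level were reached by only countably
  many members, these levels would form a function \<open>g\<close> that contradicts
  \<open>unbounded\<close>. Both \<open>N'\<close> and \<open>C\<close> are uniform in
  \<open>l\<close>, so the height of the jump may be chosen later.\<close>

lemma ex_jump:
  assumes A: "A \<subseteq> K" "uncountable A"
  obtains N' C where "N \<le> N'" "c \<le> C" "\<And>l. uncountable {k \<in> A. jumps N' C l k}"
proof -
  have "\<exists>N'\<ge>N. \<forall>l. uncountable {k \<in> A. \<forall>j<n. l \<le> \<phi> k j N'}"
  proof (rule ccontr)
    assume "\<not> ?thesis"
    then have "\<forall>x. \<exists>l. N \<le> x \<longrightarrow> countable {k \<in> A. \<forall>j<n. l \<le> \<phi> k j x}" by blast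
    from choice[OF this] obtain g
      where g: "\<And>x. N \<le> x \<Longrightarrow> countable {k \<in> A. \<forall>j<n. g x \<le> \<phi> k j x}" by blast
    have "countable (\<Union>x\<in>{N..}. {k \<in> A. \<forall>j<n. g x \<le> \<phi> k j x})" 
      by (rule countable_UN) (use g in auto)
    then have "uncountable (A - (\<Union>x\<in>{N..}. {k \<in> A. \<forall>j<n. g x \<le> \<phi> k j x}))"
      using A(2) uncountable_minus_countable by blast
    moreover have "A - (\<Union>x\<in>{N..}. {k \<in> A. \<forall>j<n. g x \<le> \<phi> k j x}) \<subseteq> {k \<in> K. \<forall>\<^sub>F x in sequentially. \<exists>j<n. \<phi> k j x \<le> g x}"
      using A(1) unfolding eventually_sequentially by (fastforce simp: not_le intro: less_imp_le)
    ultimately show False using unbounded countable_subset by blast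
  qed
  then obtain N' where N': "N \<le> N'" "\<And>l. uncountable {k \<in> A. \<forall>j<n. l \<le> \<phi> k j N'}" by blast
  have "\<exists>C. \<forall>l. uncountable {k \<in> A. (\<forall>j<n. l \<le> \<phi> k j N') \<and>
      (\<forall>v\<in>{..<n} \<times> {..<N'}. \<phi> k (fst v) (snd v) \<le> C \<or> l \<le> \<phi> k (fst v) (snd v))}"
    by (rule uncountable_gap) (use N'(2) in \<open>auto dest: order_trans\<close>)
  then obtain C where C: "\<And>l. uncountable {k \<in> A. (\<forall>j<n. l \<le> \<phi> k j N') \<and>
      (\<forall>v\<in>{..<n} \<times> {..<N'}. \<phi> k (fst v) (snd v) \<le> C \<or> l \<le> \<phi> k (fst v) (snd v))}" by blast
  have "uncountable {k \<in> A. jumps N' (max c C) l k}" for l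
    using C[of l] by (rule contrapos_nn) (erule countable_subset[rotated], force simp: jumps_def le_max_iff_disj)
  then show ?thesis using that[of N' "max c C"] N'(1) by simp
qed

definition count :: "nat \<Rightarrow> 'k \<Rightarrow> nat \<Rightarrow> 'k \<Rightarrow> nat \<Rightarrow> nat" where
  "count M a i b j = card (crossings (\<phi> a i) (\<phi> b j) \<inter> {..<M})"

text \<open>A stage of the construction of two members that overtake each other in turn: the members of
  \<open>A\<close> are ahead of those of \<open>B\<close> at \<open>M\<close>, while \<open>B\<close> is still free to jump above any given value
  before \<open>N\<close>. The values up to \<open>N\<close> that precede the jump are bounded by \<open>C\<close> in advance, so the next
  jump of \<open>A\<close> can be chosen above all of them.\<close>
definition zigzag :: "'k set \<Rightarrow> nat \<Rightarrow> nat \<Rightarrow> bool" where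
  "zigzag L H q \<longleftrightarrow> (\<exists>A B M N C. A \<subseteq> L \<and> B \<subseteq> L \<and> uncountable A \<and> M \<le> N \<and>
     (\<forall>l. uncountable {b \<in> B. jumps N C l b}) \<and>
     (\<forall>b\<in>B. \<forall>j<n. \<phi> b j M \<le> C) \<and> (\<forall>a\<in>A. \<forall>i<n. C < \<phi> a i M) \<and>
     (\<forall>a\<in>A. \<forall>b\<in>B. \<forall>i<n. \<forall>j<n. count M a i b j \<in> {q..q + H}))"

lemma zigzagE:
  assumes "zigzag L H q"
  obtains A B M N C where "A \<subseteq> L" "B \<subseteq> L" "uncountable A" "M \<le> N"
     "\<And>l. uncountable {b \<in> B. jumps N C l b}"
     "\<And>b j. b\<in>B \<Longrightarrow> j<n \<Longrightarrow> \<phi> b j M \<le> C" "\<And>a i. a\<in>A \<Longrightarrow> i<n \<Longrightarrow> C < \<phi> a i M"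
     "\<And>a b i j. a\<in>A \<Longrightarrow> b\<in>B \<Longrightarrow> i < n \<Longrightarrow> j<n \<Longrightarrow> count M a i b j \<in> {q..q + H}"
  using assms unfolding zigzag_def
  apply (elim exE conjE)
  subgoal for A B M N C by (rule that[of A B M N C]) simp_all
  done

text \<open>Between \<open>M\<close> and \<open>N\<close> the values of \<open>a\<close> lie in the
  gap that \<open>b\<close> skips. If \<open>b\<close> is behind at \<open>Suc x\<close>, it has not
  jumped yet and was behind at \<open>x\<close> already: \<open>a\<close> may lose the lead there
  but cannot regain it.\<close>

lemma count_jump_over:
  assumes "a \<in> K" "b \<in> K" "i < n" "j < n" "M \<le> N"
    and "jumps N C l b" "C < \<phi> a i M" "\<phi> a i N < l"
  shows "count N a i b j = count M a i b j"
  unfolding count_def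
proof (rule card_crossings_no_change[OF \<open>M \<le> N\<close>])
  fix x assume x: "M \<le> x" "x < N" "\<phi> b j (Suc x) < \<phi> a i (Suc x)"
  have "\<phi> b j x \<le> C"
  proof (rule ccontr)
    assume "\<not> ?thesis"
    then have "l \<le> \<phi> b j x" using assms x unfolding jumps_def by auto
    moreover have "\<phi> b j x \<le> \<phi> b j (Suc x)" "\<phi> a i (Suc x) \<le> \<phi> a i N" using \<phi>_le assms x by auto
    ultimately show False using x assms by linarith
  qed
  moreover have "\<phi> a i M \<le> \<phi> a i x" using \<phi>_le assms x by auto
  ultimately show "\<phi> b j x < \<phi> a i x" using assms by linarith
qed

text \<open>Here the values of \<open>b\<close> lie in the gap that \<open>a\<close> skips. Wherever
  a function of \<open>a\<close> is ahead it has completed its jump, so it stays ahead up to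
  \<open>N\<close>.\<close>

lemma count_overtake:
  assumes "a \<in> K" "b \<in> K" "i < n" "j < n" "M \<le> N"
    and "jumps N C l a" "\<phi> a i M \<le> C" "C < \<phi> b j M" "\<phi> b j N < l"
  shows "count N a i b j = Suc (count M a i b j)"
  unfolding count_def
proof (rule card_crossings_one_change[OF \<open>M \<le> N\<close>])
  show "\<not> \<phi> b j M < \<phi> a i M" using assms by auto
  show "\<phi> b j N < \<phi> a i N" using assms unfolding jumps_def by (meson order_less_le_trans)
  fix x assume x: "M \<le> x" "x < N" "\<phi> b j x < \<phi> a i x"
  have "l \<le> \<phi> a i x"
  proof (rule ccontr)
    assume "\<not> ?thesis"
    then have "\<phi> a i x \<le> C" using assms x unfolding jumps_def by auto
    moreover have "\<phi> b j M \<le> \<phi> b j x" using \<phi>_le assms x by auto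
    ultimately show False using x assms by linarith
  qed
  moreover have "\<phi> a i x \<le> \<phi> a i (Suc x)" "\<phi> b j (Suc x) \<le> \<phi> b j N" using \<phi>_le assms x by auto
  ultimately show "\<phi> b j (Suc x) < \<phi> a i (Suc x)" using assms by linarith
qed

text \<open>The additive error arises here: up to the place \<open>M\<close> nothing is known of the
  counts except that they are at most \<open>M\<close>. All later stages raise every count by
  exactly one, so this \<open>H\<close> is final.\<close>

lemma zigzag_0:
  assumes L: "L \<subseteq> K" "uncountable L"
  shows "\<exists>H. zigzag L H 0"
proof -
  obtain M C0 where W: "\<And>l. uncountable {k \<in> L. jumps M C0 l k}" by (rule ex_jump[OF L, of 0 0]) blast
  obtain c where c: "uncountable {k \<in> L. \<forall>j<n. \<phi> k j M \<le> c}" (is "uncountable ?B") by (rule uncountable_bounded_at[OF L(2)])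
  obtain N C where N: "M \<le> N" "c \<le> C" "\<And>l. uncountable {k \<in> ?B. jumps N C l k}"
    by (rule ex_jump[OF _ c, of M c]) (use L(1) in auto)
  have cnt: "count M a i b j \<in> {0..0 + M}" for a i b j
    using card_mono[of "{..<M}" "crossings (\<phi> a i) (\<phi> b j) \<inter> {..<M}"] unfolding count_def by auto
  have "zigzag L M 0"
    unfolding zigzag_def
    apply (rule exI[of _ "{k \<in> L. jumps M C0 (Suc C) k}"], rule exI[of _ ?B], rule exI[of _ M], rule exI[of _ N], rule exI[of _ C])
    using W[of "Suc C"] N cnt by (auto simp: jumps_def Suc_le_eq dest: order_trans)
  then show ?thesis by blast
qed

text \<open>The members of \<open>B\<close> take the lead by \<open>N\<close> and those of
  \<open>A\<close> regain it by \<open>N1\<close>, which adds one to each count. The next jump of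
  \<open>A\<close> is prepared before the pending jump of \<open>B\<close> is carried out, because
  its bound \<open>C1\<close> must be known when the height \<open>l\<close> is chosen; likewise
  \<open>C2\<close> must be known before \<open>l2\<close>.\<close>

lemma zigzag_Suc:
  assumes L: "L \<subseteq> K" and z: "zigzag L H q"
  shows "zigzag L H (Suc q)"
proof -
  obtain A B M N C where AB: "A \<subseteq> L" "B \<subseteq> L" "uncountable A" "M \<le> N"
     and B: "\<And>l. uncountable {b \<in> B. jumps N C l b}"
     and M: "\<And>b j. b\<in>B \<Longrightarrow> j<n \<Longrightarrow> \<phi> b j M \<le> C" "\<And>a i. a\<in>A \<Longrightarrow> i<n \<Longrightarrow> C < \<phi> a i M"
     and cnt: "\<And>a b i j. a\<in>A \<Longrightarrow> b\<in>B \<Longrightarrow> i < n \<Longrightarrow> j<n \<Longrightarrow> count M a i b j \<in> {q..q + H}"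
    by (rule zigzagE[OF z]) (rule that)
  obtain c1 where c1: "uncountable {k \<in> A. \<forall>j<n. \<phi> k j N \<le> c1}" (is "uncountable ?A") by (rule uncountable_bounded_at[OF AB(3)])
  obtain N1 C1 where N1: "N \<le> N1" "c1 \<le> C1" "\<And>l. uncountable {k \<in> ?A. jumps N1 C1 l k}"
    by (rule ex_jump[OF _ c1, of N c1]) (use L AB in auto)
  define l where "l = Suc (max C C1)"
  obtain c0 where c0: "uncountable {k \<in> {b \<in> B. jumps N C l b}. \<forall>j<n. \<phi> k j N1 \<le> c0}" (is "uncountable ?B")
    by (rule uncountable_bounded_at[OF B])
  obtain N2 C2 where N2: "N1 \<le> N2" "c0 \<le> C2" "\<And>l. uncountable {k \<in> ?B. jumps N2 C2 l k}"
    by (rule ex_jump[OF _ c0, of N1 c0]) (use L AB in auto)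
  define l2 where "l2 = Suc (max C1 C2)"
  let ?A' = "{k \<in> ?A. jumps N1 C1 l2 k}"
  have count: "count N1 a i b j = Suc (count M a i b j)" if "a \<in> ?A'" "b \<in> ?B" "i < n" "j < n" for a b i j
  proof -
    have K: "a \<in> K" "b \<in> K" using that AB L by auto
    have "count N a i b j = count M a i b j"
      by (rule count_jump_over[OF K that(3,4) AB(4), of C l]) (use that M N1 l_def in fastforce)+
    moreover have "count N1 a i b j = Suc (count N a i b j)"
    proof (rule count_overtake[OF K that(3,4) N1(1), of C1 l2])
      show "C1 < \<phi> b j N" using that unfolding jumps_def l_def by auto
      show "\<phi> b j N1 < l2" using that N2 unfolding l2_def by fastforce
    qed (use that N1 in fastforce)+
    ultimately show ?thesis by simp
  qed
  show ?thesis
    unfolding zigzag_def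
  proof (rule exI[of _ ?A'], rule exI[of _ ?B], rule exI[of _ N1], rule exI[of _ N2], rule exI[of _ C2], intro conjI)
    show "?A' \<subseteq> L" "?B \<subseteq> L" "uncountable ?A'" "N1 \<le> N2" using AB N1 N2 by auto
    show "\<forall>l. uncountable {b \<in> ?B. jumps N2 C2 l b}" using N2 by blast
    show "\<forall>b\<in>?B. \<forall>j<n. \<phi> b j N1 \<le> C2" using N2(2) by (auto dest: order_trans)
    show "\<forall>a\<in>?A'. \<forall>i<n. C2 < \<phi> a i N1" by (auto simp: jumps_def l2_def)
    show "\<forall>a\<in>?A'. \<forall>b\<in>?B. \<forall>i<n. \<forall>j<n. count N1 a i b j \<in> {Suc q..Suc q + H}"
    proof (intro ballI allI impI)
      fix a b i j assume *: "a \<in> ?A'" "b \<in> ?B" "i < n" "j < n"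
      then have "count M a i b j \<in> {q..q + H}" using cnt by auto
      then show "count N1 a i b j \<in> {Suc q..Suc q + H}" using count[OF *] by auto
    qed
  qed
qed

text \<open>For each \<open>N\<close> there are only countably many initial segments of length
  \<open>N\<close>, and one representative of each suffices. Countability is what lets
  \<open>directed\<close> supply a function above all of \<open>D\<close>.\<close>

lemma ex_countable_dense:
  obtains D where "countable D" "D \<subseteq> K" "\<And>k N. k \<in> K \<Longrightarrow> \<exists>d\<in>D. \<forall>j<n. \<forall>x\<le>N. \<phi> d j x = \<phi> k j x"
proof -
  define code where "code N k = map (\<lambda>j. map (\<phi> k j) [0..<Suc N]) [0..<n]" for N k
  define D where "D = (\<Union>N. (\<lambda>s. SOME k. k \<in> K \<and> code N k = s) ` (code N ` K))"
  have code: "(SOME k'. k' \<in> K \<and> code N k' = code N k) \<in> K" "code N (SOME k'. k' \<in> K \<and> code N k' = code N k) = code N k"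
    if "k \<in> K" for N k using someI[of "\<lambda>k'. k' \<in> K \<and> code N k' = code N k" k] that by auto
  show ?thesis
  proof
    have "countable ((\<lambda>s. SOME k. k \<in> K \<and> code N k = s) ` (code N ` K))" for N
      by (rule countable_image) (rule countableI_type)
    then show "countable D" unfolding D_def by blast
    show "D \<subseteq> K" unfolding D_def using code by auto
    fix k N assume "k \<in> K"
    then have "(SOME k'. k' \<in> K \<and> code N k' = code N k) \<in> D" unfolding D_def by blast
    moreover have "\<forall>j<n. \<forall>x\<le>N. \<phi> d j x = \<phi> k j x" if "code N d = code N k" for d
      using that unfolding code_def by (auto simp: list_eq_iff_nth_eq simp del: upt_Suc)
    ultimately show "\<exists>d\<in>D. \<forall>j<n. \<forall>x\<le>N. \<phi> d j x = \<phi> k j x" using code(2)[OF \<open>k \<in> K\<close>, of N] by blast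
  qed
qed

text \<open>A zigzag controls the counts only up to \<open>N\<close>. Beyond it the lead of
  \<open>b\<close> is made permanent by a function \<open>g\<close> that separates the countable set
  \<open>D\<close>, which supplies \<open>a\<close>, from all but countably many members, which
  supply \<open>b\<close>.\<close>

theorem oscillation:
  "\<exists>H. \<forall>q. \<exists>a\<in>K. \<exists>b\<in>K. a \<noteq> b \<and> (\<forall>i<n. \<forall>j<n.
     (\<forall>\<^sub>F x in sequentially. \<phi> a i x < \<phi> b j x) \<and> card (crossings (\<phi> a i) (\<phi> b j)) \<in> {q..q + H})"
proof -
  obtain D where D: "countable D" "D \<subseteq> K" "\<And>k N. k \<in> K \<Longrightarrow> \<exists>d\<in>D. \<forall>j<n. \<forall>x\<le>N. \<phi> d j x = \<phi> k j x"
    by (rule ex_countable_dense) (rule that)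
  obtain g where g: "\<And>k j. k\<in>D \<Longrightarrow> j<n \<Longrightarrow> \<forall>\<^sub>F x in sequentially. \<phi> k j x < g x"
    and g': "countable {k \<in> K. \<not> (\<forall>j<n. \<forall>\<^sub>F x in sequentially. g x \<le> \<phi> k j x)}" (is "countable ?E")
    using directed[OF D(1,2)] by blast
  have fin: "(\<forall>\<^sub>F x in sequentially. \<forall>j<n. P j x) \<longleftrightarrow> (\<forall>j<n. \<forall>\<^sub>F x in sequentially. P j x)" for P :: "nat \<Rightarrow> nat \<Rightarrow> bool"
    using eventually_ball_finite_distrib[of "{..<n}" "\<lambda>x j. P j x" sequentially] by (simp add: Ball_def)
  have "K - ?E \<subseteq> (\<Union>N. {k. \<forall>x\<ge>N. \<forall>j<n. g x \<le> \<phi> k j x})"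
  proof
    fix k assume "k \<in> K - ?E"
    then have "\<forall>j<n. \<forall>\<^sub>F x in sequentially. g x \<le> \<phi> k j x" by blast
    then have "\<forall>\<^sub>F x in sequentially. \<forall>j<n. g x \<le> \<phi> k j x" by (rule fin[THEN iffD2])
    then show "k \<in> (\<Union>N. {k. \<forall>x\<ge>N. \<forall>j<n. g x \<le> \<phi> k j x})"
      unfolding eventually_sequentially by blast
  qed
  \<comment> \<open>Uncountably many members are above \<open>g\<close> from a common place on; the
    zigzags are built inside this set \<open>?L\<close>.\<close>
  then obtain N0 where N0: "uncountable ((K - ?E) \<inter> {k. \<forall>x\<ge>N0. \<forall>j<n. g x \<le> \<phi> k j x})" (is "uncountable ?L")
    by (rule uncountable_UN_nat[OF uncountable_minus_countable[OF uncountable_K g']])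
  have L: "?L \<subseteq> K" by auto
  obtain H where "zigzag ?L H 0" using zigzag_0[OF L N0] by blast
  then have zig: "zigzag ?L H q" for q by (induction q) (use zigzag_Suc[OF L] in auto)
  show ?thesis
  proof (intro exI allI)
    fix q
    obtain A B M N C where AB: "A \<subseteq> ?L" "B \<subseteq> ?L" "uncountable A" "M \<le> N"
     and B: "\<And>l. uncountable {b \<in> B. jumps N C l b}"
     and M: "\<And>b j. b\<in>B \<Longrightarrow> j<n \<Longrightarrow> \<phi> b j M \<le> C" "\<And>a i. a\<in>A \<Longrightarrow> i<n \<Longrightarrow> C < \<phi> a i M"
     and cnt: "\<And>a b i j. a\<in>A \<Longrightarrow> b\<in>B \<Longrightarrow> i < n \<Longrightarrow> j<n \<Longrightarrow> count M a i b j \<in> {q..q + H}"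
      by (rule zigzagE[OF zig[of q]]) (rule that)
    obtain a0 where a0: "a0 \<in> A" using AB(3) by fastforce
    then have "a0 \<in> K" using AB(1) by auto
    \<comment> \<open>The member \<open>a0\<close> is exchanged for one of \<open>D\<close> with the
      same values up to \<open>N\<close>, so its counts before \<open>M\<close> are unchanged and
      \<open>g\<close> eventually dominates it.\<close>
    then obtain a where a: "a \<in> D" "\<And>j x. j<n \<Longrightarrow> x\<le>N \<Longrightarrow> \<phi> a j x = \<phi> a0 j x" using D(3) by meson
    have aK: "a \<in> K" using a D by auto
    have "\<forall>\<^sub>F x in sequentially. \<forall>j<n. \<phi> a j x < g x"
      by (rule fin[THEN iffD2]) (use g[OF a(1)] in blast)
    then obtain m0 where m0: "\<And>x j. x \<ge> m0 \<Longrightarrow> j < n \<Longrightarrow> \<phi> a j x < g x" unfolding eventually_sequentially by blast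
    define m where "m = max m0 (max N0 N)"
    \<comment> \<open>The jump of \<open>b\<close> clears all values of \<open>a\<close> up to
      \<open>m\<close>, and beyond \<open>m\<close> the function \<open>g\<close> keeps the two
      apart.\<close>
    define l where "l = Suc (\<Sum>j<n. \<phi> a j m)"
    have l: "\<phi> a i m < l" if "i < n" for i
      using that unfolding l_def less_Suc_eq_le by (intro member_le_sum) auto
    obtain b where b: "b \<in> B" "jumps N C l b" "b \<noteq> a"
    proof -
      have "uncountable ({b \<in> B. jumps N C l b} - {a})" using B uncountable_minus_countable by blast
      then have "{b \<in> B. jumps N C l b} - {a} \<noteq> {}" by (metis countable_empty)
      then show ?thesis using that by blast
    qed
    have bK: "b \<in> K" "b \<in> ?L" using b AB by auto
    have above: "\<phi> a i x < \<phi> b j x" if ij: "i < n" "j < n" and x: "N \<le> x" for i j x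
    proof (cases "x \<le> m")
      case True
      have "\<phi> a i x \<le> \<phi> a i m" "\<phi> b j N \<le> \<phi> b j x" "l \<le> \<phi> b j N"
        using True x ij \<phi>_le aK bK b(2) by (auto simp: jumps_def)
      then show ?thesis using l[OF ij(1)] by linarith
    next
      case False
      then have "\<phi> a i x < g x" "g x \<le> \<phi> b j x" using m0 ij bK(2) unfolding m_def by auto
      then show ?thesis by simp
    qed
    have "card (crossings (\<phi> a i) (\<phi> b j)) \<in> {q..q + H}" if ij: "i < n" "j < n" for i j
    proof -
      have "x < N" if "x \<in> crossings (\<phi> a i) (\<phi> b j)" for x
        using above[OF ij, of "Suc x"] that by (force simp: crossings_def not_less[symmetric])
      then have "crossings (\<phi> a i) (\<phi> b j) \<inter> {..<N} = crossings (\<phi> a i) (\<phi> b j)" by auto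
      then have "card (crossings (\<phi> a i) (\<phi> b j)) = count N a i b j" unfolding count_def by simp
      also have "\<dots> = count M a i b j"
      proof (rule count_jump_over[OF aK bK(1) ij AB(4) b(2)])
        show "C < \<phi> a i M" using M(2)[OF a0 ij(1)] a(2)[OF ij(1)] AB by simp
        show "\<phi> a i N < l" using l[OF ij(1)] \<phi>_le[OF aK ij(1), of N m] unfolding m_def by linarith
      qed
      also have "\<dots> = count M a0 i b j"
      proof -
        have "crossings (\<phi> a i) (\<phi> b j) \<inter> {..<M} = crossings (\<phi> a0 i) (\<phi> b j) \<inter> {..<M}"
          using a(2)[OF ij(1)] AB(4) by (auto simp: crossings_def)
        then show ?thesis unfolding count_def by simp
      qed
      finally show ?thesis using cnt[OF a0 b(1) ij] by simp
    qed
    moreover have "\<forall>\<^sub>F x in sequentially. \<phi> a i x < \<phi> b j x" if "i < n" "j < n" for i j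
      using above[OF that] unfolding eventually_sequentially by blast
    ultimately show "\<exists>a\<in>K. \<exists>b\<in>K. a \<noteq> b \<and> (\<forall>i<n. \<forall>j<n.
     (\<forall>\<^sub>F x in sequentially. \<phi> a i x < \<phi> b j x) \<and> card (crossings (\<phi> a i) (\<phi> b j)) \<in> {q..q + H})"
      using aK bK b(3) by (intro bexI[of _ a] bexI[of _ b]) simp_all
  qed
qed

end

subsection \<open>A colouring from a nonmeager set\<close>

text \<open>The function \<open>r x\<close> measures how closely the rationals approach
  \<open>x\<close>. A bound on it from some place on keeps \<open>x\<close> out of a punctured ball
  around every rational, so the reals obeying a fixed bound form a countable union of nowhere dense
  sets.\<close>

lemma nonmeager_imp_unbounded:
  fixes A :: "real set"
  assumes "\<not> meager A"
  obtains r :: "real \<Rightarrow> nat \<Rightarrow> nat" where "\<And>g. \<exists>x\<in>A. \<not> (\<forall>\<^sub>F n in sequentially. r x n \<le> g n)"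
proof -
  \<comment> \<open>Decoding \<open>n\<close> as a pair makes every rational occur infinitely often,
    hence beyond any \<open>m\<close>.\<close>
  define Q where "Q n = from_nat_into (\<rat> :: real set) (snd (prod_decode n))" for n
  have Q: "\<exists>n\<ge>m. Q n = q" if "q \<in> \<rat>" for m q
  proof -
    from from_nat_into_surj[OF countable_rat that]
    obtain k where "from_nat_into (\<rat> :: real set) k = q" by blast
    then show ?thesis
      by (intro exI[of _ "prod_encode (m, k)"]) (simp add: Q_def le_prod_encode_1)
  qed
  \<comment> \<open>For \<open>x = Q n\<close> the value is the junk value \<open>0\<close>, so bounded sets avoid only punctured balls.\<close>
  define r where "r x n = nat \<lceil>1 / \<bar>x - Q n\<bar>\<rceil>" for x n
  define T where "T g m = {x. \<forall>n\<ge>m. r x n \<le> g n}" for g :: "nat \<Rightarrow> nat" and m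
  have nd: "nowhere_dense (T g m)" for g m
    unfolding nowhere_dense_def
  proof (rule ccontr)
    assume "interior (closure (T g m)) \<noteq> {}"
    then obtain x where "x \<in> interior (closure (T g m))" by blast
    then obtain e where e: "e > 0" "ball x e \<subseteq> interior (closure (T g m))"
      using open_contains_ball open_interior by blast
    obtain q where q: "q \<in> \<rat>" "x < q" "q < x + e" using Rats_dense_in_real[of x "x + e"] e by auto
    obtain n where n: "n \<ge> m" "Q n = q" using Q[OF q(1)] by blast
    define d where "d = 1 / real (g n + 1)"
    have d: "d > 0" unfolding d_def by simp
    have "y \<notin> T g m" if "y \<in> ball q d - {q}" for y
    proof -
      have y: "0 < \<bar>y - q\<bar>" "\<bar>y - q\<bar> < d" using that by (auto simp: dist_real_def)
      then have "1 / \<bar>y - q\<bar> > real (g n + 1)" using d unfolding d_def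
        by (simp add: field_simps)
      then have "r y n > g n" unfolding r_def n by linarith
      then show ?thesis unfolding T_def using n by (auto simp: not_le)
    qed
    then have "(ball q d - {q}) \<inter> T g m = {}" by blast
    then have disj: "(ball q d - {q}) \<inter> closure (T g m) = {}"
      by (subst open_Int_closure_eq_empty) auto
    define s where "s = min (q - x) d / 2"
    have s: "0 < s" "s < q - x" "s < d" using q(2) d unfolding s_def by (auto simp: min_def)
    \<comment> \<open>To the left of \<open>q\<close> but still to the right of \<open>x\<close>:
      inside the ball around \<open>x\<close> and inside the punctured ball around
      \<open>q\<close>.\<close>
    define y where "y = q - s"
    have "y \<in> ball q d - {q}" "y \<in> ball x e"
      using q s unfolding y_def by (auto simp: dist_real_def abs_if)
    then show False using disj e(2) interior_subset by blast
  qed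
  show ?thesis
  proof (rule that[of r], rule ccontr)
    fix g assume "\<not> (\<exists>x\<in>A. \<not> (\<forall>\<^sub>F n in sequentially. r x n \<le> g n))"
    then have "A \<subseteq> (\<Union>m. T g m)" unfolding T_def eventually_sequentially by blast
    then show False using assms nd unfolding meager_def by blast
  qed
qed

section \<open>A scale of length omega_1\<close>

lemma card_omega1_well_order:
  assumes "card_omega1 (UNIV :: 'i set)"
  obtains R :: "'i rel" where "wf R" "total R" "\<And>i. countable {j. (j, i) \<in> R}"
proof -
  let ?r = "card_of (UNIV :: 'i set)"
  have C: "Card_order ?r" and W: "Well_order ?r" by (rule card_of_Card_order, rule card_of_Well_order)
  have F: "Field ?r = UNIV" by (simp add: Field_card_of)
  show ?thesis
  proof
    show "wf (?r - Id)" using W by (simp add: well_order_on_def)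
    show "total (?r - Id)" using W F by (auto simp: well_order_on_def linear_order_on_def total_on_def)
    fix i
    have "{j. (j, i) \<in> ?r - Id} = underS ?r i" by (auto simp: underS_def)
    moreover have "ordLess2 (card_of (underS ?r i)) ?r" by (rule card_of_underS) (use C F in auto)
    then have "ordLess2 (card_of (underS ?r i)) (cardSuc natLeq)"
      using assms unfolding card_omega1_def by (rule ordLess_ordIso_trans)
    then have "ordLeq3 (card_of (underS ?r i)) natLeq"
      using cardSuc_ordLeq_ordLess[OF natLeq_Card_order card_of_Card_order] by blast
    ultimately show "countable {j. (j, i) \<in> ?r - Id}" by (simp add: countable_card_le_natLeq)
  qed
qed

lemma card_omega1_uncountable: "card_omega1 A \<Longrightarrow> uncountable A"
proof
  assume A: "card_omega1 A" "countable A"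
  have "ordLess2 natLeq (cardSuc natLeq)" by (rule cardSuc_greater[OF natLeq_Card_order])
  moreover have "ordIso2 (cardSuc natLeq) (card_of A)" using A(1) unfolding card_omega1_def by (rule ordIso_symmetric)
  ultimately have "ordLess2 natLeq (card_of A)" by (rule ordLess_ordIso_trans)
  then show False using A(2) by (simp add: countable_card_le_natLeq not_ordLess_ordLeq)
qed

lemma ex_scale:
  assumes R: "wf R" "\<And>i. countable {j. (j, i) \<in> R}"
  obtains f :: "'i \<Rightarrow> nat \<Rightarrow> nat" where "\<And>i. mono (f i)" "\<And>i n. r i n \<le> f i n"
    "\<And>i j. (j, i) \<in> R \<Longrightarrow> \<forall>\<^sub>F n in sequentially. f j n < f i n"
proof -
  define P where "P f i u \<longleftrightarrow> mono u \<and> (\<forall>n. r i n \<le> u n) \<and> (\<forall>j. (j, i) \<in> R \<longrightarrow> (\<forall>\<^sub>F n in sequentially. f j n < u n))"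
    for f :: "'i \<Rightarrow> nat \<Rightarrow> nat" and i and u :: "nat \<Rightarrow> nat"
  have "\<exists>f. \<forall>i. P f i (f i)"
  proof (rule dependent_wf_choice[OF R(1)])
    show "P f i u = P g i u" if "\<And>z. (z, i) \<in> R \<Longrightarrow> f z = g z" for f g i u
      using that unfolding P_def by auto
    fix i and f :: "'i \<Rightarrow> nat \<Rightarrow> nat"
    define s where "s = from_nat_into {j. (j, i) \<in> R}"
    \<comment> \<open>The inner sum is a diagonal bound for the predecessors of \<open>i\<close>
      enumerated by \<open>s\<close>; the outer sum over \<open>m\<close> makes \<open>u\<close>
      increasing. Without predecessors \<open>s\<close> is arbitrary, which can only enlarge
      \<open>u\<close>.\<close>
    define u where "u n = (\<Sum>m\<le>n. r i m + (\<Sum>k\<le>m. Suc (f (s k) m)))" for n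
    have le: "r i n + (\<Sum>k\<le>n. Suc (f (s k) n)) \<le> u n" for n
      unfolding u_def by (rule member_le_sum) auto
    have "f j n < u n" if j: "(j, i) \<in> R" and n: "n \<ge> to_nat_on {j. (j, i) \<in> R} j" for j n
    proof -
      let ?k = "to_nat_on {j. (j, i) \<in> R} j"
      have "s ?k = j" unfolding s_def using R(2) j by simp
      moreover have "Suc (f (s ?k) n) \<le> (\<Sum>k\<le>n. Suc (f (s k) n))"
        by (rule member_le_sum) (use n in auto)
      ultimately show ?thesis using le[of n] by simp
    qed
    then have "\<forall>j. (j, i) \<in> R \<longrightarrow> (\<forall>\<^sub>F n in sequentially. f j n < u n)"
      unfolding eventually_sequentially by blast
    moreover have "mono u" unfolding mono_def u_def by (auto intro!: sum_mono2)
    moreover have "r i n \<le> u n" for n using le[of n] by simp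
    ultimately show "\<exists>u. P f i u" unfolding P_def by blast
  qed
  then show ?thesis using that unfolding P_def by blast
qed

lemma countable_disjoint_meeting:
  assumes "\<And>a b. a \<in> F \<Longrightarrow> b \<in> F \<Longrightarrow> a \<noteq> b \<Longrightarrow> a \<inter> b = {}" "countable S"
  shows "countable {a \<in> F. a \<inter> S \<noteq> {}}"
proof -
  define h where "h a = (SOME x. x \<in> a \<inter> S)" for a
  have h: "h a \<in> a \<inter> S" if "a \<inter> S \<noteq> {}" for a
    unfolding h_def using that by (simp only: some_in_eq not_False_eq_True)
  have "inj_on h {a \<in> F. a \<inter> S \<noteq> {}}"
  proof (rule inj_onI)
    fix a b assume ab: "a \<in> {a \<in> F. a \<inter> S \<noteq> {}}" "b \<in> {a \<in> F. a \<inter> S \<noteq> {}}" "h a = h b"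
    then have "h a \<in> a" "h a \<in> b" using h[of a] h[of b] by simp_all
    then show "a = b" using assms(1)[of a b] ab by blast
  qed
  moreover have "countable (h ` {a \<in> F. a \<inter> S \<noteq> {}})"
    by (rule countable_subset[OF _ assms(2)]) (use h in auto)
  ultimately show ?thesis by (rule countable_image_inj_on[rotated])
qed

text \<open>Oscillation numbers are only controlled up to an additive error, hence the colour depends on
  membership in arbitrarily long blocks.\<close>
definition long_blocks :: "nat \<Rightarrow> bool" where
  "long_blocks m \<longleftrightarrow> (\<exists>p. 2 ^ (2 * p) \<le> m \<and> m < 2 ^ (2 * p + 1))"

lemma ex_long_block: "\<exists>q. \<forall>m\<in>{q..q + H}. long_blocks m"
proof (intro exI ballI)
  fix m assume m: "m \<in> {2 ^ (2 * H)..2 ^ (2 * H) + H}"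
  have "H < 2 ^ (2 * H)" using less_exp[of "2 * H"] by linarith
  then show "long_blocks m" using m unfolding long_blocks_def by (intro exI[of _ H]) auto
qed

lemma ex_long_gap: "\<exists>q. \<forall>m\<in>{q..q + H}. \<not> long_blocks m"
proof (intro exI ballI notI)
  \<comment> \<open>The gap from \<open>2 ^ (2 * H + 1)\<close> to \<open>2 ^ (2 * H + 2)\<close> is
    longer than \<open>H\<close>.\<close>
  fix m assume m: "m \<in> {2 ^ (2 * H + 1)..2 ^ (2 * H + 1) + H}" and "long_blocks m"
  then obtain p where p: "2 ^ (2 * p) \<le> m" "m < 2 ^ (2 * p + 1)" unfolding long_blocks_def by blast
  have H: "H < 2 ^ (2 * H + 1)" using less_exp[of "2 * H + 1"] by linarith
  have "p \<le> H"
  proof (rule ccontr)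
    assume "\<not> p \<le> H"
    then have "(2 :: nat) ^ (2 * H + 2) \<le> 2 ^ (2 * p)" by (intro power_increasing) auto
    then show False using p m H by simp
  qed
  then have "(2 :: nat) ^ (2 * p + 1) \<le> 2 ^ (2 * H + 1)" by (intro power_increasing) auto
  moreover have "2 ^ (2 * H + 1) \<le> m" using m by (simp only: atLeastAtMost_iff)
  ultimately show False using p(2) by linarith
qed

section \<open>Graphs without large homogeneous families of finite sets\<close>

text \<open>Applied to singletons, \<open>strong\<close> excludes uncountable cliques and
  uncountable independent sets. The form for finite sets is what vectors of finite support
  require.\<close>

locale strong_coloring =
  fixes c :: "'i \<Rightarrow> 'i \<Rightarrow> bool"
  assumes irrefl: "\<not> c i i" and sym: "c i j \<Longrightarrow> c j i"
    and strong: "uncountable F \<Longrightarrow> (\<And>a. a \<in> F \<Longrightarrow> finite a) \<Longrightarrow> (\<And>a b. a \<in> F \<Longrightarrow> b \<in> F \<Longrightarrow> a \<noteq> b \<Longrightarrow> a \<inter> b = {})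
      \<Longrightarrow> \<exists>a\<in>F. \<exists>b\<in>F. a \<noteq> b \<and> (\<forall>x\<in>a. \<forall>y\<in>b. c x y \<longleftrightarrow> v)"

theorem ex_strong_coloring:
  assumes "\<exists>A :: real set. \<not> meager A \<and> card_omega1 A" and i: "card_omega1 (UNIV :: 'i set)"
  obtains c :: "'i \<Rightarrow> 'i \<Rightarrow> bool" where "strong_coloring c"
proof -
  obtain A :: "real set" where A: "\<not> meager A" "card_omega1 A" using assms(1) by blast
  obtain r where r: "\<And>g. \<exists>x\<in>A. \<not> (\<forall>\<^sub>F n in sequentially. r x n \<le> (g n :: nat))"
    by (rule nonmeager_imp_unbounded[OF A(1)]) (rule that)
  have "ordIso2 (card_of (UNIV :: 'i set)) (card_of A)"
    using A(2) i ordIso_symmetric ordIso_transitive unfolding card_omega1_def by blast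
  then obtain h where h: "bij_betw h (UNIV :: 'i set) A" using card_of_ordIso by blast
  obtain R :: "'i rel" where R: "wf R" "total R" "\<And>i. countable {j. (j, i) \<in> R}"
    by (rule card_omega1_well_order[OF i]) (rule that)
  obtain f where f: "\<And>i. mono (f i)" "\<And>i n. r (h i) n \<le> f i n"
    "\<And>i j. (j, i) \<in> R \<Longrightarrow> \<forall>\<^sub>F n in sequentially. f j n < f i n"
    by (rule ex_scale[OF R(1,3), of "\<lambda>i. r (h i)"]) (rule that)
  have uncountable: "uncountable (UNIV :: 'i set)" by (rule card_omega1_uncountable[OF i])
  define below where "below i j \<longleftrightarrow> (\<forall>\<^sub>F n in sequentially. f i n < f j n)" for i j
  have below_asym: "\<not> below j i" if "below i j" for i j
  proof
    assume "below j i"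
    then have "\<forall>\<^sub>F n in sequentially. f i n < f j n \<and> f j n < f i n"
      using that unfolding below_def by (intro eventually_conj)
    then show False by (auto dest: eventually_happens)
  qed
  have cocountable: "countable {j. \<not> (\<forall>\<^sub>F n in sequentially. f i n \<le> f j n)}" for i
  proof (rule countable_subset[OF _ R(3)[of i]], safe)
    fix j assume j: "\<not> (\<forall>\<^sub>F n in sequentially. f i n \<le> f j n)"
    then have "i \<noteq> j" by auto
    moreover have "(i, j) \<notin> R" using j eventually_mono[OF f(3)[of i j], of "\<lambda>n. f i n \<le> f j n"] by auto
    ultimately show "(j, i) \<in> R" using R(2) by (auto simp: total_on_def)
  qed
  \<comment> \<open>An index outside \<open>S\<close> and outside the predecessors of its elements
    is above all of \<open>S\<close>, since \<open>R\<close> is total.\<close>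
  have bound: "\<exists>i. \<forall>j\<in>S. below j i" if S: "countable S" for S
  proof -
    let ?S = "S \<union> (\<Union>j\<in>S. {k. (k, j) \<in> R})"
    have "countable ?S" using S R(3) by auto
    then have "?S \<noteq> UNIV" using uncountable by (metis (no_types))
    then obtain i where i: "i \<notin> ?S" by blast
    have "(j, i) \<in> R" if "j \<in> S" for j
    proof -
      have "i \<noteq> j" "(i, j) \<notin> R" using i that by auto
      then show ?thesis using R(2) by (auto simp: total_on_def)
    qed
    then show ?thesis using f(3) unfolding below_def by blast
  qed
  define osc where "osc i j = card (crossings (f i) (f j))" for i j
  \<comment> \<open>The pair is listed in the order of eventual dominance, in which the crossings
    form a finite set; \<open>card\<close> of an infinite set would be the junk value
    \<open>0\<close>.\<close>
  define c where "c i j \<longleftrightarrow> (below i j \<and> long_blocks (osc i j)) \<or> (below j i \<and> long_blocks (osc j i))" for i j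
  have main: "\<exists>a\<in>F. \<exists>b\<in>F. a \<noteq> b \<and> (\<forall>x\<in>a. \<forall>y\<in>b. c x y \<longleftrightarrow> v)"
    if F: "uncountable F" "\<And>a. a \<in> F \<Longrightarrow> finite a" "\<And>a b. a \<in> F \<Longrightarrow> b \<in> F \<Longrightarrow> a \<noteq> b \<Longrightarrow> a \<inter> b = {}" for F v
  proof -
    obtain n where "uncountable {a \<in> F. card a = n}" by (rule uncountable_common_value[OF F(1), of card]) auto
    define K where "K = {a \<in> F. card a = n}"
    have K: "uncountable K" "K \<subseteq> F" unfolding K_def by fact auto
    have "\<exists>e. bij_betw e {..<n} a" if "a \<in> K" for a
      using ex_bij_betw_nat_finite[of a] F(2) that unfolding K_def by (auto simp: atLeast0LessThan)
    then obtain en where en: "\<And>a. a \<in> K \<Longrightarrow> bij_betw (en a) {..<n} a" by metis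
    then have en_in: "en a j \<in> a" if "a \<in> K" "j < n" for a j
      using that bij_betwE by blast
    have meet: "countable {a \<in> K. a \<inter> S \<noteq> {}}" if "countable S" for S
      by (rule countable_disjoint_meeting[OF _ that]) (use F(3) K in auto)
    have fin: "(\<forall>\<^sub>F x in sequentially. \<forall>j<n. P j x)" if "\<And>j. j < n \<Longrightarrow> \<forall>\<^sub>F x in sequentially. P j x" for P :: "nat \<Rightarrow> nat \<Rightarrow> bool"
      using eventually_ball_finite_distrib[of "{..<n}" "\<lambda>x j. P j x" sequentially] that by (simp add: Ball_def)
    interpret unbounded_tuples "\<lambda>a j. f (en a j)" K n
    proof
      show "uncountable K" by fact
      show "mono (f (en k j))" for k j by (rule f(1))
    next
      fix g :: "nat \<Rightarrow> nat"
      obtain x where x: "x \<in> A" "\<not> (\<forall>\<^sub>F n in sequentially. r x n \<le> g n)" using r by blast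
      then obtain i where i: "h i = x" using h by (auto simp: bij_betw_def)
      \<comment> \<open>The index \<open>i\<close> belongs to a real whose function is not dominated
        by \<open>g\<close>. A tuple all of whose members are eventually above \<open>f i\<close>
        cannot have a member below \<open>g\<close> at almost all places, and disjointness leaves
        only countably many other tuples.\<close>
      have "{k \<in> K. \<forall>\<^sub>F x in sequentially. \<exists>j<n. f (en k j) x \<le> g x} \<subseteq> {a \<in> K. a \<inter> {j. \<not> (\<forall>\<^sub>F n in sequentially. f i n \<le> f j n)} \<noteq> {}}"
      proof safe
        fix a assume a: "a \<in> K" "\<forall>\<^sub>F x in sequentially. \<exists>j<n. f (en a j) x \<le> g x" "a \<inter> {j. \<not> (\<forall>\<^sub>F n in sequentially. f i n \<le> f j n)} = {}"
        have "\<forall>\<^sub>F x in sequentially. \<forall>j<n. f i x \<le> f (en a j) x"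
          by (rule fin) (use a en_in in blast)
        with a(2) have "\<forall>\<^sub>F x in sequentially. f i x \<le> g x"
          by eventually_elim (meson order_trans)
        then have "\<forall>\<^sub>F m in sequentially. r x m \<le> g m"
          by eventually_elim (use f(2)[of i] i in \<open>metis order_trans\<close>)
        then show False using x by blast
      qed
      then show "countable {k \<in> K. \<forall>\<^sub>F x in sequentially. \<exists>j<n. f (en k j) x \<le> g x}"
        using meet[OF cocountable[of i]] by (rule countable_subset)
    next
      fix D assume D: "countable D" "D \<subseteq> K"
      have "countable (\<Union>a\<in>D. a)"
        by (rule countable_UN) (use D F(2) K(2) in \<open>auto intro: countable_finite\<close>)
      from bound[OF this] obtain i where i: "\<And>j. j \<in> \<Union>D \<Longrightarrow> below j i" by auto
      have "{k \<in> K. \<not> (\<forall>j<n. \<forall>\<^sub>F x in sequentially. f i x \<le> f (en k j) x)} \<subseteq> {a \<in> K. a \<inter> {j. \<not> (\<forall>\<^sub>F n in sequentially. f i n \<le> f j n)} \<noteq> {}}"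
        using en_in by blast
      then have "countable {k \<in> K. \<not> (\<forall>j<n. \<forall>\<^sub>F x in sequentially. f i x \<le> f (en k j) x)}"
        using meet[OF cocountable[of i]] by (rule countable_subset)
      moreover have "\<forall>k\<in>D. \<forall>j<n. \<forall>\<^sub>F x in sequentially. f (en k j) x < f i x"
        using i en_in D(2) unfolding below_def by blast
      ultimately show "\<exists>g. (\<forall>k\<in>D. \<forall>j<n. \<forall>\<^sub>F x in sequentially. f (en k j) x < g x) \<and>
           countable {k \<in> K. \<not> (\<forall>j<n. \<forall>\<^sub>F x in sequentially. g x \<le> f (en k j) x)}" by blast
    qed
    obtain H where H: "\<And>q. \<exists>a\<in>K. \<exists>b\<in>K. a \<noteq> b \<and> (\<forall>i<n. \<forall>j<n.
       below (en a i) (en b j) \<and> osc (en a i) (en b j) \<in> {q..q + H})"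
      using oscillation unfolding below_def osc_def by blast
    \<comment> \<open>Since \<open>H\<close> is already fixed, the whole interval of possible
      oscillation values can be placed in a block or in a gap, as \<open>v\<close> demands.\<close>
    obtain q where q: "\<forall>m\<in>{q..q + H}. long_blocks m \<longleftrightarrow> v" using ex_long_block[of H] ex_long_gap[of H] by (cases v) auto
    obtain a b where ab: "a \<in> K" "b \<in> K" "a \<noteq> b" and osc: "\<forall>i<n. \<forall>j<n.
       below (en a i) (en b j) \<and> osc (en a i) (en b j) \<in> {q..q + H}"
      using H[of q] by metis
    have "c x y \<longleftrightarrow> v" if "x \<in> a" "y \<in> b" for x y
    proof -
      have "x \<in> en a ` {..<n}" "y \<in> en b ` {..<n}"
        using en[OF ab(1)] en[OF ab(2)] that by (simp_all add: bij_betw_def)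
      then obtain i j where i: "i < n" "x = en a i" and j: "j < n" "y = en b j" by auto
      have "below x y" "long_blocks (osc x y) \<longleftrightarrow> v" using osc i j q by auto
      then show ?thesis using below_asym unfolding c_def by blast
    qed
    then show ?thesis using ab K(2) by blast
  qed
  have "strong_coloring c"
  proof
    show "\<not> c i i" for i using below_asym[of i i] unfolding c_def by blast
    show "c i j \<Longrightarrow> c j i" for i j unfolding c_def by blast
  qed (rule main)
  then show ?thesis by (rule that)
qed

subsection \<open>Norms given by cliques\<close>

declare scaleR_fun_def [simp]

definition supp :: "('i \<Rightarrow> real) \<Rightarrow> 'i set" where
  "supp x = {i. x i \<noteq> 0}"

definition restr :: "'i set \<Rightarrow> ('i \<Rightarrow> real) \<Rightarrow> 'i \<Rightarrow> real" where
  "restr S x = (\<lambda>i. if i \<in> S then x i else 0)"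

lemma supp_restr [simp]: "supp (restr S x) = supp x \<inter> S"
  by (auto simp: supp_def restr_def)

lemma restr_diff: "restr S (x - y) = restr S x - restr S y"
  by (auto simp: restr_def)

lemma restr_idem: "supp x \<subseteq> S \<Longrightarrow> restr S x = x"
  by (rule ext) (auto simp: restr_def supp_def)

lemma supp_diff: "supp (x - y) \<subseteq> supp x \<union> supp y"
  by (auto simp: supp_def)

lemma supp_add: "supp (x + y) \<subseteq> supp x \<union> supp y"
  by (auto simp: supp_def)

lemma L2_set_cong_supp: "finite A \<Longrightarrow> L2_set x A = L2_set x (A \<inter> supp x)"
  unfolding L2_set_def by (rule arg_cong[where f = sqrt], rule sum.mono_neutral_right) (auto simp: supp_def)

lemma L2_set_mono_set: "finite B \<Longrightarrow> A \<subseteq> B \<Longrightarrow> L2_set x A \<le> L2_set x B"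
  unfolding L2_set_def by (intro real_sqrt_le_mono sum_mono2) auto

lemma L2_set_restr: "finite A \<Longrightarrow> L2_set (restr S x) A = L2_set x (A \<inter> S)"
  by (subst L2_set_cong_supp, simp, subst L2_set_cong_supp[of "A \<inter> S"], simp)
     (auto intro!: L2_set_cong simp: restr_def supp_def)

lemma L2_set_scaleR: "L2_set (r *\<^sub>R x) A = \<bar>r\<bar> * L2_set x A"
  by (simp add: L2_set_def power_mult_distrib sum_distrib_left[symmetric] real_sqrt_mult)

lemma L2_set_Un_disjoint:
  "finite A \<Longrightarrow> finite B \<Longrightarrow> A \<inter> B = {} \<Longrightarrow> L2_set x (A \<union> B) = sqrt ((L2_set x A)\<^sup>2 + (L2_set x B)\<^sup>2)"
  by (simp add: L2_set_def sum.union_disjoint sum_nonneg)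

definition cliques :: "('i \<Rightarrow> 'i \<Rightarrow> bool) \<Rightarrow> 'i set set" where
  "cliques c = {A. finite A \<and> (\<forall>x\<in>A. \<forall>y\<in>A. x \<noteq> y \<longrightarrow> c x y)}"

definition hnorm :: "('i \<Rightarrow> 'i \<Rightarrow> bool) \<Rightarrow> ('i \<Rightarrow> real) \<Rightarrow> real" where
  "hnorm c x = (SUP A\<in>cliques c. L2_set x A)"

text \<open>The supremum of an unbounded set of reals is unspecified, so finiteness of the norm is a
  predicate of its own.\<close>

definition hbounded :: "('i \<Rightarrow> 'i \<Rightarrow> bool) \<Rightarrow> ('i \<Rightarrow> real) \<Rightarrow> bool" where
  "hbounded c x \<longleftrightarrow> bdd_above (L2_set x ` cliques c)"

text \<open>A concrete completion of the finitely supported vectors, inside the functions on the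
  index set. Norm estimates thus reduce to finite supports by approximation.\<close>

definition hspace :: "('i \<Rightarrow> 'i \<Rightarrow> bool) \<Rightarrow> ('i \<Rightarrow> real) set" where
  "hspace c = {x. hbounded c x \<and> (\<forall>e>0. \<exists>y. finite (supp y) \<and> hnorm c (x - y) < e)}"

lemma cliques_finite: "A \<in> cliques c \<Longrightarrow> finite A"
  by (simp add: cliques_def)

lemma cliques_subset: "A \<in> cliques c \<Longrightarrow> B \<subseteq> A \<Longrightarrow> B \<in> cliques c"
  by (auto simp: cliques_def intro: finite_subset)

lemma cliques_simps [simp]: "{} \<in> cliques c" "{i} \<in> cliques c"
  by (auto simp: cliques_def)

lemma L2_set_le_hnorm: "hbounded c x \<Longrightarrow> A \<in> cliques c \<Longrightarrow> L2_set x A \<le> hnorm c x"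
  unfolding hbounded_def hnorm_def by (rule cSUP_upper)

lemma hnorm_leI:
  assumes "\<And>A. A \<in> cliques c \<Longrightarrow> L2_set x A \<le> M"
  shows "hbounded c x" "hnorm c x \<le> M"
proof -
  have "cliques c \<noteq> {}" using cliques_simps(1)[of c] by blast
  then show "hnorm c x \<le> M" unfolding hnorm_def by (rule cSUP_least) (rule assms)
  show "hbounded c x" unfolding hbounded_def by (rule bdd_aboveI2) (rule assms)
qed

lemma hnorm_nonneg: "hbounded c x \<Longrightarrow> 0 \<le> hnorm c x"
  using L2_set_le_hnorm[of c x "{}"] by simp

lemma abs_le_hnorm: "hbounded c x \<Longrightarrow> \<bar>x i\<bar> \<le> hnorm c x"
  using L2_set_le_hnorm[of c x "{i}"] by (simp add: L2_set_def)

lemma hnorm_add: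
  assumes "hbounded c x" "hbounded c y"
  shows "hbounded c (x + y)" "hnorm c (x + y) \<le> hnorm c x + hnorm c y"
proof -
  have *: "L2_set (x + y) A \<le> hnorm c x + hnorm c y" if "A \<in> cliques c" for A
  proof -
    have "L2_set (x + y) A \<le> L2_set x A + L2_set y A"
      using L2_set_triangle_ineq[of x y A] by (simp add: plus_fun_def)
    then show ?thesis using assms[THEN L2_set_le_hnorm, OF that] by linarith
  qed
  show "hbounded c (x + y)" "hnorm c (x + y) \<le> hnorm c x + hnorm c y" by (rule hnorm_leI, erule *)+
qed

lemma hnorm_scaleR:
  assumes "hbounded c x"
  shows "hbounded c (r *\<^sub>R x)" "hnorm c (r *\<^sub>R x) = \<bar>r\<bar> * hnorm c x"
proof -
  have le: "hbounded c (r *\<^sub>R x) \<and> hnorm c (r *\<^sub>R x) \<le> \<bar>r\<bar> * hnorm c x" if "hbounded c x" for x r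
  proof -
    have "L2_set (r *\<^sub>R x) A \<le> \<bar>r\<bar> * hnorm c x" if "A \<in> cliques c" for A
      unfolding L2_set_scaleR by (intro mult_left_mono L2_set_le_hnorm \<open>hbounded c x\<close> that) auto
    then show ?thesis using hnorm_leI by blast
  qed
  show *: "hbounded c (r *\<^sub>R x)" using le assms by blast
  show "hnorm c (r *\<^sub>R x) = \<bar>r\<bar> * hnorm c x"
  proof (cases "r = 0")
    case True
    then show ?thesis using le[OF assms, of r] hnorm_nonneg[OF *] by simp
  next
    case False
    have "inverse r *\<^sub>R r *\<^sub>R x = x" using False by (simp add: fun_eq_iff)
    then have "hnorm c x \<le> \<bar>inverse r\<bar> * hnorm c (r *\<^sub>R x)" using le[OF *, of "inverse r"] by metis
    then have "\<bar>r\<bar> * hnorm c x \<le> hnorm c (r *\<^sub>R x)" using False by (simp add: field_simps)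
    then show ?thesis using le[OF assms, of r] by simp
  qed
qed

lemma hnorm_diff:
  assumes "hbounded c x" "hbounded c y"
  shows "hbounded c (x - y)" "hnorm c (x - y) \<le> hnorm c x + hnorm c y"
proof -
  have "hbounded c ((-1) *\<^sub>R y)" "hnorm c ((-1) *\<^sub>R y) = hnorm c y" using hnorm_scaleR[OF assms(2), of "-1"] by auto
  moreover have "x - y = x + (-1) *\<^sub>R y" by (simp add: fun_eq_iff)
  ultimately show "hbounded c (x - y)" "hnorm c (x - y) \<le> hnorm c x + hnorm c y"
    using hnorm_add[of c x "(-1) *\<^sub>R y"] assms(1) by (simp_all only:)
qed

lemma hnorm_minus_commute: "hnorm c (x - y) = hnorm c (y - x)"
proof -
  have "L2_set (x - y) A = L2_set (y - x) A" for A
    unfolding L2_set_def minus_apply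
    by (rule arg_cong[where f = sqrt], rule sum.cong[OF refl], rule power2_commute)
  then show ?thesis by (simp add: hnorm_def)
qed

lemma hnorm_0: "hbounded c 0" "hnorm c 0 = 0"
proof -
  have *: "L2_set (0 :: 'a \<Rightarrow> real) A \<le> 0" for A by (simp add: L2_set_def)
  show "hbounded c 0" by (rule hnorm_leI) (rule *)
  moreover have "hnorm c 0 \<le> 0" by (rule hnorm_leI) (rule *)
  ultimately show "hnorm c 0 = 0" using hnorm_nonneg by force
qed

lemma hnorm_eq_0:
  assumes "hbounded c x" "hnorm c x = 0"
  shows "x = 0"
proof
  fix i show "x i = 0 i" using abs_le_hnorm[OF assms(1), of i] assms(2) by simp
qed

lemma hnorm_finite:
  assumes "finite (supp x)"
  shows "hbounded c x" "hnorm c x \<le> L2_set x (supp x)"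
proof -
  have *: "L2_set x A \<le> L2_set x (supp x)" if "A \<in> cliques c" for A
    using L2_set_cong_supp[OF cliques_finite[OF that], of x] L2_set_mono_set[OF assms, of "A \<inter> supp x" x] by simp
  show "hbounded c x" "hnorm c x \<le> L2_set x (supp x)" by (rule hnorm_leI, erule *)+
qed

text \<open>Only the traces of cliques on the finite support matter. An attaining clique inside the
  support can later be united with one for another vector.\<close>

lemma hnorm_finite_attained:
  assumes "finite (supp x)"
  obtains A where "A \<in> cliques c" "A \<subseteq> supp x" "hnorm c x = L2_set x A"
proof -
  let ?C = "{A \<in> cliques c. A \<subseteq> supp x}"
  have "finite ?C" by (rule finite_subset[of _ "Pow (supp x)"]) (use assms in auto)
  then have fin: "finite (L2_set x ` ?C)" by (rule finite_imageI)
  have ne: "L2_set x ` ?C \<noteq> {}" using cliques_simps(1)[of c] by blast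
  obtain A where A: "A \<in> ?C" "Max (L2_set x ` ?C) = L2_set x A" using Max_in[OF fin ne] by blast
  have "L2_set x B \<le> L2_set x A" if "B \<in> cliques c" for B
  proof -
    have "L2_set x B = L2_set x (B \<inter> supp x)" using that by (intro L2_set_cong_supp cliques_finite)
    moreover have "B \<inter> supp x \<in> ?C" using cliques_subset[OF that, of "B \<inter> supp x"] by simp
    then have "L2_set x (B \<inter> supp x) \<le> Max (L2_set x ` ?C)" by (intro Max_ge[OF fin] imageI)
    ultimately show ?thesis using A(2) by simp
  qed
  then have "hnorm c x \<le> L2_set x A" by (rule hnorm_leI)
  moreover have "L2_set x A \<le> hnorm c x" using A hnorm_finite[OF assms] L2_set_le_hnorm by blast
  ultimately show ?thesis using that A by auto
qed

lemma hnorm_restr: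
  assumes "hbounded c x"
  shows "hbounded c (restr S x)" "hnorm c (restr S x) \<le> hnorm c x"
proof -
  have *: "L2_set (restr S x) A \<le> hnorm c x" if "A \<in> cliques c" for A
    using L2_set_restr[OF cliques_finite[OF that]] L2_set_le_hnorm[OF assms, of "A \<inter> S"] cliques_subset[OF that] by simp
  show "hbounded c (restr S x)" "hnorm c (restr S x) \<le> hnorm c x" by (rule hnorm_leI, erule *)+
qed

lemma hspace_hbounded: "x \<in> hspace c \<Longrightarrow> hbounded c x"
  by (simp add: hspace_def)

lemma hspace_finite: "finite (supp x) \<Longrightarrow> x \<in> hspace c"
  unfolding hspace_def using hnorm_finite(1)[of x c] hnorm_0[of c] by (auto intro!: exI[of _ x])

lemma hspace_approx:
  "x \<in> hspace c \<Longrightarrow> 0 < e \<Longrightarrow> \<exists>y. finite (supp y) \<and> hnorm c (x - y) < e"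
  unfolding hspace_def by blast

lemma hspace_closed:
  assumes "hbounded c x" "\<And>e. 0 < e \<Longrightarrow> \<exists>y\<in>hspace c. hnorm c (x - y) < e"
  shows "x \<in> hspace c"
  unfolding hspace_def
proof (intro CollectI conjI allI impI)
  fix e :: real assume "e > 0"
  then obtain y where y: "y \<in> hspace c" "hnorm c (x - y) < e / 2" using assms(2)[of "e / 2"] by auto
  then obtain z where z: "finite (supp z)" "hnorm c (y - z) < e / 2" using hspace_approx[of y c "e / 2"] \<open>e > 0\<close> by auto
  have "hnorm c ((x - y) + (y - z)) \<le> hnorm c (x - y) + hnorm c (y - z)"
    by (intro hnorm_add hnorm_diff assms hspace_hbounded y hnorm_finite z)
  then show "\<exists>y. finite (supp y) \<and> hnorm c (x - y) < e" using y z by (intro exI[of _ z]) auto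
qed fact

lemma hspace_subspace: "subspace (hspace c)"
proof (rule subspaceI)
  show "0 \<in> hspace c" by (rule hspace_finite) (simp add: supp_def)
next
  fix x y assume xy: "x \<in> hspace c" "y \<in> hspace c"
  note b = xy[THEN hspace_hbounded]
  show "x + y \<in> hspace c"
  proof (rule hspace_closed)
    show "hbounded c (x + y)" using b by (rule hnorm_add)
    fix e :: real assume "e > 0"
    then obtain u v where u: "finite (supp u)" "hnorm c (x - u) < e / 2" and v: "finite (supp v)" "hnorm c (y - v) < e / 2"
      using hspace_approx[of x c "e / 2"] hspace_approx[of y c "e / 2"] xy by auto
    have "hnorm c ((x - u) + (y - v)) \<le> hnorm c (x - u) + hnorm c (y - v)"
      by (intro hnorm_add hnorm_diff b hnorm_finite u v)
    moreover have "(x - u) + (y - v) = x + y - (u + v)" by simp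
    moreover have "u + v \<in> hspace c"
      by (intro hspace_finite finite_subset[OF supp_add]) (use u v in simp)
    ultimately show "\<exists>z\<in>hspace c. hnorm c (x + y - z) < e" using u v by (intro bexI[of _ "u + v"]) auto
  qed
next
  fix r x assume x: "x \<in> hspace c"
  note b = x[THEN hspace_hbounded]
  show "r *\<^sub>R x \<in> hspace c"
  proof (rule hspace_closed)
    show "hbounded c (r *\<^sub>R x)" using b by (rule hnorm_scaleR)
    fix e :: real assume "e > 0"
    then have e: "e / (\<bar>r\<bar> + 1) > 0" by simp
    then obtain u where u: "finite (supp u)" "hnorm c (x - u) < e / (\<bar>r\<bar> + 1)"
      using hspace_approx[OF x] by blast
    have "hnorm c (r *\<^sub>R (x - u)) = \<bar>r\<bar> * hnorm c (x - u)"
      by (intro hnorm_scaleR hnorm_diff b hnorm_finite u)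
    also have "\<dots> \<le> \<bar>r\<bar> * (e / (\<bar>r\<bar> + 1))" using u by (intro mult_left_mono) auto
    also have "\<dots> < e" using \<open>e > 0\<close> by (simp add: field_simps)
    finally have "hnorm c (r *\<^sub>R x - r *\<^sub>R u) < e" by (simp add: scaleR_diff_right del: scaleR_fun_def)
    moreover have "r *\<^sub>R u \<in> hspace c"
      using u finite_subset[of "supp (r *\<^sub>R u)" "supp u"] by (intro hspace_finite) (auto simp: supp_def)
    ultimately show "\<exists>z\<in>hspace c. hnorm c (r *\<^sub>R x - z) < e" by blast
  qed
qed

lemma hspace_is_norm: "is_norm_on (hspace c) (hnorm c)"
  unfolding is_norm_on_def
  using hspace_subspace[of c] hnorm_nonneg hnorm_eq_0 hnorm_0(2)[of c] hnorm_add(2) hnorm_scaleR(2) hspace_hbounded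
  by (metis (no_types, lifting))

text \<open>Cliques are finite, so \<open>L2_set\<close> on a clique is continuous for pointwise
  convergence, and the bound on \<open>s n - s m\<close> passes to the limit in \<open>m\<close>
  clique by clique.\<close>

lemma hnorm_limit:
  assumes "\<And>m. hbounded c (s m)" "\<And>m n. M \<le> m \<Longrightarrow> M \<le> n \<Longrightarrow> hnorm c (s m - s n) \<le> e"
    and x: "\<And>i. (\<lambda>m. s m i) \<longlonglongrightarrow> x i" and "M \<le> n"
  shows "hbounded c (s n - x)" "hnorm c (s n - x) \<le> e"
proof -
  have *: "L2_set (s n - x) A \<le> e" if A: "A \<in> cliques c" for A
  proof (rule LIMSEQ_le_const2)
    show "(\<lambda>m. L2_set (s n - s m) A) \<longlonglongrightarrow> L2_set (s n - x) A"
      unfolding L2_set_def minus_apply by (intro tendsto_intros x)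
    have "L2_set (s n - s m) A \<le> e" if "M \<le> m" for m
      using L2_set_le_hnorm[OF hnorm_diff(1)[OF assms(1,1)] A, of n m] assms(2)[OF \<open>M \<le> n\<close> that] by linarith
    then show "\<exists>N. \<forall>m\<ge>N. L2_set (s n - s m) A \<le> e" by blast
  qed
  show "hbounded c (s n - x)" "hnorm c (s n - x) \<le> e" by (rule hnorm_leI, erule *)+
qed

text \<open>The coordinatewise limit is kept in the conclusion because the embedding of l2 is later
  defined coordinate by coordinate.\<close>

lemma hspace_Cauchy_limit:
  assumes s: "\<And>n. s n \<in> hspace c" "\<And>e. 0 < e \<Longrightarrow> \<exists>M. \<forall>m\<ge>M. \<forall>n\<ge>M. hnorm c (s m - s n) < e"
  obtains x where "x \<in> hspace c" "(\<lambda>n. hnorm c (s n - x)) \<longlonglongrightarrow> 0" "\<And>i. (\<lambda>m. s m i) \<longlonglongrightarrow> x i"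
proof -
  note b = s(1)[THEN hspace_hbounded]
  have "convergent (\<lambda>m. s m i)" for i
  proof (rule Cauchy_convergent, rule CauchyI)
    fix e :: real assume "e > 0"
    then obtain M where M: "\<forall>m\<ge>M. \<forall>n\<ge>M. hnorm c (s m - s n) < e" using s(2) by blast
    have "norm (s m i - s n i) \<le> hnorm c (s m - s n)" for m n
      using abs_le_hnorm[OF hnorm_diff(1)[OF b b], of m n i] by simp
    then show "\<exists>M. \<forall>m\<ge>M. \<forall>n\<ge>M. norm (s m i - s n i) < e" using M by (meson le_less_trans)
  qed
  then obtain x where x: "\<And>i. (\<lambda>m. s m i) \<longlonglongrightarrow> x i" unfolding convergent_def by metis
  have lim: "\<exists>M. \<forall>n\<ge>M. hbounded c (s n - x) \<and> hnorm c (s n - x) < e" if e: "e > 0" for e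
  proof -
    obtain M where M: "\<forall>m\<ge>M. \<forall>n\<ge>M. hnorm c (s m - s n) < e / 2" using s(2)[OF half_gt_zero[OF e]] by blast
    then have M': "\<And>m n. M \<le> m \<Longrightarrow> M \<le> n \<Longrightarrow> hnorm c (s m - s n) \<le> e / 2" by (simp add: less_imp_le)
    show ?thesis using hnorm_limit[OF b M' x] e by (intro exI[of _ M]) force
  qed
  show ?thesis
  proof (rule that)
    obtain M where "hbounded c (s M - x)" using lim[of 1] by auto
    then have "hbounded c (s M - (s M - x))" using b hnorm_diff(1) by blast
    then have bx: "hbounded c x" by simp
    show "x \<in> hspace c"
    proof (rule hspace_closed[OF bx])
      fix e :: real assume "e > 0"
      then obtain M where "hbounded c (s M - x)" "hnorm c (s M - x) < e" using lim by blast
      then have "hnorm c (x - s M) < e" by (simp add: hnorm_minus_commute)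
      then show "\<exists>y\<in>hspace c. hnorm c (x - y) < e" using s(1) by blast
    qed
    show "(\<lambda>n. hnorm c (s n - x)) \<longlonglongrightarrow> 0"
      unfolding LIMSEQ_iff
    proof (intro allI impI)
      fix e :: real assume "e > 0"
      then show "\<exists>no. \<forall>n\<ge>no. norm (hnorm c (s n - x) - 0) < e"
        using lim[of e] hnorm_nonneg[OF hnorm_diff(1)[OF b bx]] by simp blast
    qed
  qed (rule x)
qed

lemma hspace_banach: "banach_space (hspace c) (hnorm c)"
  unfolding banach_space_def complete_wrt_def
proof (intro conjI hspace_is_norm allI impI)
  fix s :: "nat \<Rightarrow> 'a \<Rightarrow> real"
  assume "\<forall>n. s n \<in> hspace c" "\<forall>e>0. \<exists>M. \<forall>m\<ge>M. \<forall>n\<ge>M. hnorm c (s m - s n) < e"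
  then obtain x where "x \<in> hspace c" "(\<lambda>n. hnorm c (s n - x)) \<longlonglongrightarrow> 0"
    using hspace_Cauchy_limit[of s c] by metis
  then show "\<exists>x\<in>hspace c. (\<lambda>n. hnorm c (s n - x)) \<longlonglongrightarrow> 0" by blast
qed

section \<open>The Hilbert space as the case of the complete graph\<close>

abbreviation all_pairs :: "'i \<Rightarrow> 'i \<Rightarrow> bool" where
  "all_pairs \<equiv> \<lambda>_ _. True"

lemma cliques_all_pairs: "cliques all_pairs = {A. finite A}"
  by (simp add: cliques_def)

lemma L2_set_power2: "(L2_set x A)\<^sup>2 = (\<Sum>i\<in>A. (x i)\<^sup>2)"
  by (simp add: L2_set_def sum_nonneg)

lemma hnorm_all_pairs_finite:
  assumes "finite (supp x)"
  shows "hnorm all_pairs x = L2_set x (supp x)"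
  using hnorm_finite[OF assms, of all_pairs] L2_set_le_hnorm[OF hnorm_finite(1)[OF assms], of "supp x" all_pairs] assms
  by (simp add: cliques_all_pairs)

lemma hnorm_le_all_pairs:
  assumes "hbounded all_pairs x"
  shows "hbounded c x" "hnorm c x \<le> hnorm all_pairs x"
proof -
  have *: "L2_set x A \<le> hnorm all_pairs x" if "A \<in> cliques c" for A
    using L2_set_le_hnorm[OF assms] cliques_finite[OF that] by (simp add: cliques_all_pairs)
  show "hbounded c x" "hnorm c x \<le> hnorm all_pairs x" by (rule hnorm_leI, erule *)+
qed

text \<open>A finite set \<open>A\<close> that nearly attains the norm leaves a small tail, because
  squares over disjoint sets add up when all finite sets are cliques. This is special to the
  complete graph: without edges a nonzero constant on an infinite index set is bounded but not
  approximable.\<close>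

lemma hbounded_all_pairs_in_hspace:
  assumes b: "hbounded all_pairs x"
  shows "x \<in> hspace all_pairs"
  unfolding hspace_def
proof (intro CollectI conjI allI impI b)
  fix e :: real assume e: "e > 0"
  let ?S = "hnorm all_pairs x"
  have "\<exists>A. finite A \<and> ?S\<^sup>2 - (e / 2)\<^sup>2 < (L2_set x A)\<^sup>2"
  proof (rule ccontr)
    assume "\<not> ?thesis"
    then have "(L2_set x A)\<^sup>2 \<le> ?S\<^sup>2 - (e / 2)\<^sup>2" if "finite A" for A
      using that by (meson not_less)
    then have "L2_set x A \<le> sqrt (?S\<^sup>2 - (e / 2)\<^sup>2)" if "A \<in> cliques all_pairs" for A
      using that by (intro real_le_rsqrt) (simp add: cliques_all_pairs)
    then have "?S \<le> sqrt (?S\<^sup>2 - (e / 2)\<^sup>2)" by (rule hnorm_leI)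
    moreover have "sqrt (?S\<^sup>2 - (e / 2)\<^sup>2) < sqrt (?S\<^sup>2)" using e by (intro real_sqrt_less_mono) simp
    ultimately show False using hnorm_nonneg[OF b] by simp
  qed
  then obtain A where A: "finite A" "?S\<^sup>2 - (e / 2)\<^sup>2 < (L2_set x A)\<^sup>2" by blast
  have "L2_set (x - restr A x) B \<le> e / 2" if "B \<in> cliques all_pairs" for B
  proof -
    have B: "finite B" using that by (rule cliques_finite)
    have "(L2_set (x - restr A x) B)\<^sup>2 = (\<Sum>i\<in>B - A. (x i)\<^sup>2)"
      unfolding L2_set_power2 by (rule sum.mono_neutral_cong_right) (use B in \<open>auto simp: restr_def\<close>)
    moreover have "(L2_set x (A \<union> B))\<^sup>2 = (L2_set x A)\<^sup>2 + (\<Sum>i\<in>B - A. (x i)\<^sup>2)"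
      unfolding L2_set_power2 using sum.union_disjoint[of A "B - A" "\<lambda>i. (x i)\<^sup>2"] A(1) B by simp
    moreover have "(L2_set x (A \<union> B))\<^sup>2 \<le> ?S\<^sup>2"
      using L2_set_le_hnorm[OF b, of "A \<union> B"] A(1) B by (intro power_mono) (auto simp: cliques_all_pairs)
    ultimately have "(L2_set (x - restr A x) B)\<^sup>2 \<le> (e / 2)\<^sup>2" using A(2) by linarith
    then show ?thesis by (rule power2_le_imp_le) (use e in simp)
  qed
  then have "hnorm all_pairs (x - restr A x) \<le> e / 2" by (rule hnorm_leI)
  then show "\<exists>y. finite (supp y) \<and> hnorm all_pairs (x - y) < e"
    using e A(1) by (intro exI[of _ "restr A x"]) simp
qed

lemma l2_space_eq_hspace: "l2_space UNIV = hspace all_pairs"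
proof (intro set_eqI iffI)
  fix x :: "'a \<Rightarrow> real" assume "x \<in> l2_space UNIV"
  then have "(\<lambda>i. (x i)\<^sup>2) summable_on UNIV" by (simp add: l2_space_def)
  then have "(L2_set x A)\<^sup>2 \<le> (\<Sum>\<^sub>\<infinity>i. (x i)\<^sup>2)" if "finite A" for A
    unfolding L2_set_power2 using that by (intro finite_sum_le_infsum) auto
  then have "L2_set x A \<le> sqrt (\<Sum>\<^sub>\<infinity>i. (x i)\<^sup>2)" if "A \<in> cliques all_pairs" for A
    using that by (intro real_le_rsqrt) (simp add: cliques_all_pairs)
  then show "x \<in> hspace all_pairs" by (intro hbounded_all_pairs_in_hspace hnorm_leI)
next
  fix x :: "'a \<Rightarrow> real" assume "x \<in> hspace all_pairs"
  then have b: "hbounded all_pairs x" by (rule hspace_hbounded)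
  have "(\<Sum>i\<in>A. (x i)\<^sup>2) \<le> (hnorm all_pairs x)\<^sup>2" if "finite A" for A
    unfolding L2_set_power2[symmetric] using L2_set_le_hnorm[OF b, of A] that
    by (intro power_mono) (auto simp: cliques_all_pairs)
  then have "(\<lambda>i. (x i)\<^sup>2) summable_on UNIV"
    by (intro nonneg_bdd_above_summable_on bdd_aboveI2[of _ _ "(hnorm all_pairs x)\<^sup>2"]) auto
  then show "x \<in> l2_space UNIV" by (simp add: l2_space_def)
qed

lemma l2_norm_eq_hnorm:
  assumes "x \<in> l2_space UNIV"
  shows "l2_norm x = hnorm all_pairs x"
proof (rule antisym)
  have s: "(\<lambda>i. (x i)\<^sup>2) summable_on UNIV" using assms by (simp add: l2_space_def)
  have b: "hbounded all_pairs x" using assms unfolding l2_space_eq_hspace by (rule hspace_hbounded)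
  have "(\<Sum>i\<in>A. (x i)\<^sup>2) \<le> (hnorm all_pairs x)\<^sup>2" if "finite A" for A
    unfolding L2_set_power2[symmetric] using L2_set_le_hnorm[OF b, of A] that
    by (intro power_mono) (auto simp: cliques_all_pairs)
  then have "(\<Sum>\<^sub>\<infinity>i. (x i)\<^sup>2) \<le> (hnorm all_pairs x)\<^sup>2" by (intro infsum_le_finite_sums s)
  then show "l2_norm x \<le> hnorm all_pairs x"
    unfolding l2_norm_def using hnorm_nonneg[OF b] by (intro real_le_lsqrt) auto
  have "(L2_set x A)\<^sup>2 \<le> (\<Sum>\<^sub>\<infinity>i. (x i)\<^sup>2)" if "finite A" for A
    unfolding L2_set_power2 using that s by (intro finite_sum_le_infsum) auto
  then have "L2_set x A \<le> l2_norm x" if "A \<in> cliques all_pairs" for A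
    unfolding l2_norm_def using that by (intro real_le_rsqrt) (simp add: cliques_all_pairs)
  then show "hnorm all_pairs x \<le> l2_norm x" by (rule hnorm_leI)
qed

subsection \<open>Uncountable separated sets\<close>

lemma maximal_pairwise:
  obtains J where "J \<subseteq> I" "pairwise P J" "\<And>x. x \<in> I \<Longrightarrow> x \<notin> J \<Longrightarrow> \<exists>y\<in>J. \<not> P x y \<or> \<not> P y x"
proof -
  let ?A = "{J. J \<subseteq> I \<and> pairwise P J}"
  have "\<exists>M\<in>?A. \<forall>X\<in>?A. M \<subseteq> X \<longrightarrow> X = M"
  proof (rule subset_Zorn')
    fix C assume C: "subset.chain ?A C"
    have sub: "C \<subseteq> ?A" using C by (simp add: subset.chain_def)
    have "chain\<^sub>\<subseteq> C" unfolding chain_subset_def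
    proof (intro ballI)
      fix A B assume "A \<in> C" "B \<in> C"
      moreover have "\<forall>x\<in>C. \<forall>y\<in>C. x \<subset> y \<or> x = y \<or> y \<subset> x \<or> y = x" using C by (simp add: subset.chain_def)
      ultimately show "A \<subseteq> B \<or> B \<subseteq> A" by (metis psubset_imp_subset subset_refl)
    qed
    then have "pairwise P (\<Union>C)" by (rule pairwise_chain_Union[rotated]) (use sub in blast)
    moreover have "\<Union>C \<subseteq> I" using sub by blast
    ultimately show "\<Union>C \<in> ?A" by blast
  qed
  then obtain J where "J \<in> ?A" and max: "\<forall>X\<in>?A. J \<subseteq> X \<longrightarrow> X = J" by (elim bexE) (rule that)
  then have J: "J \<subseteq> I" "pairwise P J" by simp_all
  show ?thesis
  proof (rule that[OF J])
    fix x assume x: "x \<in> I" "x \<notin> J"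
    show "\<exists>y\<in>J. \<not> P x y \<or> \<not> P y x"
    proof (rule ccontr)
      assume "\<not> ?thesis"
      then have "pairwise P (insert x J)" using J(2) by (auto simp: pairwise_insert)
      then have "insert x J \<in> ?A" using x(1) J(1) by simp
      then have "insert x J = J" using max by (metis subset_insertI)
      then show False using x(2) by blast
    qed
  qed
qed

text \<open>A countable maximal independent set, together with its countable neighbourhoods, would
  cover \<open>I\<close>.\<close>

lemma uncountable_independent:
  assumes I: "uncountable I" and sym: "\<And>x y. E x y \<Longrightarrow> E y x"
    and cnt: "\<And>x. x \<in> I \<Longrightarrow> countable {y \<in> I. E x y}"
  obtains J where "J \<subseteq> I" "uncountable J" "pairwise (\<lambda>x y. \<not> E x y) J"
proof -
  obtain J where J: "J \<subseteq> I" "pairwise (\<lambda>x y. \<not> E x y) J"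
    and max: "\<And>x. x \<in> I \<Longrightarrow> x \<notin> J \<Longrightarrow> \<exists>y\<in>J. \<not> \<not> E x y \<or> \<not> \<not> E y x"
    by (rule maximal_pairwise) (rule that)
  have "uncountable J"
  proof
    assume "countable J"
    then have "countable (J \<union> (\<Union>x\<in>J. {y \<in> I. E x y}))" using cnt J(1) by auto
    moreover have "I \<subseteq> J \<union> (\<Union>x\<in>J. {y \<in> I. E x y})" using max sym by blast
    ultimately show False using I countable_subset by blast
  qed
  then show ?thesis using that J by blast
qed

text \<open>Induction on the common size: a point lying in uncountably many of the sets is moved
  into the root; if there is none, each set meets only countably many others and an uncountable
  disjoint subfamily exists. Intersections are merely contained in \<open>R\<close>, which suffices
  because the parts on \<open>R\<close> are made equal later.\<close>

lemma weak_delta_system: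
  assumes "uncountable I" "\<And>i. i \<in> I \<Longrightarrow> finite (a i)"
  obtains J R where "J \<subseteq> I" "uncountable J" "finite R" "pairwise (\<lambda>i j. a i \<inter> a j \<subseteq> R) J"
proof -
  have *: "\<exists>J R. J \<subseteq> I \<and> uncountable J \<and> finite R \<and> pairwise (\<lambda>i j. a i \<inter> a j \<subseteq> R) J"
    if "uncountable I" "\<And>i. i \<in> I \<Longrightarrow> finite (a i) \<and> card (a i) = n" for n I a
    using that
  proof (induction n arbitrary: I a)
    case 0
    then have "a i = {}" if "i \<in> I" for i using that by (metis card_0_eq)
    then have "pairwise (\<lambda>i j. a i \<inter> a j \<subseteq> {}) I" by (simp add: pairwise_def)
    then show ?case using 0(1) by blast
  next
    case (Suc n)
    show ?case
    proof (cases "\<exists>z. uncountable {i \<in> I. z \<in> a i}")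
      case True
      then obtain z where z: "uncountable {i \<in> I. z \<in> a i}" by blast
      have fin: "finite (a i - {z}) \<and> card (a i - {z}) = n" if "i \<in> {i \<in> I. z \<in> a i}" for i
        using Suc.prems(2)[of i] that by simp
      have "\<exists>J R. J \<subseteq> {i \<in> I. z \<in> a i} \<and> uncountable J \<and> finite R \<and>
          pairwise (\<lambda>i j. (a i - {z}) \<inter> (a j - {z}) \<subseteq> R) J"
        by (rule Suc.IH[OF z]) (rule fin)
      then obtain J R where J: "J \<subseteq> {i \<in> I. z \<in> a i}" "uncountable J" "finite R"
          "pairwise (\<lambda>i j. (a i - {z}) \<inter> (a j - {z}) \<subseteq> R) J" by (elim exE conjE) (rule that)
      have "pairwise (\<lambda>i j. a i \<inter> a j \<subseteq> insert z R) J" using J(4) by (auto simp: pairwise_def)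
      then show ?thesis using J(1-3) by (intro exI[of _ J] exI[of _ "insert z R"]) auto
    next
      case False
      have "countable {j \<in> I. a i \<inter> a j \<noteq> {}}" if "i \<in> I" for i
      proof (rule countable_subset)
        show "{j \<in> I. a i \<inter> a j \<noteq> {}} \<subseteq> (\<Union>z\<in>a i. {j \<in> I. z \<in> a j})" by blast
        show "countable (\<Union>z\<in>a i. {j \<in> I. z \<in> a j})"
          using False Suc.prems(2)[OF that] by (intro countable_UN) (auto intro: countable_finite)
      qed
      then obtain J where J: "J \<subseteq> I" "uncountable J" "pairwise (\<lambda>i j. \<not> a i \<inter> a j \<noteq> {}) J"
        by (rule uncountable_independent[OF Suc.prems(1), of "\<lambda>i j. a i \<inter> a j \<noteq> {}", rotated])
          (simp_all add: Int_commute)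
      then have "pairwise (\<lambda>i j. a i \<inter> a j \<subseteq> {}) J" by (simp add: pairwise_def)
      then show ?thesis using J(1,2) by blast
    qed
  qed
  obtain n where n: "uncountable {i \<in> I. card (a i) = n}"
    by (rule uncountable_common_value[OF assms(1), of "\<lambda>i. card (a i)"]) auto
  have "\<exists>J R. J \<subseteq> {i \<in> I. card (a i) = n} \<and> uncountable J \<and> finite R \<and> pairwise (\<lambda>i j. a i \<inter> a j \<subseteq> R) J"
    by (rule *[OF n]) (use assms(2) in auto)
  then obtain J R where J: "J \<subseteq> {i \<in> I. card (a i) = n}" "uncountable J" "finite R" "pairwise (\<lambda>i j. a i \<inter> a j \<subseteq> R) J"
    by (elim exE conjE) (rule that)
  show ?thesis by (rule that[OF _ J(2-4)]) (use J(1) in auto)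
qed

lemma countable_rational_functions:
  assumes "countable S"
  shows "countable {q :: 'i \<Rightarrow> real. finite (supp q) \<and> supp q \<subseteq> S \<and> range q \<subseteq> \<rat>}" (is "countable ?Q")
proof (rule countable_image_inj_on)
  let ?g = "\<lambda>q :: 'i \<Rightarrow> real. (\<lambda>i. (i, q i)) ` supp q"
  show "countable (?g ` ?Q)"
  proof (rule countable_subset)
    show "?g ` ?Q \<subseteq> {A. A \<subseteq> S \<times> \<rat> \<and> finite A}" by auto
    show "countable {A. A \<subseteq> S \<times> (\<rat> :: real set) \<and> finite A}"
      using countable_Collect_finite_subset[OF countable_SIGMA[OF assms countable_rat]] by (simp add: conj_commute)
  qed
  show "inj_on ?g ?Q"
  proof (rule inj_onI, rule ext)
    fix p q i assume eq: "?g p = ?g q"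
    have "(i, x) \<in> ?g f \<longleftrightarrow> x = f i \<and> f i \<noteq> 0" for f x by (auto simp: supp_def)
    then show "p i = q i" using eq by metis
  qed
qed

lemma L2_set_diff_eq_left: "(\<And>i. i \<in> A \<Longrightarrow> b i = 0) \<Longrightarrow> L2_set (a - b) A = L2_set a A"
  by (simp add: L2_set_def)

lemma L2_set_diff_eq_right: "(\<And>i. i \<in> A \<Longrightarrow> a i = 0) \<Longrightarrow> L2_set (a - b) A = L2_set b A"
  by (simp add: L2_set_def)

section \<open>Differences of disjointly supported vectors\<close>

text \<open>No clique meets both supports, so each clique sees only one of the two vectors.\<close>

lemma hnorm_disjoint_no_edges:
  assumes "finite (supp a)" "finite (supp b)" "supp a \<inter> supp b = {}"
    and c: "\<And>x y. x \<in> supp a \<Longrightarrow> y \<in> supp b \<Longrightarrow> \<not> c x y"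
  shows "hnorm c (a - b) \<le> max (hnorm c a) (hnorm c b)"
proof (rule hnorm_leI)
  fix A assume A: "A \<in> cliques c"
  note fin = cliques_finite[OF A]
  have "\<not> (x \<in> A \<inter> supp a \<and> y \<in> A \<inter> supp b)" for x y
  proof
    assume "x \<in> A \<inter> supp a \<and> y \<in> A \<inter> supp b"
    moreover from this have "x \<noteq> y" using assms(3) by blast
    ultimately show False using A c[of x y] unfolding cliques_def by blast
  qed
  then consider "A \<inter> supp a = {}" | "A \<inter> supp b = {}" by blast
  then show "L2_set (a - b) A \<le> max (hnorm c a) (hnorm c b)"
  proof cases
    case 1
    then have "L2_set (a - b) A = L2_set b A" by (intro L2_set_diff_eq_right) (auto simp: supp_def)
    then show ?thesis using L2_set_le_hnorm[OF hnorm_finite(1)[OF assms(2)] A] by simp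
  next
    case 2
    then have "L2_set (a - b) A = L2_set a A" by (intro L2_set_diff_eq_left) (auto simp: supp_def)
    then show ?thesis using L2_set_le_hnorm[OF hnorm_finite(1)[OF assms(1)] A] by simp
  qed
qed

lemma L2_set_diff_disjoint:
  assumes "finite A" "finite B" "A \<subseteq> supp a" "B \<subseteq> supp b" "supp a \<inter> supp b = {}"
  shows "L2_set (a - b) (A \<union> B) = sqrt ((L2_set a A)\<^sup>2 + (L2_set b B)\<^sup>2)"
proof -
  have "L2_set (a - b) A = L2_set a A" by (rule L2_set_diff_eq_left) (use assms in \<open>auto simp: supp_def\<close>)
  moreover have "L2_set (a - b) B = L2_set b B" by (rule L2_set_diff_eq_right) (use assms in \<open>auto simp: supp_def\<close>)
  moreover have "A \<inter> B = {}" using assms by blast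
  ultimately show ?thesis using L2_set_Un_disjoint[OF assms(1,2), of "a - b"] by simp
qed

text \<open>The union of a clique attaining the norm of \<open>a\<close> and one attaining that of
  \<open>b\<close> is again a clique, and the squares add.\<close>

lemma hnorm_disjoint_all_edges:
  assumes fin: "finite (supp a)" "finite (supp b)" and disj: "supp a \<inter> supp b = {}"
    and c: "\<And>x y. x \<in> supp a \<Longrightarrow> y \<in> supp b \<Longrightarrow> c x y \<and> c y x"
    and p: "0 \<le> p" "p \<le> hnorm c a" "p \<le> hnorm c b"
  shows "sqrt 2 * p \<le> hnorm c (a - b)"
proof -
  obtain A where A: "A \<in> cliques c" "A \<subseteq> supp a" "hnorm c a = L2_set a A" by (rule hnorm_finite_attained[OF fin(1)])
  obtain B where B: "B \<in> cliques c" "B \<subseteq> supp b" "hnorm c b = L2_set b B" by (rule hnorm_finite_attained[OF fin(2)])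
  have "p\<^sup>2 + p\<^sup>2 \<le> (L2_set a A)\<^sup>2 + (L2_set b B)\<^sup>2" using p A B by (intro add_mono power_mono) auto
  then have "sqrt (2 * p\<^sup>2) \<le> sqrt ((L2_set a A)\<^sup>2 + (L2_set b B)\<^sup>2)" by (intro real_sqrt_le_mono) simp
  then have "sqrt 2 * p \<le> L2_set (a - b) (A \<union> B)"
    using L2_set_diff_disjoint[OF cliques_finite[OF A(1)] cliques_finite[OF B(1)] A(2) B(2) disj] p(1)
    by (simp add: real_sqrt_mult)
  also have "\<dots> \<le> hnorm c (a - b)"
  proof (rule L2_set_le_hnorm)
    show "hbounded c (a - b)" by (intro hnorm_diff hnorm_finite fin)
    show "A \<union> B \<in> cliques c" using A B c by (auto simp: cliques_def)
  qed
  finally show ?thesis .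
qed

context strong_coloring
begin

lemma strong_family:
  assumes "uncountable J" "\<And>i. i \<in> J \<Longrightarrow> finite (a i)" "\<And>i. i \<in> J \<Longrightarrow> a i \<noteq> {}"
    "\<And>i j. i \<in> J \<Longrightarrow> j \<in> J \<Longrightarrow> i \<noteq> j \<Longrightarrow> a i \<inter> a j = {}"
  obtains i j where "i \<in> J" "j \<in> J" "i \<noteq> j" "\<And>x y. x \<in> a i \<Longrightarrow> y \<in> a j \<Longrightarrow> c x y \<longleftrightarrow> v"
proof -
  have "inj_on a J" using assms(3,4) by (fastforce intro: inj_onI)
  then have "uncountable (a ` J)" using assms(1) countable_image_inj_on by blast
  then have "\<exists>x\<in>a ` J. \<exists>y\<in>a ` J. x \<noteq> y \<and> (\<forall>s\<in>x. \<forall>t\<in>y. c s t \<longleftrightarrow> v)"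
  proof (rule strong)
    show "finite x" if "x \<in> a ` J" for x using that assms(2) by blast
    show "x \<inter> y = {}" if "x \<in> a ` J" "y \<in> a ` J" "x \<noteq> y" for x y using that assms(4) by blast
  qed
  then obtain i j where "i \<in> J" "j \<in> J" "a i \<noteq> a j" "\<forall>s\<in>a i. \<forall>t\<in>a j. c s t \<longleftrightarrow> v" by blast
  then show ?thesis by (intro that[of i j]) auto
qed

end

section \<open>Common form of an uncountable separated set\<close>

text \<open>Treats both spaces at once: \<open>t = 1\<close> is the sum of l2 norm and clique norm
  on l2, \<open>t = 0\<close> the clique norm on its own completion. The formula for the norm is
  required only at finite supports.\<close>

locale clique_norm =
  fixes c :: "'i \<Rightarrow> 'i \<Rightarrow> bool" and V :: "('i \<Rightarrow> real) set" and N :: "('i \<Rightarrow> real) \<Rightarrow> real" and t :: real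
  assumes norm: "is_norm_on V N"
    and finite_in: "finite (supp y) \<Longrightarrow> y \<in> V"
    and N_finite: "finite (supp y) \<Longrightarrow> N y = t * L2_set y (supp y) + hnorm c y"
    and dense: "x \<in> V \<Longrightarrow> 0 < e \<Longrightarrow> \<exists>y. finite (supp y) \<and> N (x - y) < e"
    and coord: "x \<in> V \<Longrightarrow> \<bar>x i\<bar> \<le> N x"
    and restr_in: "x \<in> V \<Longrightarrow> restr S x \<in> V" and N_restr: "x \<in> V \<Longrightarrow> N (restr S x) \<le> N x"
    and t: "0 \<le> t" "t \<le> 1"
begin

lemma V_closed: "x \<in> V \<Longrightarrow> y \<in> V \<Longrightarrow> x + y \<in> V" "x \<in> V \<Longrightarrow> y \<in> V \<Longrightarrow> x - y \<in> V"
  using norm unfolding is_norm_on_def by (auto intro: subspace_add subspace_diff)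

lemma N_add: "x \<in> V \<Longrightarrow> y \<in> V \<Longrightarrow> N (x + y) \<le> N x + N y"
  using norm unfolding is_norm_on_def by blast

lemma N_minus_commute:
  assumes "x \<in> V" "y \<in> V" shows "N (x - y) = N (y - x)"
proof -
  have "N ((-1) *\<^sub>R (y - x)) = \<bar>-1\<bar> * N (y - x)"
    using norm V_closed(2)[OF assms(2,1)] unfolding is_norm_on_def by blast
  moreover have "(-1) *\<^sub>R (y - x) = x - y" by (simp add: fun_eq_iff)
  ultimately show ?thesis by simp
qed

lemma N_triangle:
  assumes "x \<in> V" "y \<in> V" "z \<in> V" shows "N (x - z) \<le> N (x - y) + N (y - z)"
  using N_add[of "x - y" "y - z"] V_closed(2) assms by simp

lemma N_diff: "x \<in> V \<Longrightarrow> y \<in> V \<Longrightarrow> N (x - y) \<le> N x + N y"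
  using N_triangle[of x 0 y] N_minus_commute[of 0 y] finite_in[of 0] by (simp add: supp_def)

lemma ex_rational_approx:
  assumes x: "x \<in> V" and e: "0 < e"
  obtains q where "finite (supp q)" "supp q \<subseteq> supp x" "range q \<subseteq> \<rat>" "N (x - q) < e"
proof -
  obtain y0 where y0: "finite (supp y0)" "N (x - y0) < e / 2" using dense[OF x half_gt_zero[OF e]] by blast
  define y where "y = restr (supp x) y0"
  have fin: "finite (supp y)" unfolding y_def using y0 by simp
  have "x - y = restr (supp x) (x - y0)" by (simp add: restr_diff restr_idem y_def)
  then have xy: "N (x - y) < e / 2"
    using N_restr[of "x - y0" "supp x"] V_closed(2)[OF x finite_in[OF y0(1)]] y0(2) by simp
  \<comment> \<open>Rounding all coordinates costs less than \<open>e / 4\<close> in the l2 norm,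
    and \<open>N\<close> is at most twice the l2 norm there because \<open>t\<close> is at most 1.
    The summand 1 covers an empty support.\<close>
  define d where "d = e / (4 * (real (card (supp y)) + 1))"
  have d: "d > 0" unfolding d_def using e by (intro divide_pos_pos) auto
  have "\<exists>r\<in>\<rat>. \<bar>y i - r\<bar> < d" for i
    using Rats_dense_in_real[of "y i" "y i + d"] d by (auto intro!: bexI)
  then obtain r where r: "\<And>i. r i \<in> \<rat>" "\<And>i. \<bar>y i - r i\<bar> < d" by metis
  define q where "q i = (if i \<in> supp y then r i else 0)" for i
  have sq: "supp q \<subseteq> supp y" unfolding q_def by (auto simp: supp_def)
  have finq: "finite (supp q)" using finite_subset[OF sq fin] .
  have sd: "supp (y - q) \<subseteq> supp y" using supp_diff[of y q] sq by blast
  have find: "finite (supp (y - q))" using finite_subset[OF sd fin] .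
  have "L2_set (y - q) (supp (y - q)) \<le> (\<Sum>i\<in>supp (y - q). \<bar>(y - q) i\<bar>)" by (rule L2_set_le_sum_abs)
  also have "\<dots> \<le> (\<Sum>i\<in>supp y. \<bar>(y - q) i\<bar>)" using sd fin by (intro sum_mono2) auto
  also have "\<dots> \<le> (\<Sum>i\<in>supp y. d)" using r by (intro sum_mono) (auto simp: q_def intro: less_imp_le)
  also have "\<dots> < e / 4"
  proof -
    have "real (card (supp y)) * d < (real (card (supp y)) + 1) * d" using d by simp
    also have "\<dots> = e / 4" unfolding d_def by (simp add: field_simps)
    finally show ?thesis by simp
  qed
  finally have L: "L2_set (y - q) (supp (y - q)) < e / 4" .
  have "t * L2_set (y - q) (supp (y - q)) \<le> 1 * L2_set (y - q) (supp (y - q))"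
    using t by (intro mult_right_mono) auto
  then have "N (y - q) < e / 2" using N_finite[OF find] hnorm_finite(2)[OF find, of c] L by linarith
  then have "N (x - q) < e"
    using N_triangle[OF x finite_in[OF fin] finite_in[OF finq]] xy by linarith
  moreover have "range q \<subseteq> \<rat>" using r by (auto simp: q_def)
  moreover have "supp q \<subseteq> supp x" using sq unfolding y_def by auto
  ultimately show ?thesis using that finq by blast
qed

text \<open>Were the union of the supports countable, rational approximations would make
  \<open>Y\<close> countable. Hence uncountably many coordinates \<open>i\<close> have a vector
  \<open>w i\<close> in \<open>Y\<close> not vanishing at \<open>i\<close>, and pigeonholing makes
  the lower bound on this coordinate and the bound on the norms uniform.\<close>

lemma spread_coordinates:
  assumes Y: "Y \<subseteq> V" "uncountable Y" and d: "0 < \<delta>" "\<And>x y. x \<in> Y \<Longrightarrow> y \<in> Y \<Longrightarrow> x \<noteq> y \<Longrightarrow> \<delta> \<le> N (x - y)"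
  obtains \<eta> B I w where "0 < \<eta>" "uncountable I" "inj_on w I" "\<And>i. i \<in> I \<Longrightarrow> w i \<in> Y"
    "\<And>i. i \<in> I \<Longrightarrow> \<eta> \<le> \<bar>w i i\<bar>" "\<And>i. i \<in> I \<Longrightarrow> N (w i) \<le> B"
proof -
  define S where "S = (\<Union>x\<in>Y. supp x)"
  have "uncountable S"
  proof
    assume S: "countable S"
    have "\<exists>q. finite (supp q) \<and> supp q \<subseteq> S \<and> range q \<subseteq> \<rat> \<and> N (x - q) < \<delta> / 2" if "x \<in> Y" for x
    proof -
      have "x \<in> V" using that Y by blast
      then obtain q where "finite (supp q)" "supp q \<subseteq> supp x" "range q \<subseteq> \<rat>" "N (x - q) < \<delta> / 2"
        by (rule ex_rational_approx[OF _ half_gt_zero[OF d(1)]])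
      then show ?thesis using that unfolding S_def by blast
    qed
    then obtain q where q: "\<And>x. x \<in> Y \<Longrightarrow> finite (supp (q x)) \<and> supp (q x) \<subseteq> S \<and> range (q x) \<subseteq> \<rat> \<and> N (x - q x) < \<delta> / 2"
      by metis
    have "inj_on q Y"
    proof (rule inj_onI, rule ccontr)
      fix x y assume xy: "x \<in> Y" "y \<in> Y" "q x = q y" "x \<noteq> y"
      have v: "x \<in> V" "y \<in> V" "q x \<in> V" using xy Y q finite_in by auto
      have "N (x - y) \<le> N (x - q x) + N (q x - y)" by (rule N_triangle) (use v in auto)
      also have "N (q x - y) = N (y - q y)" using N_minus_commute v xy by metis
      finally show False using q[OF xy(1)] q[OF xy(2)] d(2)[OF xy(1,2,4)] by linarith
    qed
    moreover have "countable (q ` Y)"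
      by (rule countable_subset[OF _ countable_rational_functions[OF S]]) (use q in auto)
    ultimately show False using Y countable_image_inj_on by blast
  qed
  have "\<exists>x\<in>Y. x i \<noteq> 0" if "i \<in> S" for i using that unfolding S_def supp_def by blast
  then obtain w where w: "\<And>i. i \<in> S \<Longrightarrow> w i \<in> Y" "\<And>i. i \<in> S \<Longrightarrow> w i i \<noteq> 0" by metis
  have "S \<subseteq> (\<Union>n. {i. 1 / real (Suc n) \<le> \<bar>w i i\<bar> \<and> N (w i) \<le> real n})"
  proof
    fix i assume "i \<in> S"
    then have "0 < \<bar>w i i\<bar>" using w by simp
    then obtain m where m: "1 / real (Suc m) < \<bar>w i i\<bar>" using nat_approx_posE by metis
    obtain k where k: "N (w i) \<le> real k" using real_arch_simple by blast
    have "1 / real (Suc (max m k)) \<le> 1 / real (Suc m)" by (intro divide_left_mono) auto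
    then show "i \<in> (\<Union>n. {i. 1 / real (Suc n) \<le> \<bar>w i i\<bar> \<and> N (w i) \<le> real n})"
      using m k by (intro UN_I[of "max m k"]) auto
  qed
  then obtain n where n: "uncountable (S \<inter> {i. 1 / real (Suc n) \<le> \<bar>w i i\<bar> \<and> N (w i) \<le> real n})" (is "uncountable ?I")
    by (rule uncountable_UN_nat[OF \<open>uncountable S\<close>])
  define \<eta> where "\<eta> = 1 / real (Suc n)"
  have \<eta>: "\<eta> > 0" unfolding \<eta>_def by simp
  \<comment> \<open>A vector within \<open>\<eta>\<close> of a finitely supported one has only
    finitely many coordinates of size at least \<open>\<eta>\<close>, so it is chosen for finitely
    many indices.\<close>
  have "countable {j \<in> ?I. w i = w j}" if i: "i \<in> ?I" for i
  proof -
    have "w i \<in> V" using i w Y by blast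
    then obtain y where y: "finite (supp y)" "N (w i - y) < \<eta>" using dense \<eta> by blast
    have "{j \<in> ?I. w i = w j} \<subseteq> supp y"
    proof safe
      fix j assume j: "j \<in> S" "1 / real (Suc n) \<le> \<bar>w j j\<bar>" "w i = w j"
      have "\<bar>(w i - y) j\<bar> \<le> N (w i - y)" by (intro coord V_closed \<open>w i \<in> V\<close> finite_in y)
      then show "j \<in> supp y" using j y unfolding \<eta>_def supp_def by auto
    qed
    then show ?thesis using y(1) countable_finite finite_subset by blast
  qed
  then obtain J where J: "J \<subseteq> ?I" "uncountable J" "pairwise (\<lambda>i j. \<not> w i = w j) J"
    using uncountable_independent[OF n, of "\<lambda>i j. w i = w j"] by auto
  show ?thesis
  proof (rule that[OF \<eta> J(2)])
    show "inj_on w J" using J(3) by (auto simp: pairwise_def inj_on_def)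
  qed (use J(1) w in \<open>auto simp: \<eta>_def\<close>)
qed

text \<open>Rational approximations restricted to the finite root take countably many values, so
  uncountably many share one value \<open>r\<close>. What remains outside the root is disjointly
  supported, and \<open>r\<close> cancels in differences.\<close>

lemma common_part:
  assumes I: "uncountable I" "\<And>i. i \<in> I \<Longrightarrow> w i \<in> V" "\<And>i. i \<in> I \<Longrightarrow> \<eta> \<le> \<bar>w i i\<bar>"
    and e: "0 < \<epsilon>" "\<epsilon> < \<eta>" and F: "finite F"
  obtains J r z where "J \<subseteq> I" "uncountable J" "finite (supp r)"
    "\<And>i. i \<in> J \<Longrightarrow> finite (supp (z i))" "\<And>i. i \<in> J \<Longrightarrow> supp (z i) \<inter> (supp r \<union> F) = {}"
    "\<And>i. i \<in> J \<Longrightarrow> \<eta> - \<epsilon> \<le> \<bar>z i i\<bar>" "\<And>i. i \<in> J \<Longrightarrow> N (w i - (r + z i)) < \<epsilon>"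
    "\<And>i j. i \<in> J \<Longrightarrow> j \<in> J \<Longrightarrow> i \<noteq> j \<Longrightarrow> supp (z i) \<inter> supp (z j) = {}"
proof -
  have "\<exists>q. finite (supp q) \<and> range q \<subseteq> \<rat> \<and> N (w i - q) < \<epsilon>" if "i \<in> I" for i
    using ex_rational_approx[OF I(2)[OF that] e(1)] by metis
  then obtain q where q: "\<And>i. i \<in> I \<Longrightarrow> finite (supp (q i))" "\<And>i. i \<in> I \<Longrightarrow> range (q i) \<subseteq> \<rat>" "\<And>i. i \<in> I \<Longrightarrow> N (w i - q i) < \<epsilon>"
    by metis
  obtain J0 R0 where J0: "J0 \<subseteq> I" "uncountable J0" "finite R0" "pairwise (\<lambda>i j. supp (q i) \<inter> supp (q j) \<subseteq> R0) J0"
    by (rule weak_delta_system[OF I(1), of "\<lambda>i. supp (q i)"]) (use q(1) in blast)+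
  \<comment> \<open>Coordinates to be avoided are added to the root, which moves them into the
    cancelling part.\<close>
  define R where "R = R0 \<union> F"
  have R: "finite R" unfolding R_def using J0 F by simp
  have "countable ((\<lambda>i. restr R (q i)) ` J0)"
  proof (rule countable_subset[OF _ countable_rational_functions[of R]])
    have "restr R (q i) j \<in> \<rat>" if "i \<in> J0" for i j
      using q(2)[of i] J0(1) that by (auto simp: restr_def)
    then show "(\<lambda>i. restr R (q i)) ` J0 \<subseteq> {q. finite (supp q) \<and> supp q \<subseteq> R \<and> range q \<subseteq> \<rat>}"
      using R by auto
    show "countable R" using R by (rule countable_finite)
  qed
  then obtain r where r: "uncountable {i \<in> J0. restr R (q i) = r}" by (rule uncountable_common_value[OF J0(2)])
  \<comment> \<open>Dropping the indices in the root ensures that the large coordinate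
    \<open>i\<close> of \<open>q i\<close> survives in \<open>z i\<close>.\<close>
  define J where "J = {i \<in> J0. restr R (q i) = r} - R"
  define z where "z i = restr (- R) (q i)" for i
  have eq: "r + z i = q i" if "i \<in> J" for i
    using that unfolding J_def z_def by (auto simp: restr_def)
  have J: "J \<subseteq> I" unfolding J_def using J0 by auto
  have "uncountable J" unfolding J_def using r countable_finite[OF R] uncountable_minus_countable by blast
  then obtain i0 where "i0 \<in> J" by fastforce
  then have r_supp: "supp r \<subseteq> R" unfolding J_def by auto
  show ?thesis
  proof (rule that[OF J \<open>uncountable J\<close>])
    show "finite (supp r)" using r_supp R by (rule finite_subset)
    fix i assume i: "i \<in> J"
    show "finite (supp (z i))" unfolding z_def using q(1) i J by auto
    show "supp (z i) \<inter> (supp r \<union> F) = {}" using r_supp unfolding z_def R_def by auto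
    show "N (w i - (r + z i)) < \<epsilon>" using q(3) i J eq[OF i] by auto
    have iI: "i \<in> I" using i J by blast
    have "\<bar>(w i - q i) i\<bar> \<le> N (w i - q i)" by (intro coord V_closed I(2)[OF iI] finite_in q(1)[OF iI])
    then have "\<eta> - \<epsilon> \<le> \<bar>q i i\<bar>" using I(3)[OF iI] q(3)[OF iI] by auto
    moreover have "z i i = q i i" using i unfolding J_def z_def restr_def by auto
    ultimately show "\<eta> - \<epsilon> \<le> \<bar>z i i\<bar>" by simp
    fix j assume j: "j \<in> J" "i \<noteq> j"
    then have "supp (q i) \<inter> supp (q j) \<subseteq> R" using J0(4) i unfolding J_def R_def pairwise_def by blast
    then show "supp (z i) \<inter> supp (z j) = {}" unfolding z_def by auto
  qed
qed

end

context clique_norm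
begin

lemma N_common_part:
  assumes "x \<in> V" "y \<in> V" "r \<in> V" "a \<in> V" "b \<in> V" "N (x - (r + a)) \<le> e" "N (y - (r + b)) \<le> e"
  shows "N (x - y) \<le> N (a - b) + 2 * e" "N (a - b) \<le> N (x - y) + 2 * e"
proof -
  let ?p = "x - (r + a)" and ?q = "y - (r + b)"
  have in_V: "?p - ?q \<in> V" "?p \<in> V" "?q \<in> V" "a - b \<in> V" "x - y \<in> V" using assms V_closed by auto
  have pq: "N (?p - ?q) \<le> 2 * e" using N_diff[OF in_V(2,3)] assms by linarith
  have "(a - b) + (?p - ?q) = x - y" "(x - y) - (?p - ?q) = a - b" by simp_all
  then have "N (x - y) \<le> N (a - b) + N (?p - ?q)" "N (a - b) \<le> N (x - y) + N (?p - ?q)"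
    using N_add[OF in_V(4,1)] N_diff[OF in_V(5,1)] by (simp_all only:)
  then show "N (x - y) \<le> N (a - b) + 2 * e" "N (a - b) \<le> N (x - y) + 2 * e" using pq by linarith+
qed

end

lemma supp_diff_disjoint:
  assumes "supp x \<inter> supp y = {}"
  shows "supp (x - y) = supp x \<union> supp y"
proof (rule set_eqI)
  fix i
  have "x i = 0 \<or> y i = 0" using assms by (auto simp: supp_def)
  then show "i \<in> supp (x - y) \<longleftrightarrow> i \<in> supp x \<union> supp y" by (auto simp: supp_def)
qed

lemma L2_pair_le:
  assumes "0 \<le> x" "0 \<le> y" "x \<le> s" "y \<le> s"
  shows "sqrt (x\<^sup>2 + y\<^sup>2) \<le> sqrt 2 * s"
proof -
  have "x\<^sup>2 + y\<^sup>2 \<le> s\<^sup>2 + s\<^sup>2" using assms by (intro add_mono power_mono) auto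
  then have "sqrt (x\<^sup>2 + y\<^sup>2) \<le> sqrt (2 * s\<^sup>2)" by (intro real_sqrt_le_mono) simp
  then show ?thesis using assms by (simp add: real_sqrt_mult)
qed

lemma L2_pair_ge:
  assumes "s \<le> x" "s \<le> y" "0 \<le> x" "0 \<le> y"
  shows "sqrt 2 * s \<le> sqrt (x\<^sup>2 + y\<^sup>2)"
proof (cases "0 \<le> s")
  case True
  have "s\<^sup>2 + s\<^sup>2 \<le> x\<^sup>2 + y\<^sup>2" using assms True by (intro add_mono power_mono) auto
  then have "sqrt (2 * s\<^sup>2) \<le> sqrt (x\<^sup>2 + y\<^sup>2)" by (intro real_sqrt_le_mono) simp
  then show ?thesis using True by (simp add: real_sqrt_mult)
next
  case False
  then have "sqrt 2 * s \<le> 0" by (simp add: mult_nonneg_nonpos)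
  then show ?thesis by (smt (verit) real_sqrt_ge_zero zero_le_power2)
qed

section \<open>Equilateral and separated sets\<close>

locale strong_clique_norm = strong_coloring c + clique_norm c V N t
  for c :: "'i \<Rightarrow> 'i \<Rightarrow> bool" and V N t
begin

text \<open>With all l2 norms near \<open>s\<close> and all clique norms near \<open>p\<close>, an
  unjoined pair has distance at most about \<open>t * (sqrt 2 * s) + p\<close>, a joined one at
  least about \<open>t * (sqrt 2 * s) + sqrt 2 * p\<close>. Equality up to errors of order
  \<open>\<epsilon>\<close> is impossible because \<open>p\<close> is large compared with
  \<open>\<epsilon>\<close>.\<close>

theorem no_uncountable_equilateral:
  assumes Y: "Y \<subseteq> V" "uncountable Y"
  shows "\<not> equilateral N Y"
proof
  assume "equilateral N Y"
  then obtain \<delta> where \<delta>: "0 < \<delta>" "\<And>x y. x \<in> Y \<Longrightarrow> y \<in> Y \<Longrightarrow> x \<noteq> y \<Longrightarrow> N (x - y) = \<delta>"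
    unfolding equilateral_def by blast
  obtain \<eta> B I w where \<eta>: "0 < \<eta>" and I: "uncountable I" "inj_on w I" and w: "\<And>i. i \<in> I \<Longrightarrow> w i \<in> Y"
    "\<And>i. i \<in> I \<Longrightarrow> \<eta> \<le> \<bar>w i i\<bar>" "\<And>i. i \<in> I \<Longrightarrow> N (w i) \<le> B"
    by (rule spread_coordinates[OF Y \<delta>(1)]) (simp add: \<delta>(2), rule that)
  have wV: "\<And>i. i \<in> I \<Longrightarrow> w i \<in> V" using w Y by blast
  \<comment> \<open>Each \<open>z i\<close> has a coordinate of size at least
    \<open>99 * \<epsilon>\<close>, hence \<open>p\<close> is at least
    \<open>98 * \<epsilon>\<close> after rounding, while all errors together will amount to
    \<open>7 * \<epsilon>\<close>.\<close>
  define \<epsilon> where "\<epsilon> = \<eta> / 100"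
  have \<epsilon>: "0 < \<epsilon>" "\<epsilon> < \<eta>" using \<eta> unfolding \<epsilon>_def by auto
  obtain J r z where J: "J \<subseteq> I" "uncountable J" and r: "finite (supp r)"
    and z: "\<And>i. i \<in> J \<Longrightarrow> finite (supp (z i))" "\<And>i. i \<in> J \<Longrightarrow> supp (z i) \<inter> (supp r \<union> {}) = {}"
    "\<And>i. i \<in> J \<Longrightarrow> \<eta> - \<epsilon> \<le> \<bar>z i i\<bar>" "\<And>i. i \<in> J \<Longrightarrow> N (w i - (r + z i)) < \<epsilon>"
    "\<And>i j. i \<in> J \<Longrightarrow> j \<in> J \<Longrightarrow> i \<noteq> j \<Longrightarrow> supp (z i) \<inter> supp (z j) = {}"
    by (rule common_part[OF I(1) wV w(2) \<epsilon> finite.emptyI]) (assumption, assumption, rule that)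
  define L where "L i = L2_set (z i) (supp (z i))" for i
  define h where "h i = hnorm c (z i)" for i
  \<comment> \<open>Pairs of bins of width \<open>\<epsilon>\<close>; countably many exist, so
    uncountably many indices share both levels.\<close>
  define f where "f i = (\<lfloor>L i / \<epsilon>\<rfloor>, \<lfloor>h i / \<epsilon>\<rfloor>)" for i
  obtain v where v: "uncountable {i \<in> J. f i = v}"
    by (rule uncountable_common_value[OF J(2), of f]) (rule countableI_type)
  define K where "K = {i \<in> J. f i = v}"
  have K: "uncountable K" "\<And>i. i \<in> K \<Longrightarrow> i \<in> J" using v unfolding K_def by auto
  define s where "s = of_int (fst v) * \<epsilon>"
  define p where "p = of_int (snd v) * \<epsilon>"
  have levels: "s \<le> L i" "L i \<le> s + \<epsilon>" "p \<le> h i" "h i \<le> p + \<epsilon>" if "i \<in> K" for i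
  proof -
    have "v = f i" using that unfolding K_def by simp
    then have "s = of_int \<lfloor>L i / \<epsilon>\<rfloor> * \<epsilon>" "p = of_int \<lfloor>h i / \<epsilon>\<rfloor> * \<epsilon>" unfolding s_def p_def f_def by simp_all
    then show "s \<le> L i" "L i \<le> s + \<epsilon>" "p \<le> h i" "h i \<le> p + \<epsilon>"
      using floor_divide_lower[OF \<epsilon>(1), of "L i"] floor_divide_upper[OF \<epsilon>(1), of "L i"]
        floor_divide_lower[OF \<epsilon>(1), of "h i"] floor_divide_upper[OF \<epsilon>(1), of "h i"] by (simp_all add: algebra_simps)
  qed
  have nonempty: "supp (z i) \<noteq> {}" if "i \<in> K" for i
    using z(3)[OF K(2)[OF that]] \<epsilon> unfolding supp_def by force
  have p_ge: "98 * \<epsilon> \<le> p"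
  proof -
    obtain i where i: "i \<in> K" using K(1) by fastforce
    have "\<bar>z i i\<bar> \<le> h i" unfolding h_def using z(1) K(2) i by (intro abs_le_hnorm hnorm_finite) auto
    then show ?thesis using z(3)[of i] K(2)[OF i] levels[OF i] unfolding \<epsilon>_def by simp
  qed
  have dist: "N (z i - z j) = t * sqrt ((L i)\<^sup>2 + (L j)\<^sup>2) + hnorm c (z i - z j)" "\<bar>N (z i - z j) - \<delta>\<bar> \<le> 2 * \<epsilon>"
    if ij: "i \<in> K" "j \<in> K" "i \<noteq> j" for i j
  proof -
    have J': "i \<in> J" "j \<in> J" using ij K by auto
    note disj = z(5)[OF J' ij(3)]
    have fin: "finite (supp (z i - z j))"
      by (rule finite_subset[OF supp_diff]) (use z(1) J' in simp)
    have "supp (z i - z j) = supp (z i) \<union> supp (z j)" using disj by (rule supp_diff_disjoint)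
    then have "L2_set (z i - z j) (supp (z i - z j)) = sqrt ((L i)\<^sup>2 + (L j)\<^sup>2)"
      using L2_set_diff_disjoint[OF z(1)[OF J'(1)] z(1)[OF J'(2)] subset_refl subset_refl disj] unfolding L_def by simp
    then show "N (z i - z j) = t * sqrt ((L i)\<^sup>2 + (L j)\<^sup>2) + hnorm c (z i - z j)" using N_finite[OF fin] by simp
    have "w i \<noteq> w j" using I(2) ij(3) J' J(1) by (auto dest: inj_onD)
    then have "N (w i - w j) = \<delta>" using \<delta>(2) w(1) J' J(1) by blast
    moreover have "N (w i - w j) \<le> N (z i - z j) + 2 * \<epsilon>" "N (z i - z j) \<le> N (w i - w j) + 2 * \<epsilon>"
      by (rule N_common_part[of _ _ r]; use J' J(1) wV finite_in r z(1) z(4)[OF J'(1)] z(4)[OF J'(2)] in force)+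
    ultimately show "\<bar>N (z i - z j) - \<delta>\<bar> \<le> 2 * \<epsilon>" by linarith
  qed
  have L0: "0 \<le> L i" for i unfolding L_def by (rule L2_set_nonneg)
  obtain i j where ij: "i \<in> K" "j \<in> K" "i \<noteq> j" "\<And>x y. x \<in> supp (z i) \<Longrightarrow> y \<in> supp (z j) \<Longrightarrow> c x y \<longleftrightarrow> False"
    by (rule strong_family[OF K(1), of "\<lambda>i. supp (z i)" False]) (use K(2) z nonempty in auto)
  have "hnorm c (z i - z j) \<le> max (h i) (h j)"
    unfolding h_def by (rule hnorm_disjoint_no_edges) (use ij K(2) z in auto)
  also have "\<dots> \<le> p + \<epsilon>" using levels ij by simp
  finally have "hnorm c (z i - z j) \<le> p + \<epsilon>" .
  moreover have "t * sqrt ((L i)\<^sup>2 + (L j)\<^sup>2) \<le> t * (sqrt 2 * (s + \<epsilon>))"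
    using t(1) L0 levels ij(1,2) by (intro mult_left_mono L2_pair_le) auto
  ultimately have upper: "\<delta> \<le> t * (sqrt 2 * (s + \<epsilon>)) + p + 3 * \<epsilon>" using dist[OF ij(1-3)] by linarith
  obtain k l where kl: "k \<in> K" "l \<in> K" "k \<noteq> l" "\<And>x y. x \<in> supp (z k) \<Longrightarrow> y \<in> supp (z l) \<Longrightarrow> c x y \<longleftrightarrow> True"
    by (rule strong_family[OF K(1), of "\<lambda>i. supp (z i)" True]) (use K(2) z nonempty in auto)
  have "sqrt 2 * p \<le> hnorm c (z k - z l)"
    by (rule hnorm_disjoint_all_edges) (use kl K(2) z sym levels p_ge \<epsilon> in \<open>auto simp: h_def\<close>)
  moreover have "t * (sqrt 2 * s) \<le> t * sqrt ((L k)\<^sup>2 + (L l)\<^sup>2)"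
    using t(1) L0 levels kl(1,2) by (intro mult_left_mono L2_pair_ge) auto
  ultimately have lower: "t * (sqrt 2 * s) + sqrt 2 * p \<le> \<delta> + 2 * \<epsilon>" using dist[OF kl(1-3)] by linarith
  have "t * (sqrt 2 * (s + \<epsilon>)) = t * (sqrt 2 * s) + t * (sqrt 2 * \<epsilon>)" by (simp add: algebra_simps)
  then have "sqrt 2 * p \<le> t * (sqrt 2 * \<epsilon>) + p + 5 * \<epsilon>" using upper lower by linarith
  moreover have "t * (sqrt 2 * \<epsilon>) \<le> 1 * (2 * \<epsilon>)"
    using t \<epsilon> by (intro mult_mono) (auto intro: real_le_lsqrt)
  \<comment> \<open>A rational lower bound for \<open>sqrt 2\<close>: two fifths of
    \<open>98 * \<epsilon>\<close> exceed \<open>7 * \<epsilon>\<close>.\<close>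
  moreover have "(7 / 5) * p \<le> sqrt 2 * p"
    using p_ge \<epsilon> by (intro mult_right_mono real_le_rsqrt) (auto simp: power2_eq_square)
  ultimately show False using p_ge \<epsilon>(1) by linarith
qed

text \<open>For \<open>t = 0\<close> the distance of an unjoined pair is at most the larger of the
  two norms. Each \<open>z i\<close> is a restriction of \<open>r + z i\<close>, which is nearly a
  unit vector, so this maximum is at most \<open>1 + e\<close>.\<close>

theorem no_uncountable_separated:
  assumes "t = 0" "0 < \<epsilon>" and Y: "Y \<subseteq> unit_sphere_of V N" "uncountable Y"
  shows "\<not> separated N (1 + \<epsilon>) Y"
proof
  assume sep: "separated N (1 + \<epsilon>) Y"
  have YV: "Y \<subseteq> V" and Y1: "\<And>y. y \<in> Y \<Longrightarrow> N y = 1" using Y unfolding unit_sphere_of_def by auto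
  obtain \<eta> B I w where \<eta>: "0 < \<eta>" and I: "uncountable I" "inj_on w I" and w: "\<And>i. i \<in> I \<Longrightarrow> w i \<in> Y"
    "\<And>i. i \<in> I \<Longrightarrow> \<eta> \<le> \<bar>w i i\<bar>" "\<And>i. i \<in> I \<Longrightarrow> N (w i) \<le> B"
    by (rule spread_coordinates[OF YV Y(2), of "1 + \<epsilon>"]) (use sep \<open>0 < \<epsilon>\<close> in \<open>auto simp: separated_def\<close>)
  have wV: "\<And>i. i \<in> I \<Longrightarrow> w i \<in> V" using w YV by blast
  \<comment> \<open>One \<open>e\<close> is lost in the norm of \<open>z i\<close> and two in
    passing back to \<open>w i - w j\<close>, so \<open>3 * e\<close> must stay below
    \<open>\<epsilon>\<close>.\<close>
  define e where "e = min (\<epsilon> / 4) (\<eta> / 2)"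
  have e: "0 < e" "e < \<eta>" "3 * e < \<epsilon>" using \<eta> \<open>0 < \<epsilon>\<close> unfolding e_def by auto
  obtain J r z where J: "J \<subseteq> I" "uncountable J" and r: "finite (supp r)"
    and z: "\<And>i. i \<in> J \<Longrightarrow> finite (supp (z i))" "\<And>i. i \<in> J \<Longrightarrow> supp (z i) \<inter> (supp r \<union> {}) = {}"
    "\<And>i. i \<in> J \<Longrightarrow> \<eta> - e \<le> \<bar>z i i\<bar>" "\<And>i. i \<in> J \<Longrightarrow> N (w i - (r + z i)) < e"
    "\<And>i j. i \<in> J \<Longrightarrow> j \<in> J \<Longrightarrow> i \<noteq> j \<Longrightarrow> supp (z i) \<inter> supp (z j) = {}"
    by (rule common_part[OF I(1) wV w(2) e(1,2) finite.emptyI]) (assumption, assumption, rule that)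
  have nonempty: "supp (z i) \<noteq> {}" if "i \<in> J" for i
    using z(3)[OF that] e unfolding supp_def by force
  have hz: "hnorm c (z i) \<le> 1 + e" if i: "i \<in> J" for i
  proof -
    have fin: "finite (supp (r + z i))" by (rule finite_subset[OF supp_add]) (use z(1) i r in simp)
    have "z i = restr (supp (z i)) (r + z i)"
      using z(2)[OF i] by (auto simp: restr_def supp_def fun_eq_iff)
    then have "hnorm c (z i) \<le> hnorm c (r + z i)" using hnorm_restr(2)[OF hnorm_finite(1)[OF fin]] by metis
    also have "\<dots> = N (r + z i)" using N_finite[OF fin] \<open>t = 0\<close> by simp
    also have "\<dots> \<le> N (w i) + N (w i - (r + z i))"
    proof -
      have wi: "w i \<in> V" using wV J i by blast
      have "r + z i \<in> V" using fin by (rule finite_in)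
      then have "N (w i - (w i - (r + z i))) \<le> N (w i) + N (w i - (r + z i))" using wi V_closed by (intro N_diff) auto
      then show ?thesis by simp
    qed
    finally show ?thesis using z(4)[OF i] Y1 w(1) J i by force
  qed
  obtain i j where ij: "i \<in> J" "j \<in> J" "i \<noteq> j" "\<And>x y. x \<in> supp (z i) \<Longrightarrow> y \<in> supp (z j) \<Longrightarrow> c x y \<longleftrightarrow> False"
    by (rule strong_family[OF J(2), of "\<lambda>i. supp (z i)" False]) (use z nonempty in auto)
  have fin: "finite (supp (z i - z j))"
    by (rule finite_subset[OF supp_diff]) (use z(1) ij in simp)
  have "N (z i - z j) = hnorm c (z i - z j)" using N_finite[OF fin] \<open>t = 0\<close> by simp
  also have "\<dots> \<le> max (hnorm c (z i)) (hnorm c (z j))"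
    by (rule hnorm_disjoint_no_edges) (use ij z in auto)
  also have "\<dots> \<le> 1 + e" using hz ij by simp
  finally have "N (z i - z j) \<le> 1 + e" .
  moreover have "N (w i - w j) \<le> N (z i - z j) + 2 * e"
    by (rule N_common_part[of _ _ r]) (use ij J(1) wV finite_in r z(1) z(4)[OF ij(1)] z(4)[OF ij(2)] in force)+
  moreover have "w i \<noteq> w j" using I(2) ij(1-3) J(1) by (auto dest: inj_onD)
  then have "1 + \<epsilon> \<le> N (w i - w j)" using sep w(1) ij(1,2) J(1) unfolding separated_def by blast
  ultimately show False using e by linarith
qed

end

section \<open>The two instances\<close>

lemma strong_clique_norm_hspace:
  assumes "strong_coloring c"
  shows "strong_clique_norm c (hspace c) (hnorm c) 0"
proof -
  interpret strong_coloring c by fact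
  show ?thesis
  proof
    show "is_norm_on (hspace c) (hnorm c)" by (rule hspace_is_norm)
    show "y \<in> hspace c" if "finite (supp y)" for y using that by (rule hspace_finite)
    show "restr S x \<in> hspace c" if x: "x \<in> hspace c" for x S
    proof (rule hspace_closed)
      show "hbounded c (restr S x)" by (intro hnorm_restr hspace_hbounded x)
      fix e :: real assume "e > 0"
      then obtain y where y: "finite (supp y)" "hnorm c (x - y) < e" using hspace_approx[OF x] by blast
      have "hnorm c (restr S x - restr S y) \<le> hnorm c (x - y)"
        unfolding restr_diff[symmetric] by (intro hnorm_restr hnorm_diff hspace_hbounded x hnorm_finite y)
      then show "\<exists>y\<in>hspace c. hnorm c (restr S x - y) < e"
        using y by (intro bexI[of _ "restr S y"]) (auto intro: hspace_finite)
    qed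
  qed (auto intro: hspace_approx abs_le_hnorm hnorm_restr hspace_hbounded)
qed

text \<open>The clique norm never exceeds the l2 norm, so the sum is equivalent to it with constants
  1 and 2.\<close>

lemma strong_clique_norm_l2:
  assumes "strong_coloring c"
  shows "strong_clique_norm c (l2_space UNIV) (\<lambda>x. l2_norm x + hnorm c x) 1"
    and "equivalent_norm (l2_space UNIV) l2_norm (\<lambda>x. l2_norm x + hnorm c x)"
proof -
  interpret strong_coloring c by fact
  let ?V = "hspace (all_pairs :: 'a \<Rightarrow> 'a \<Rightarrow> bool)"
  let ?N = "\<lambda>x. l2_norm x + hnorm c x"
  have N: "?N x = hnorm all_pairs x + hnorm c x" if "x \<in> ?V" for x
    using l2_norm_eq_hnorm[of x] that by (simp add: l2_space_eq_hspace)
  have b: "hbounded all_pairs x" "hbounded c x" "hnorm c x \<le> hnorm all_pairs x" "0 \<le> hnorm all_pairs x" "0 \<le> hnorm c x" if "x \<in> ?V" for x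
    using hspace_hbounded[OF that] hnorm_le_all_pairs[OF hspace_hbounded[OF that], of c] hnorm_nonneg by auto
  note sub = hspace_subspace[of "all_pairs :: 'a \<Rightarrow> 'a \<Rightarrow> bool"]
  have norm: "is_norm_on ?V ?N"
    unfolding is_norm_on_def
  proof (intro conjI ballI allI sub)
    fix x y assume xy: "x \<in> ?V" "y \<in> ?V"
    show "0 \<le> ?N x" using N b xy by simp
    show "?N x = 0 \<longleftrightarrow> x = 0"
      using N[OF xy(1)] b[OF xy(1)] hnorm_eq_0[of all_pairs x] hnorm_0(2)[of all_pairs] hnorm_0(2)[of c] by auto
    show "?N (x + y) \<le> ?N x + ?N y"
      using N[OF xy(1)] N[OF xy(2)] N[OF subspace_add[OF sub xy]] hnorm_add(2)[OF b(1)[OF xy(1)] b(1)[OF xy(2)]]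
        hnorm_add(2)[OF b(2)[OF xy(1)] b(2)[OF xy(2)]] by linarith
    fix r
    show "?N (r *\<^sub>R x) = \<bar>r\<bar> * ?N x"
      using N[OF xy(1)] N[OF subspace_scale[OF sub xy(1), of r]] hnorm_scaleR(2)[OF b(1)[OF xy(1)], of r] hnorm_scaleR(2)[OF b(2)[OF xy(1)], of r]
      by (simp add: algebra_simps)
  qed
  then show "equivalent_norm (l2_space UNIV) l2_norm ?N"
    unfolding equivalent_norm_def l2_space_eq_hspace
  proof (intro conjI exI ballI)
    show "(0::real) < 1" "(0::real) < 2" by simp_all
    fix x assume x: "x \<in> ?V"
    then have "l2_norm x = hnorm all_pairs x" using N[OF x] by simp
    then show "1 * l2_norm x \<le> ?N x" "?N x \<le> 2 * l2_norm x" using b[OF x] by simp_all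
  qed
  show "strong_clique_norm c (l2_space UNIV) ?N 1"
    unfolding l2_space_eq_hspace
  proof
    show "is_norm_on ?V ?N" by (rule norm)
    show "y \<in> ?V" if "finite (supp y)" for y using that by (rule hspace_finite)
    show "?N y = 1 * L2_set y (supp y) + hnorm c y" if "finite (supp y)" for y
      using N[OF hspace_finite[OF that]] hnorm_all_pairs_finite[OF that] by simp
    show "\<bar>x i\<bar> \<le> ?N x" if "x \<in> ?V" for x i
      using N[OF that] b[OF that] abs_le_hnorm[OF b(1)[OF that], of i] by simp
    have bdd: "hbounded all_pairs (restr S x)" if "x \<in> ?V" for x S using b(1)[OF that] by (rule hnorm_restr)
    then show "restr S x \<in> ?V" if "x \<in> ?V" for x S using that by (intro hbounded_all_pairs_in_hspace)
    then show "?N (restr S x) \<le> ?N x" if "x \<in> ?V" for x S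
      using N that hnorm_restr(2)[OF b(1)[OF that], of S] hnorm_restr(2)[OF b(2)[OF that], of S] by fastforce
    show "\<exists>y. finite (supp y) \<and> ?N (x - y) < e" if x: "x \<in> ?V" and "0 < e" for x e
    proof -
      obtain y where y: "finite (supp y)" "hnorm all_pairs (x - y) < e / 2" using hspace_approx[OF x, of "e / 2"] \<open>0 < e\<close> by auto
      have "x - y \<in> ?V" using subspace_diff[OF sub x hspace_finite[OF y(1)]] .
      then have "?N (x - y) < e" using N b y by fastforce
      then show ?thesis using y by blast
    qed
  qed simp_all
qed

subsection \<open>Copies of \<open>l2\<close> in nonseparable subspaces\<close>

lemma sum_fun_apply: "(\<Sum>k\<in>A. f k) i = (\<Sum>k\<in>A. f k i :: real)"
  by (induction A rule: infinite_finite_induct) auto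

lemma hnorm_sum:
  assumes "\<And>k. k \<in> A \<Longrightarrow> hbounded c (f k)"
  shows "hbounded c (\<Sum>k\<in>A. f k) \<and> hnorm c (\<Sum>k\<in>A. f k) \<le> (\<Sum>k\<in>A. hnorm c (f k))"
  using assms
proof (induction A rule: infinite_finite_induct)
  case (insert k A)
  then have IH: "hbounded c (\<Sum>k\<in>A. f k)" "hnorm c (\<Sum>k\<in>A. f k) \<le> (\<Sum>k\<in>A. hnorm c (f k))" "hbounded c (f k)"
    by simp_all
  show ?case
    unfolding sum.insert[OF insert(1,2)] using hnorm_add[OF IH(3,1)] IH(2) by (intro conjI) (assumption, linarith)
qed (simp_all add: hnorm_0)

lemma sum_power2_at_most_one:
  fixes g :: "'k \<Rightarrow> real"
  assumes "\<And>k l. k \<in> A \<Longrightarrow> l \<in> A \<Longrightarrow> k \<noteq> l \<Longrightarrow> g k = 0 \<or> g l = 0"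
  shows "(\<Sum>k\<in>A. g k)\<^sup>2 = (\<Sum>k\<in>A. (g k)\<^sup>2)"
proof (cases "finite A \<and> (\<exists>k\<in>A. g k \<noteq> 0)")
  case True
  then obtain k where k: "k \<in> A" "g k \<noteq> 0" by blast
  then have "g l = 0" if "l \<in> A - {k}" for l using assms[of k l] that by auto
  then have "(\<Sum>l\<in>A - {k}. g l) = 0" "(\<Sum>l\<in>A - {k}. (g l)\<^sup>2) = 0" by simp_all
  then show ?thesis using True k(1) by (simp add: sum.remove)
qed (auto simp: sum.infinite)

text \<open>The blocks \<open>v\<close> are exactly disjoint but need not lie in \<open>W\<close>;
  the nearby \<open>u\<close> do. The errors in \<open>close\<close> sum to at most
  \<open>\<alpha> / 2\<close>, so half of the lower estimate for \<open>v\<close> survives for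
  \<open>u\<close>.\<close>

locale l2_blocks =
  fixes c :: "'i \<Rightarrow> 'i \<Rightarrow> bool" and W :: "('i \<Rightarrow> real) set"
    and u v :: "nat \<Rightarrow> 'i \<Rightarrow> real" and idx :: "nat \<Rightarrow> 'i" and \<alpha> B :: real
  assumes W: "closed_subspace_of W (hspace c) (hnorm c)" and u: "\<And>k. u k \<in> W"
    and v_finite: "\<And>k. finite (supp (v k))" and v_disjoint: "\<And>k l. k \<noteq> l \<Longrightarrow> supp (v k) \<inter> supp (v l) = {}"
    and \<alpha>: "0 < \<alpha>" "\<And>k. \<alpha> \<le> \<bar>v k (idx k)\<bar>" and B: "\<And>k. hnorm c (v k) \<le> B"
    and edges: "\<And>k l. k \<noteq> l \<Longrightarrow> c (idx k) (idx l)"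
    and close: "\<And>k. hnorm c (u k - v k) \<le> \<alpha> / 4 * (1 / 2) ^ k"
begin

lemma W_subspace: "subspace W" and W_hspace: "W \<subseteq> hspace c"
  using W unfolding closed_subspace_of_def by auto

lemma B_nonneg: "0 \<le> B"
  using B[of 0] hnorm_nonneg[OF hnorm_finite(1)[OF v_finite[of 0]], of c] by linarith

definition comb :: "(nat \<Rightarrow> 'i \<Rightarrow> real) \<Rightarrow> (nat \<Rightarrow> real) \<Rightarrow> nat set \<Rightarrow> 'i \<Rightarrow> real" where
  "comb f s A = (\<Sum>k\<in>A. s k *\<^sub>R f k)"

lemma comb_apply: "comb f s A i = (\<Sum>k\<in>A. s k * f k i)"
  by (simp add: comb_def sum_fun_apply)

lemma hbounded_v: "hbounded c (v k)"
  using v_finite by (rule hnorm_finite)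

lemma hbounded_u: "hbounded c (u k)"
  using u W_hspace hspace_hbounded by blast

lemma comb_in_W: "comb u s A \<in> W"
  unfolding comb_def using W_subspace u by (intro subspace_sum subspace_scale)

lemma hbounded_comb: "(\<And>k. hbounded c (f k)) \<Longrightarrow> hbounded c (comb f s A)"
  unfolding comb_def by (intro conjunct1[OF hnorm_sum] hnorm_scaleR)

lemma at_most_one: "k \<noteq> l \<Longrightarrow> s k * v k i = 0 \<or> s l * v l i = 0"
  using v_disjoint[of k l] by (auto simp: supp_def)

text \<open>Disjoint supports suffice: within each clique the squares of the blocks add up, and each
  block contributes at most \<open>B\<close>.\<close>

lemma comb_v_le:
  assumes "finite A"
  shows "hnorm c (comb v s A) \<le> B * L2_set s A"
proof (rule hnorm_leI)
  fix C assume C: "C \<in> cliques c"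
  have "(L2_set (comb v s A) C)\<^sup>2 = (\<Sum>i\<in>C. \<Sum>k\<in>A. (s k * v k i)\<^sup>2)"
    unfolding L2_set_power2 comb_apply
    by (rule sum.cong[OF refl], rule sum_power2_at_most_one, rule at_most_one)
  also have "\<dots> = (\<Sum>k\<in>A. (s k)\<^sup>2 * (L2_set (v k) C)\<^sup>2)"
    unfolding L2_set_power2 sum_distrib_left power_mult_distrib by (rule sum.swap)
  also have "\<dots> \<le> (\<Sum>k\<in>A. (s k)\<^sup>2 * B\<^sup>2)"
  proof (intro sum_mono mult_left_mono power_mono)
    show "L2_set (v k) C \<le> B" for k using L2_set_le_hnorm[OF hbounded_v C, of k] B[of k] by linarith
  qed auto
  also have "\<dots> = (B * L2_set s A)\<^sup>2"
    unfolding power_mult_distrib L2_set_power2 sum_distrib_left by (simp add: mult.commute)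
  finally show "L2_set (comb v s A) C \<le> B * L2_set s A"
    by (rule power2_le_imp_le) (use B_nonneg in simp)
qed

lemma comb_v_ge:
  assumes A: "finite A"
  shows "\<alpha> * L2_set s A \<le> hnorm c (comb v s A)"
proof -
  have "inj_on idx A"
  proof (rule inj_onI, rule ccontr)
    fix k l assume kl: "idx k = idx l" "k \<noteq> l"
    have "idx k \<in> supp (v k) \<inter> supp (v l)"
      using \<alpha>(1) \<alpha>(2)[of k] \<alpha>(2)[of l] kl(1) by (auto simp: supp_def)
    then show False using v_disjoint[OF kl(2)] by blast
  qed
  have val: "comb v s A (idx k) = s k * v k (idx k)" if "k \<in> A" for k
  proof -
    have "idx k \<in> supp (v k)" using \<alpha>(1) \<alpha>(2)[of k] by (auto simp: supp_def)
    then have "idx k \<notin> supp (v l)" if "l \<in> A - {k}" for l using v_disjoint[of k l] that by blast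
    then have "v l (idx k) = 0" if "l \<in> A - {k}" for l using that by (simp add: supp_def)
    then have "(\<Sum>l\<in>A - {k}. s l * v l (idx k)) = 0" by simp
    then show ?thesis unfolding comb_apply using A that by (simp add: sum.remove)
  qed
  have "(\<alpha> * L2_set s A)\<^sup>2 = (\<Sum>k\<in>A. (s k)\<^sup>2 * \<alpha>\<^sup>2)"
    unfolding power_mult_distrib L2_set_power2 sum_distrib_left by (simp add: mult.commute)
  also have "\<dots> \<le> (\<Sum>k\<in>A. (s k)\<^sup>2 * \<bar>v k (idx k)\<bar>\<^sup>2)"
    using \<alpha> by (intro sum_mono mult_left_mono power_mono) auto
  also have "\<dots> = (\<Sum>k\<in>A. (comb v s A (idx k))\<^sup>2)"
    by (intro sum.cong refl) (simp add: val power_mult_distrib)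
  also have "\<dots> = (L2_set (comb v s A) (idx ` A))\<^sup>2"
    unfolding L2_set_power2 using sum.reindex[OF \<open>inj_on idx A\<close>, of "\<lambda>i. (comb v s A i)\<^sup>2"] by (simp add: o_def)
  finally have "\<alpha> * L2_set s A \<le> L2_set (comb v s A) (idx ` A)" by (rule power2_le_imp_le) simp
  also have "\<dots> \<le> hnorm c (comb v s A)"
  proof (rule L2_set_le_hnorm[OF hbounded_comb[OF hbounded_v]])
    have "c (idx k) (idx l)" if "idx k \<noteq> idx l" for k l by (rule edges) (use that in auto)
    then show "idx ` A \<in> cliques c" using A by (simp add: cliques_def)
  qed
  finally show ?thesis .
qed

lemma comb_diff_le:
  assumes A: "finite A"
  shows "hnorm c (comb u s A - comb v s A) \<le> \<alpha> / 2 * L2_set s A"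
proof -
  have bd: "hbounded c (s k *\<^sub>R (u k - v k))" for k by (intro hnorm_scaleR hnorm_diff hbounded_u hbounded_v)
  have "comb u s A - comb v s A = (\<Sum>k\<in>A. s k *\<^sub>R (u k - v k))"
    unfolding comb_def sum_subtractf[symmetric] scaleR_diff_right ..
  then have "hnorm c (comb u s A - comb v s A) \<le> (\<Sum>k\<in>A. hnorm c (s k *\<^sub>R (u k - v k)))"
    using hnorm_sum[of A c "\<lambda>k. s k *\<^sub>R (u k - v k)"] bd by simp
  also have "\<dots> \<le> (\<Sum>k\<in>A. L2_set s A * (\<alpha> / 4 * (1 / 2) ^ k))"
  proof (rule sum_mono)
    fix k assume "k \<in> A"
    have "\<bar>s k\<bar> \<le> L2_set s A" using L2_set_mono_set[OF A, of "{k}" s] \<open>k \<in> A\<close> by (simp add: L2_set_def)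
    moreover have "hnorm c (s k *\<^sub>R (u k - v k)) = \<bar>s k\<bar> * hnorm c (u k - v k)"
      by (intro hnorm_scaleR hnorm_diff hbounded_u hbounded_v)
    ultimately show "hnorm c (s k *\<^sub>R (u k - v k)) \<le> L2_set s A * (\<alpha> / 4 * (1 / 2) ^ k)"
      using close[of k] hnorm_nonneg[OF hnorm_diff(1)[OF hbounded_u[of k] hbounded_v[of k]]]
      by (simp only:) (intro mult_mono; simp)
  qed
  also have "\<dots> = L2_set s A * (\<alpha> / 4) * (\<Sum>k\<in>A. (1 / 2) ^ k)" by (simp add: sum_distrib_left mult.assoc)
  also have "\<dots> \<le> L2_set s A * (\<alpha> / 4) * 2"
  proof (rule mult_left_mono)
    have "(\<Sum>k\<in>A. (1 / 2 :: real) ^ k) \<le> (\<Sum>k. (1 / 2) ^ k)" using A by (intro sum_le_suminf) auto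
    then show "(\<Sum>k\<in>A. (1 / 2 :: real) ^ k) \<le> 2" by (simp add: suminf_geometric)
  qed (use \<alpha> in simp)
  finally show ?thesis by (simp add: mult.commute)
qed

lemma comb_u_bounds:
  assumes A: "finite A"
  shows "hnorm c (comb u s A) \<le> (B + \<alpha> / 2) * L2_set s A" "\<alpha> / 2 * L2_set s A \<le> hnorm c (comb u s A)"
proof -
  have b: "hbounded c (comb u s A)" "hbounded c (comb v s A)" "hbounded c (comb u s A - comb v s A)"
    by (intro hbounded_comb hbounded_u hbounded_v hnorm_diff)+
  have "hnorm c (comb u s A) \<le> hnorm c (comb v s A) + hnorm c (comb u s A - comb v s A)"
    using hnorm_add(2)[OF b(2,3)] by simp
  then show "hnorm c (comb u s A) \<le> (B + \<alpha> / 2) * L2_set s A"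
    using comb_v_le[OF A, of s] comb_diff_le[OF A, of s] by (simp add: algebra_simps)
  have "hnorm c (comb v s A) \<le> hnorm c (comb u s A) + hnorm c (comb u s A - comb v s A)"
    using hnorm_diff(2)[OF b(1,3)] by simp
  then show "\<alpha> / 2 * L2_set s A \<le> hnorm c (comb u s A)"
    using comb_v_ge[OF A, of s] comb_diff_le[OF A, of s] by (simp add: algebra_simps)
qed

text \<open>Taking the limit coordinatewise gives a total function without choice; linearity on l2
  follows from uniqueness of real limits. Outside l2 the value may be junk.\<close>

definition embed :: "(nat \<Rightarrow> real) \<Rightarrow> 'i \<Rightarrow> real" where
  "embed s i = lim (\<lambda>n. comb u s {..<n} i)"

lemma l2_facts:
  assumes "s \<in> l2_space (UNIV :: nat set)"
  shows "summable (\<lambda>k. (s k)\<^sup>2)" "(\<lambda>n. L2_set s {..<n}) \<longlonglongrightarrow> l2_norm s"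
proof -
  have "((\<lambda>k. (s k)\<^sup>2) has_sum (\<Sum>\<^sub>\<infinity>k. (s k)\<^sup>2)) UNIV"
    using assms unfolding l2_space_def by (intro has_sum_infsum) auto
  then have sums: "(\<lambda>k. (s k)\<^sup>2) sums (\<Sum>\<^sub>\<infinity>k. (s k)\<^sup>2)" by (rule has_sum_imp_sums)
  then show "summable (\<lambda>k. (s k)\<^sup>2)" by (rule sums_summable)
  show "(\<lambda>n. L2_set s {..<n}) \<longlonglongrightarrow> l2_norm s"
    unfolding L2_set_def l2_norm_def using sums unfolding sums_def by (rule tendsto_real_sqrt)
qed

lemma embed_limit:
  assumes s: "s \<in> l2_space UNIV"
  shows "embed s \<in> W" "(\<lambda>n. hnorm c (comb u s {..<n} - embed s)) \<longlonglongrightarrow> 0"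
    "(\<lambda>n. comb u s {..<n} i) \<longlonglongrightarrow> embed s i"
proof -
  let ?C = "B + \<alpha> / 2"
  have C: "0 < ?C" using B_nonneg \<alpha> by simp
  have Cauchy: "\<exists>M. \<forall>m\<ge>M. \<forall>n\<ge>M. hnorm c (comb u s {..<m} - comb u s {..<n}) < e" if e: "0 < e" for e
  proof -
    have "0 < (e / ?C)\<^sup>2" using C e by simp
    then obtain M where M: "\<And>m n. m \<ge> M \<Longrightarrow> norm (\<Sum>k\<in>{m..<n}. (s k)\<^sup>2) < (e / ?C)\<^sup>2"
      using l2_facts(1)[OF s] unfolding summable_Cauchy by meson
    have le: "hnorm c (comb u s {..<n} - comb u s {..<m}) < e" if "M \<le> m" "m \<le> n" for m n
    proof -
      have "{..<n} = {..<m} \<union> {m..<n}" "{..<m} \<inter> {m..<n} = {}" using that by auto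
      then have "comb u s {..<n} = comb u s {..<m} + comb u s {m..<n}"
        unfolding comb_def by (simp add: sum.union_disjoint)
      then have "hnorm c (comb u s {..<n} - comb u s {..<m}) = hnorm c (comb u s {m..<n})" by simp
      also have "\<dots> \<le> ?C * L2_set s {m..<n}" by (rule comb_u_bounds) simp
      also have "L2_set s {m..<n} < e / ?C"
        unfolding L2_set_def using M[OF that(1), of n] C e by (intro real_less_lsqrt) (auto simp: sum_nonneg)
      then have "?C * L2_set s {m..<n} < e" using C by (simp add: field_simps)
      finally show ?thesis .
    qed
    have "hnorm c (comb u s {..<m} - comb u s {..<n}) < e" if "M \<le> m" "M \<le> n" for m n
      using le[of m n] le[of n m] that hnorm_minus_commute[of c "comb u s {..<m}" "comb u s {..<n}"] by (cases "m \<le> n") auto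
    then show ?thesis by blast
  qed
  obtain x where x: "x \<in> hspace c" "(\<lambda>n. hnorm c (comb u s {..<n} - x)) \<longlonglongrightarrow> 0" "\<And>i. (\<lambda>n. comb u s {..<n} i) \<longlonglongrightarrow> x i"
    by (rule hspace_Cauchy_limit[of "\<lambda>n. comb u s {..<n}" c]) (use comb_in_W W_hspace Cauchy in blast)+
  have "embed s = x"
  proof
    show "embed s i = x i" for i unfolding embed_def using x(3) by (rule limI)
  qed
  moreover have "x \<in> W"
  proof -
    have closed: "\<forall>p. \<forall>x\<in>hspace c. (\<forall>n :: nat. p n \<in> W) \<longrightarrow> (\<lambda>n. hnorm c (p n - x)) \<longlonglongrightarrow> 0 \<longrightarrow> x \<in> W"
      using W unfolding closed_subspace_of_def by (elim conjE)
    show ?thesis by (rule closed[rule_format, OF x(1) comb_in_W x(2)])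
  qed
  ultimately show "embed s \<in> W" "(\<lambda>n. hnorm c (comb u s {..<n} - embed s)) \<longlonglongrightarrow> 0"
    "(\<lambda>n. comb u s {..<n} i) \<longlonglongrightarrow> embed s i" using x by simp_all
qed

lemma embed_bounds:
  assumes s: "s \<in> l2_space UNIV"
  shows "\<alpha> / 2 * l2_norm s \<le> hnorm c (embed s)" "hnorm c (embed s) \<le> (B + \<alpha> / 2) * l2_norm s"
proof -
  have be: "hbounded c (embed s)" using embed_limit(1)[OF s] W_hspace hspace_hbounded by blast
  have bc: "hbounded c (comb u s {..<n})" for n by (intro hbounded_comb hbounded_u)
  note lim0 = embed_limit(2)[OF s] and limL = l2_facts(2)[OF s]
  have "(\<lambda>n. hnorm c (embed s) + hnorm c (comb u s {..<n} - embed s)) \<longlonglongrightarrow> hnorm c (embed s) + 0"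
    by (intro tendsto_intros lim0)
  moreover have "(\<lambda>n. \<alpha> / 2 * L2_set s {..<n}) \<longlonglongrightarrow> \<alpha> / 2 * l2_norm s" by (intro tendsto_intros limL)
  moreover have "\<alpha> / 2 * L2_set s {..<n} \<le> hnorm c (embed s) + hnorm c (comb u s {..<n} - embed s)" for n
  proof -
    have "hnorm c (comb u s {..<n}) \<le> hnorm c (embed s) + hnorm c (comb u s {..<n} - embed s)"
      using hnorm_add(2)[OF be hnorm_diff(1)[OF bc be], of n] by simp
    then show ?thesis using comb_u_bounds(2)[of "{..<n}" s] by simp
  qed
  ultimately show "\<alpha> / 2 * l2_norm s \<le> hnorm c (embed s)" using LIMSEQ_le by fastforce
  have "(\<lambda>n. (B + \<alpha> / 2) * L2_set s {..<n} + hnorm c (comb u s {..<n} - embed s)) \<longlonglongrightarrow> (B + \<alpha> / 2) * l2_norm s + 0"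
    by (intro tendsto_intros lim0 limL)
  moreover have "hnorm c (embed s) \<le> (B + \<alpha> / 2) * L2_set s {..<n} + hnorm c (comb u s {..<n} - embed s)" for n
  proof -
    have "hnorm c (embed s) \<le> hnorm c (comb u s {..<n}) + hnorm c (comb u s {..<n} - embed s)"
      using hnorm_diff(2)[OF bc hnorm_diff(1)[OF bc be], of n n] by simp
    then show ?thesis using comb_u_bounds(1)[of "{..<n}" s] by simp
  qed
  ultimately show "hnorm c (embed s) \<le> (B + \<alpha> / 2) * l2_norm s"
    using LIMSEQ_le_const[of _ "(B + \<alpha> / 2) * l2_norm s + 0" "hnorm c (embed s)"] by simp
qed

lemma contains_l2: "contains_l2 W (hnorm c)"
  unfolding contains_l2_def
proof (intro exI conjI)
  have sub: "subspace (l2_space (UNIV :: nat set))" unfolding l2_space_eq_hspace by (rule hspace_subspace)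
  show "embed ` l2_space UNIV \<subseteq> W" using embed_limit(1) by blast
  show "linear_on_set (l2_space UNIV) embed"
    unfolding linear_on_set_def
  proof (intro conjI ballI allI ext)
    fix s s' :: "nat \<Rightarrow> real" and i assume s: "s \<in> l2_space UNIV" "s' \<in> l2_space UNIV"
    have "(\<lambda>n. comb u s {..<n} i + comb u s' {..<n} i) \<longlonglongrightarrow> embed s i + embed s' i"
      by (intro tendsto_add embed_limit s)
    moreover have "comb u s {..<n} i + comb u s' {..<n} i = comb u (s + s') {..<n} i" for n
      by (simp add: comb_apply sum.distrib algebra_simps)
    ultimately have "(\<lambda>n. comb u (s + s') {..<n} i) \<longlonglongrightarrow> embed s i + embed s' i" by simp
    moreover have "(\<lambda>n. comb u (s + s') {..<n} i) \<longlonglongrightarrow> embed (s + s') i"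
      by (intro embed_limit subspace_add[OF sub] s)
    ultimately show "embed (s + s') i = (embed s + embed s') i" by (simp add: LIMSEQ_unique)
  next
    fix s :: "nat \<Rightarrow> real" and r i assume s: "s \<in> l2_space UNIV"
    have "(\<lambda>n. r * comb u s {..<n} i) \<longlonglongrightarrow> r * embed s i"
      by (intro tendsto_mult tendsto_const embed_limit s)
    moreover have "r * comb u s {..<n} i = comb u (r *\<^sub>R s) {..<n} i" for n
      by (simp add: comb_apply sum_distrib_left algebra_simps)
    ultimately have "(\<lambda>n. comb u (r *\<^sub>R s) {..<n} i) \<longlonglongrightarrow> r * embed s i" by (simp only:)
    moreover have "(\<lambda>n. comb u (r *\<^sub>R s) {..<n} i) \<longlonglongrightarrow> embed (r *\<^sub>R s) i"
      by (intro embed_limit subspace_scale[OF sub] s)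
    ultimately have "r * embed s i = embed (r *\<^sub>R s) i" by (rule LIMSEQ_unique)
    then show "embed (r *\<^sub>R s) i = (r *\<^sub>R embed s) i" by simp
  qed
  show "0 < \<alpha> / 2" using \<alpha> by simp
  show "\<forall>x\<in>l2_space UNIV. \<alpha> / 2 * l2_norm x \<le> hnorm c (embed x) \<and> hnorm c (embed x) \<le> (B + \<alpha> / 2) * l2_norm x"
    using embed_bounds by blast
qed

end

section \<open>Blocks along an infinite clique\<close>

context strong_coloring
begin

text \<open>If all degrees in \<open>I\<close> were countable there would be an uncountable
  independent set, in which the colouring nevertheless joins two points.\<close>

lemma ex_uncountable_degree:
  assumes "uncountable I"
  obtains i where "i \<in> I" "uncountable {j \<in> I. c i j}"
proof -
  have "\<exists>i\<in>I. uncountable {j \<in> I. c i j}"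
  proof (rule ccontr)
    assume "\<not> ?thesis"
    then have cnt: "\<And>i. i \<in> I \<Longrightarrow> countable {j \<in> I. c i j}" by blast
    obtain J where J: "J \<subseteq> I" "uncountable J" "pairwise (\<lambda>x y. \<not> c x y) J"
      by (rule uncountable_independent[OF assms sym cnt])
    obtain i j where "i \<in> J" "j \<in> J" "i \<noteq> j" "\<And>x y. x \<in> {i} \<Longrightarrow> y \<in> {j} \<Longrightarrow> c x y \<longleftrightarrow> True"
      by (rule strong_family[OF J(2), of "\<lambda>i. {i}" True]) auto
    then show False using J(3) unfolding pairwise_def by blast
  qed
  then show ?thesis using that by blast
qed

end

context strong_clique_norm
begin

text \<open>If the maximal \<open>1 / real (Suc n)\<close>-separated subsets were countable for
  every \<open>n\<close>, their union would be a countable dense set.\<close>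

lemma nonseparable_imp_separated:
  assumes W: "W \<subseteq> V" "\<not> separable_wrt W N"
  obtains \<delta> Y where "0 < \<delta>" "Y \<subseteq> W" "uncountable Y" "\<And>x y. x \<in> Y \<Longrightarrow> y \<in> Y \<Longrightarrow> x \<noteq> y \<Longrightarrow> \<delta> \<le> N (x - y)"
proof (rule ccontr)
  assume no: "\<not> thesis"
  define P where "P n x y \<longleftrightarrow> 1 / real (Suc n) \<le> N (x - y)" for n x y
  have "\<exists>J\<subseteq>W. pairwise (P n) J \<and> (\<forall>x\<in>W. x \<notin> J \<longrightarrow> (\<exists>y\<in>J. \<not> P n x y \<or> \<not> P n y x))" for n
    by (rule maximal_pairwise[of W "P n"]) blast
  then obtain J where J: "\<And>n. J n \<subseteq> W" "\<And>n. pairwise (P n) (J n)"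
    and max: "\<And>n x. x \<in> W \<Longrightarrow> x \<notin> J n \<Longrightarrow> \<exists>y\<in>J n. \<not> P n x y \<or> \<not> P n y x" by metis
  have cnt: "countable (J n)" for n
  proof (rule ccontr)
    assume "uncountable (J n)"
    moreover have "1 / real (Suc n) \<le> N (x - y)" if "x \<in> J n" "y \<in> J n" "x \<noteq> y" for x y
      using J(2)[of n] that unfolding pairwise_def P_def by blast
    ultimately show False using no that[of "1 / real (Suc n)" "J n"] J(1)[of n] by simp
  qed
  have "dense_in (\<Union>n. J n) W N"
    unfolding dense_in_def
  proof (intro ballI allI impI)
    fix x e assume x: "x \<in> W" and e: "(0 :: real) < e"
    obtain n where n: "1 / real (Suc n) < e" using nat_approx_posE[OF e] by blast
    show "\<exists>d\<in>\<Union>n. J n. N (x - d) < e"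
    proof (cases "x \<in> J n")
      case True
      have "N (x - x) = 0" using N_finite[of 0] hnorm_0(2)[of c] by (simp add: supp_def)
      then show ?thesis using True e by (intro bexI[of _ x]) auto
    next
      case False
      then obtain y where y: "y \<in> J n" "\<not> P n x y \<or> \<not> P n y x" using max x by blast
      have "x \<in> V" "y \<in> V" using x y(1) J(1) W(1) by auto
      then have "N (x - y) < e" using y(2) N_minus_commute[of x y] n unfolding P_def by auto
      then show ?thesis using y(1) by blast
    qed
  qed
  then have "separable_wrt W N"
    unfolding separable_wrt_def using cnt J(1) by (intro exI[of _ "\<Union>n. J n"]) auto
  then show False using W by blast
qed

text \<open>Taking a difference cancels the common part \<open>r\<close>, whose support is not under
  control, and leaves a block off \<open>F\<close>. The index \<open>i\<close> has uncountably many
  neighbours in \<open>J\<close>, so the construction can continue inside its neighbourhood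
  \<open>I'\<close>.\<close>

lemma ex_block:
  assumes I: "uncountable I" "\<And>i. i \<in> I \<Longrightarrow> w i \<in> V" "\<And>i. i \<in> I \<Longrightarrow> \<eta> \<le> \<bar>w i i\<bar>"
    and \<eta>: "0 < \<eta>" and e: "0 < e" and F: "finite F"
  obtains I' i j v where "I' \<subseteq> I" "uncountable I'" "i \<in> I" "j \<in> I" "\<And>k. k \<in> I' \<Longrightarrow> c i k"
    "finite (supp v)" "supp v \<inter> F = {}" "\<eta> / 2 \<le> \<bar>v i\<bar>" "N (w i - w j - v) \<le> e"
proof -
  define \<epsilon> where "\<epsilon> = min (e / 2) (\<eta> / 2)"
  have \<epsilon>: "0 < \<epsilon>" "\<epsilon> < \<eta>" "2 * \<epsilon> \<le> e" "\<epsilon> \<le> \<eta> / 2" using \<eta> e unfolding \<epsilon>_def by auto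
  obtain J r z where J: "J \<subseteq> I" "uncountable J" and r: "finite (supp r)"
    and z: "\<And>i. i \<in> J \<Longrightarrow> finite (supp (z i))" "\<And>i. i \<in> J \<Longrightarrow> supp (z i) \<inter> (supp r \<union> F) = {}"
    "\<And>i. i \<in> J \<Longrightarrow> \<eta> - \<epsilon> \<le> \<bar>z i i\<bar>" "\<And>i. i \<in> J \<Longrightarrow> N (w i - (r + z i)) < \<epsilon>"
    "\<And>i j. i \<in> J \<Longrightarrow> j \<in> J \<Longrightarrow> i \<noteq> j \<Longrightarrow> supp (z i) \<inter> supp (z j) = {}"
    by (rule common_part[OF I \<epsilon>(1,2) F]) (assumption, assumption, rule that)
  obtain i where i: "i \<in> J" "uncountable {j \<in> J. c i j}" by (rule ex_uncountable_degree[OF J(2)])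
  obtain j where j: "j \<in> J" "c i j" using i(2) by (metis (no_types, lifting) countable_empty empty_Collect_eq)
  have "i \<noteq> j" using j irrefl by blast
  have zi: "\<eta> / 2 \<le> \<bar>z i i\<bar>" using z(3)[OF i(1)] \<epsilon> by linarith
  have "i \<in> supp (z i)" using zi \<eta> by (auto simp: supp_def)
  \<comment> \<open>Subtracting \<open>z j\<close> therefore does not disturb the large coordinate
    \<open>i\<close>.\<close>
  then have "i \<notin> supp (z j)" using z(5)[OF i(1) j(1) \<open>i \<noteq> j\<close>] by blast
  then have "z j i = 0" by (simp add: supp_def)
  then have "\<eta> / 2 \<le> \<bar>(z i - z j) i\<bar>" using zi by simp
  moreover have "N (w i - w j - (z i - z j)) \<le> e"
  proof -
    let ?p = "w i - (r + z i)" and ?q = "w j - (r + z j)"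
    have V: "?p \<in> V" "?q \<in> V" using i j J I(2) finite_in r z(1) V_closed by auto
    have "?p - ?q = w i - w j - (z i - z j)" by simp
    moreover have "N (?p - ?q) \<le> e" using N_diff[OF V] z(4)[OF i(1)] z(4)[OF j(1)] \<epsilon>(3) by linarith
    ultimately show ?thesis by (simp only:)
  qed
  moreover have "finite (supp (z i - z j))" by (rule finite_subset[OF supp_diff]) (use z(1) i j in simp)
  moreover have "supp (z i - z j) \<inter> F = {}" using supp_diff[of "z i" "z j"] z(2)[OF i(1)] z(2)[OF j(1)] by blast
  moreover have "{j \<in> J. c i j} \<subseteq> I" "i \<in> I" "j \<in> I" using J i j by auto
  ultimately show ?thesis using that[of "{j \<in> J. c i j}" i j "z i - z j"] i(2) by blast
qed

lemma ex_block_sequence: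
  assumes I: "uncountable I" "\<And>i. i \<in> I \<Longrightarrow> w i \<in> V" "\<And>i. i \<in> I \<Longrightarrow> \<eta> \<le> \<bar>w i i\<bar>"
    and \<eta>: "0 < \<eta>" and e: "\<And>k :: nat. 0 < e k"
  obtains idx idx' v where "\<And>k. idx k \<in> I" "\<And>k. idx' k \<in> I" "\<And>k l. k \<noteq> l \<Longrightarrow> c (idx k) (idx l)"
    "\<And>k. finite (supp (v k))" "\<And>k l. k \<noteq> l \<Longrightarrow> supp (v k) \<inter> supp (v l) = {}"
    "\<And>k. \<eta> / 2 \<le> \<bar>v k (idx k)\<bar>" "\<And>k. N (w (idx k) - w (idx' k) - v k) \<le> e k"
proof -
  define P where "P k st \<longleftrightarrow> (case st of (I', F, i, j, v) \<Rightarrow> I' \<subseteq> I \<and> uncountable I' \<and> finite F \<and> i \<in> I \<and> j \<in> I \<and>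
     (\<forall>l\<in>I'. c i l) \<and> finite (supp v) \<and> supp v \<subseteq> F \<and> \<eta> / 2 \<le> \<bar>v i\<bar> \<and> N (w i - w j - v) \<le> e k)" for k st
  \<comment> \<open>The state holds the indices still available, the coordinates already used, and
    the current block. Since the available sets decrease, every later \<open>idx\<close> is joined
    to all earlier ones.\<close>
  define Q where "Q st st' \<longleftrightarrow> (case st of (I1, F1, i1, j1, v1) \<Rightarrow> case st' of (I2, F2, i2, j2, v2) \<Rightarrow>
     I2 \<subseteq> I1 \<and> F1 \<subseteq> F2 \<and> i2 \<in> I1 \<and> supp v2 \<inter> F1 = {})" 
    for st st' :: "'i set \<times> 'i set \<times> 'i \<times> 'i \<times> ('i \<Rightarrow> real)"
  have step: "\<exists>I2 F2 i2 j2 v2. P k (I2, F2, i2, j2, v2) \<and> I2 \<subseteq> I1 \<and> F1 \<subseteq> F2 \<and> i2 \<in> I1 \<and> supp v2 \<inter> F1 = {}"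
    if H: "I1 \<subseteq> I" "uncountable I1" "finite F1" for k I1 F1
  proof -
    have I1: "\<And>i. i \<in> I1 \<Longrightarrow> w i \<in> V" "\<And>i. i \<in> I1 \<Longrightarrow> \<eta> \<le> \<bar>w i i\<bar>" using I that by auto
    obtain I' i j v where "I' \<subseteq> I1" "uncountable I'" "i \<in> I1" "j \<in> I1" "\<And>k. k \<in> I' \<Longrightarrow> c i k"
      "finite (supp v)" "supp v \<inter> F1 = {}" "\<eta> / 2 \<le> \<bar>v i\<bar>" "N (w i - w j - v) \<le> e k"
      by (rule ex_block[OF H(2) I1 \<eta> e[of k] H(3)]) (assumption, assumption, rule that)
    then show ?thesis using H
      by (intro exI[of _ I'] exI[of _ "F1 \<union> supp v"] exI[of _ i] exI[of _ j] exI[of _ v]) (auto simp: P_def)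
  qed
  have "\<exists>f. \<forall>k. P k (f k) \<and> Q (f k) (f (Suc k))"
  proof (rule dependent_nat_choice)
    show "\<exists>st. P 0 st" using step[of I "{}" 0] I(1) by blast
    fix st k assume "P k st"
    then obtain I1 F1 i1 j1 v1 where st: "st = (I1, F1, i1, j1, v1)" "I1 \<subseteq> I" "uncountable I1" "finite F1"
      unfolding P_def by (cases st) auto
    show "\<exists>st'. P (Suc k) st' \<and> Q st st'"
      using step[OF st(2-4), of "Suc k"] unfolding Q_def st(1) by fastforce
  qed
  then obtain f where f: "\<And>k. P k (f k)" "\<And>k. Q (f k) (f (Suc k))" by blast
  define II where "II k = fst (f k)" for k
  define FF where "FF k = fst (snd (f k))" for k
  define idx where "idx k = fst (snd (snd (f k)))" for k
  define idx' where "idx' k = fst (snd (snd (snd (f k))))" for k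
  define v where "v k = snd (snd (snd (snd (f k))))" for k
  have fk: "f k = (II k, FF k, idx k, idx' k, v k)" for k
    by (simp add: II_def FF_def idx_def idx'_def v_def)
  have P: "idx k \<in> I" "idx' k \<in> I" "\<And>l. l \<in> II k \<Longrightarrow> c (idx k) l" "finite (supp (v k))" "supp (v k) \<subseteq> FF k"
    "\<eta> / 2 \<le> \<bar>v k (idx k)\<bar>" "N (w (idx k) - w (idx' k) - v k) \<le> e k" for k
    using f(1)[of k] unfolding P_def fk by auto
  have Q: "II (Suc k) \<subseteq> II k" "FF k \<subseteq> FF (Suc k)" "idx (Suc k) \<in> II k" "supp (v (Suc k)) \<inter> FF k = {}" for k
    using f(2)[of k] unfolding Q_def fk by auto
  have anti: "II l \<subseteq> II k" and mono: "FF k \<subseteq> FF l" if "k \<le> l" for k l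
    using lift_Suc_antimono_le[of II, OF Q(1) that] lift_Suc_mono_le[of FF, OF Q(2) that] by auto
  have less: "c (idx k) (idx l) \<and> supp (v k) \<inter> supp (v l) = {}" if "k < l" for k l
  proof -
    obtain m where m: "l = Suc m" "k \<le> m" using \<open>k < l\<close> by (cases l) auto
    then show ?thesis using anti[OF m(2)] mono[OF m(2)] Q(3,4)[of m] P(3) P(5)[of k] by blast
  qed
  show ?thesis
  proof (rule that)
    show "c (idx k) (idx l)" "supp (v k) \<inter> supp (v l) = {}" if "k \<noteq> l" for k l
      using less[of k l] less[of l k] sym that by (auto simp: neq_iff)
  qed (rule P)+
qed

end

theorem nonseparable_contains_l2:
  assumes c: "strong_coloring c" and W: "closed_subspace_of W (hspace c) (hnorm c)" "\<not> separable_wrt W (hnorm c)"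
  shows "contains_l2 W (hnorm c)"
proof -
  interpret strong_clique_norm c "hspace c" "hnorm c" 0 by (rule strong_clique_norm_hspace[OF c])
  have sub: "subspace W" "W \<subseteq> hspace c" using W(1) unfolding closed_subspace_of_def by auto
  obtain \<delta> Y where Y: "0 < \<delta>" "Y \<subseteq> W" "uncountable Y" "\<And>x y. x \<in> Y \<Longrightarrow> y \<in> Y \<Longrightarrow> x \<noteq> y \<Longrightarrow> \<delta> \<le> hnorm c (x - y)"
    by (rule nonseparable_imp_separated[OF sub(2) W(2)]) (rule that)
  have YV: "Y \<subseteq> hspace c" using Y sub by blast
  obtain \<eta> B I w where \<eta>: "0 < \<eta>" and I: "uncountable I" "inj_on w I" and w: "\<And>i. i \<in> I \<Longrightarrow> w i \<in> Y"
    "\<And>i. i \<in> I \<Longrightarrow> \<eta> \<le> \<bar>w i i\<bar>" "\<And>i. i \<in> I \<Longrightarrow> hnorm c (w i) \<le> B"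
    by (rule spread_coordinates[OF YV Y(3,1)]) (rule Y(4), assumption+, rule that)
  have wV: "\<And>i. i \<in> I \<Longrightarrow> w i \<in> hspace c" using w YV by blast
  \<comment> \<open>This is the error allowed by \<open>close\<close> for the lower bound
    \<open>\<eta> / 2\<close>.\<close>
  define e where "e k = \<eta> / 8 * (1 / 2) ^ k" for k :: nat
  have e: "\<And>k. 0 < e k" unfolding e_def using \<eta> by simp
  obtain idx idx' v where idx: "\<And>k. idx k \<in> I" "\<And>k. idx' k \<in> I" "\<And>k l. k \<noteq> l \<Longrightarrow> c (idx k) (idx l)"
    and v: "\<And>k. finite (supp (v k))" "\<And>k l. k \<noteq> l \<Longrightarrow> supp (v k) \<inter> supp (v l) = {}"
    "\<And>k. \<eta> / 2 \<le> \<bar>v k (idx k)\<bar>" "\<And>k. hnorm c (w (idx k) - w (idx' k) - v k) \<le> e k"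
    by (rule ex_block_sequence[OF I(1) wV w(2) \<eta> e]) (assumption, assumption, rule that)
  \<comment> \<open>A difference of two vectors \<open>w\<close> has norm at most
    \<open>2 * B\<close>, and the block differs from it by at most \<open>e k\<close>, hence by at
    most \<open>\<eta>\<close>.\<close>
  interpret l2_blocks c W "\<lambda>k. w (idx k) - w (idx' k)" v idx "\<eta> / 2" "2 * B + \<eta>"
  proof
    show "w (idx k) - w (idx' k) \<in> W" for k
      using w(1) idx Y(2) by (intro subspace_diff[OF sub(1)]) auto
    show "hnorm c (v k) \<le> 2 * B + \<eta>" for k
    proof -
      let ?u = "w (idx k) - w (idx' k)"
      have b: "hbounded c (w (idx k))" "hbounded c (w (idx' k))"
        by (rule hspace_hbounded[OF wV[OF idx(1)]], rule hspace_hbounded[OF wV[OF idx(2)]])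
      have bu: "hbounded c ?u" "hnorm c ?u \<le> hnorm c (w (idx k)) + hnorm c (w (idx' k))" by (intro hnorm_diff b)+
      have "hnorm c (?u - (?u - v k)) \<le> hnorm c ?u + hnorm c (?u - v k)"
        by (intro hnorm_diff b hnorm_finite v)
      moreover have "e k \<le> \<eta>" unfolding e_def using \<eta> power_le_one[of "1 / 2 :: real" k] by (simp add: divide_le_eq)
      ultimately show ?thesis using bu(2) w(3)[OF idx(1)[of k]] w(3)[OF idx(2)[of k]] v(4)[of k] by simp
    qed
    show "hnorm c (w (idx k) - w (idx' k) - v k) \<le> \<eta> / 2 / 4 * (1 / 2) ^ k" for k
      using v(4)[of k] unfolding e_def by simp
  qed (use \<eta> W(1) v idx in auto)
  show ?thesis by (rule contains_l2)
qed

section \<open>Size and generation of the clique space\<close>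

lemma hspace_not_separable:
  fixes c :: "'i \<Rightarrow> 'i \<Rightarrow> bool"
  assumes "uncountable (UNIV :: 'i set)"
  shows "\<not> separable_wrt (hspace c) (hnorm c)"
proof
  assume "separable_wrt (hspace c) (hnorm c)"
  then obtain D where D: "countable D" "D \<subseteq> hspace c" and dense: "dense_in D (hspace c) (hnorm c)"
    unfolding separable_wrt_def by blast
  define b :: "'i \<Rightarrow> 'i \<Rightarrow> real" where "b i = (\<lambda>j. if j = i then 1 else 0)" for i
  have "supp (b i) = {i}" for i by (auto simp: b_def supp_def)
  then have b: "b i \<in> hspace c" for i by (intro hspace_finite) simp
  have "\<exists>d\<in>D. hnorm c (b i - d) < 1 / 2" for i
    using dense b[of i] unfolding dense_in_def by (meson half_gt_zero zero_less_one)
  then obtain d where d: "\<And>i. d i \<in> D" "\<And>i. hnorm c (b i - d i) < 1 / 2" by metis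
  have "inj d"
  proof (rule injI, rule ccontr)
    fix i j assume ij: "d i = d j" "i \<noteq> j"
    have hb: "hbounded c (b i - d i)" "hbounded c (b j - d j)"
      using b d(1) D(2) hspace_hbounded by (blast intro: hnorm_diff)+
    have "(b i - d i) i - (b j - d j) i = 1" using ij by (simp add: b_def)
    then show False
      using abs_le_hnorm[OF hb(1), of i] abs_le_hnorm[OF hb(2), of i] d(2)[of i] d(2)[of j] by linarith
  qed
  moreover have "countable (range d)" by (rule countable_subset[OF _ D(1)]) (use d in blast)
  ultimately show False using assms countable_image_inj_on by blast
qed

text \<open>The witness is the inclusion of l2, a contraction whose range contains all finitely
  supported vectors.\<close>

lemma hspace_hilbert_generated:
  fixes c :: "'i \<Rightarrow> 'i \<Rightarrow> bool"
  shows "hilbert_generated_by (UNIV :: 'i set) (hspace c) (hnorm c)"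
  unfolding hilbert_generated_by_def
proof (intro exI[of _ "\<lambda>x. x"] conjI)
  have le: "x \<in> hspace c \<and> hnorm c x \<le> 1 * l2_norm x" if x: "x \<in> l2_space UNIV" for x
  proof -
    have xh: "x \<in> hspace all_pairs" using x by (simp add: l2_space_eq_hspace)
    note b = hspace_hbounded[OF xh]
    have "x \<in> hspace c"
    proof (rule hspace_closed[OF hnorm_le_all_pairs(1)[OF b]])
      fix e :: real assume "0 < e"
      then obtain y where y: "finite (supp y)" "hnorm all_pairs (x - y) < e" using hspace_approx[OF xh] by blast
      have "hnorm c (x - y) \<le> hnorm all_pairs (x - y)"
        by (rule hnorm_le_all_pairs(2)[OF hnorm_diff(1)[OF b hnorm_finite(1)[OF y(1)]]])
      then have "hnorm c (x - y) < e" using y(2) by linarith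
      then show "\<exists>y\<in>hspace c. hnorm c (x - y) < e" using hspace_finite[OF y(1)] by blast
    qed
    then show ?thesis using hnorm_le_all_pairs(2)[OF b] l2_norm_eq_hnorm[OF x] by simp
  qed
  show "(\<lambda>x. x) ` l2_space UNIV \<subseteq> hspace c" using le by blast
  show "linear_on_set (l2_space UNIV) (\<lambda>x. x)" by (simp add: linear_on_set_def)
  show "\<exists>C. \<forall>x\<in>l2_space UNIV. hnorm c x \<le> C * l2_norm x" using le by blast
  show "dense_in ((\<lambda>x. x) ` l2_space UNIV) (hspace c) (hnorm c)"
    unfolding dense_in_def
  proof (intro ballI allI impI)
    fix x and e :: real assume "x \<in> hspace c" "0 < e"
    then obtain y where "finite (supp y)" "hnorm c (x - y) < e" using hspace_approx by blast
    then show "\<exists>d\<in>(\<lambda>x. x) ` l2_space UNIV. hnorm c (x - d) < e"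
      using hspace_finite[of y all_pairs] by (auto simp: l2_space_eq_hspace)
  qed
qed

subsection \<open>The two spaces\<close>

text \<open>A single graph serves both parts; only the norm built from it differs.\<close>

theorem theorem1p2:
  assumes nonmeager: "\<exists>A :: real set. \<not> meager A \<and> card_omega1 A"
    and omega1: "card_omega1 (UNIV :: 'i set)"
  shows "(\<exists>N. equivalent_norm (l2_space (UNIV :: 'i set)) l2_norm N \<and>
            \<not> (\<exists>Y \<subseteq> l2_space (UNIV :: 'i set). uncountable Y \<and> equilateral N Y))
       \<and> (\<exists>(X :: ('i \<Rightarrow> real) set) N. banach_space X N \<and> \<not> separable_wrt X N \<and>
            (\<exists>\<Gamma> :: 'i set. hilbert_generated_by \<Gamma> X N) \<and>
            (\<forall>W. closed_subspace_of W X N \<longrightarrow> \<not> separable_wrt W N \<longrightarrow> contains_l2 W N) \<and>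
            \<not> (\<exists>Y \<subseteq> unit_sphere_of X N. uncountable Y \<and> equilateral N Y) \<and>
            (\<forall>\<epsilon>>0. \<not> (\<exists>Y \<subseteq> unit_sphere_of X N. uncountable Y \<and> separated N (1 + \<epsilon>) Y)))"
proof -
  obtain c :: "'i \<Rightarrow> 'i \<Rightarrow> bool" where c: "strong_coloring c"
    by (rule ex_strong_coloring[OF nonmeager omega1])
  interpret L: strong_clique_norm c "l2_space UNIV" "\<lambda>x. l2_norm x + hnorm c x" 1
    by (rule strong_clique_norm_l2[OF c])
  interpret X: strong_clique_norm c "hspace c" "hnorm c" 0
    by (rule strong_clique_norm_hspace[OF c])
  have "\<exists>N. equivalent_norm (l2_space (UNIV :: 'i set)) l2_norm N \<and>
      \<not> (\<exists>Y \<subseteq> l2_space (UNIV :: 'i set). uncountable Y \<and> equilateral N Y)"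
    using strong_clique_norm_l2(2)[OF c] L.no_uncountable_equilateral by blast
  moreover have "\<not> separable_wrt (hspace c) (hnorm c)"
    using hspace_not_separable card_omega1_uncountable[OF omega1] by blast
  moreover have "\<not> (\<exists>Y \<subseteq> unit_sphere_of (hspace c) (hnorm c). uncountable Y \<and> equilateral (hnorm c) Y)"
    using X.no_uncountable_equilateral unfolding unit_sphere_of_def by blast
  moreover have "\<forall>\<epsilon>>0. \<not> (\<exists>Y \<subseteq> unit_sphere_of (hspace c) (hnorm c). uncountable Y \<and> separated (hnorm c) (1 + \<epsilon>) Y)"
    using X.no_uncountable_separated by blast
  ultimately show ?thesis
    using hspace_banach[of c] hspace_hilbert_generated[of c] nonseparable_contains_l2[OF c] by blast
qed

end
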